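(* Let $\Gamma$ be a connected metric graph of genus $g\geq 1$ and let $d\geq 1$ be an integer. If $\Gamma$ satisfies the Manin--Mumford condition in degree $d$, then for every effective divisor $D$ of degree $d$ on $\Gamma$, $$\#\big(\iota_D^{(d)}(\Gamma^d)\cap\mathrm{Jac}(\Gamma)_{\mathrm{tors}}\big)\leq\binom{3g-3}{d}.$$
   Context: A metric graph $\Gamma=(G,\ell)$ is the compact connected metric space obtained from a finite connected graph $G$ (loops and multiple edges allowed) with edge lengths $\ell:E(G)\to\mathbb{R}_{>0}$ by identifying each edge $e$ with a closed interval $[0,\ell(e)]$ and taking the path metric; $(G,\ell)$ is then called a model of $\Gamma$ (a metric graph has many models). The genus of $\Gamma$ is $g=\dim H_1(\Gamma,\mathbb{R})=\#E(G)-\#V(G)+1$. $\mathrm{Div}(\Gamma)$ is the free abelian group on the points of $\Gamma$, $\deg$ is the sum of coefficients, $\mathrm{Div}^0(\Gamma)=\ker(\deg)$, and a divisor is effective if all its coefficients are nonnegative. $\mathrm{PL}_{\mathbb{Z}}(\Gamma)$ is the set of continuous functions $f:\Gamma\to\mathbb{R}$ that are linear with integer slope (with respect to arc length) on each edge of some model of $\Gamma$. For such $f$, $\Delta(f)=-\sum_{x\in\Gamma}a_x\,x$, where $a_x$ is the sum of the outgoing slopes of $f$ at $x$. The Jacobian is $\mathrm{Jac}(\Gamma)=\mathrm{Div}^0(\Gamma)/\Delta(\mathrm{PL}_{\mathbb{Z}}(\Gamma))$, and $\mathrm{Jac}(\Gamma)_{\mathrm{tors}}$ is its torsion subgroup.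 For an effective divisor $D$ of degree $d$, the degree $d$ Abel--Jacobi map is $\iota_D^{(d)}:\Gamma^d\to\mathrm{Jac}(\Gamma)$, $(p_1,\ldots,p_d)\mapsto[p_1+\cdots+p_d-D]$; it depends only on the class $[D]$. $\Gamma$ satisfies the Manin--Mumford condition in degree $d$ if $\iota_D^{(d)}(\Gamma^d)\cap\mathrm{Jac}(\Gamma)_{\mathrm{tors}}$ is finite for every effective degree $d$ divisor class $[D]$. *)

theory Defs
  imports "HOL-Analysis.Analysis" "HOL-Algebra.Algebra" "Graph_Theory.Digraph_Component"
begin

section \<open>Metric graphs and their models\<close>

text \<open>
  The combinatorial graph underlying a model is a finite \<open>pre_digraph\<close> (loops and parallel arcs
  are allowed): the direction of an arc \<open>e\<close> only records which end of \<open>[0, len e]\<close> is glued to which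
  vertex, and connectedness is that of the underlying undirected graph.  Its vertices are
  points of the metric graph, and \<open>\<phi> e\<close> parametrizes the edge \<open>e\<close> by arc length.

  \<open>edge_path G len \<phi> x y L\<close>: there is a path of length \<open>L\<close> from \<open>x\<close> to \<open>y\<close> which is a concatenation
  of finitely many segments, each contained in a single edge.
\<close>

inductive edge_path ::
    "('a, 'e) pre_digraph \<Rightarrow> ('e \<Rightarrow> real) \<Rightarrow> ('e \<Rightarrow> real \<Rightarrow> 'a) \<Rightarrow> 'a \<Rightarrow> 'a \<Rightarrow> real \<Rightarrow> bool"
  for G len \<phi> where
  edge_path_refl: "edge_path G len \<phi> x x 0"
| edge_path_step: "\<lbrakk>edge_path G len \<phi> x (\<phi> e s) L; e \<in> arcs G; s \<in> {0..len e}; t \<in> {0..len e}\<rbrakk>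
    \<Longrightarrow> edge_path G len \<phi> x (\<phi> e t) (L + \<bar>t - s\<bar>)"

text \<open>
  \<open>is_model \<Gamma> G len \<phi>\<close>: the metric space \<open>\<Gamma>\<close> is obtained from the finite connected graph \<open>G\<close> by
  identifying each edge \<open>e\<close> with \<open>[0, len e]\<close>; the only points identified with each other are
  endpoints of edges, according to the incidences of \<open>G\<close>, and the distance is the path metric.
\<close>

definition is_model ::
    "'a metric \<Rightarrow> ('a, 'e) pre_digraph \<Rightarrow> ('e \<Rightarrow> real) \<Rightarrow> ('e \<Rightarrow> real \<Rightarrow> 'a) \<Rightarrow> bool" where
  "is_model \<Gamma> G len \<phi> \<longleftrightarrow>
     fin_digraph G \<and> Digraph_Component.connected G \<and>
     (\<forall>e\<in>arcs G. 0 < len e \<and> \<phi> e 0 = tail G e \<and> \<phi> e (len e) = head G e \<and>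
        (\<forall>t\<in>{0<..<len e}. \<phi> e t \<notin> verts G)) \<and>
     inj_on (\<lambda>(e, t). \<phi> e t) (SIGMA e:arcs G. {0<..<len e}) \<and>
     mspace \<Gamma> = verts G \<union> (\<Union>e\<in>arcs G. \<phi> e ` {0..len e}) \<and>
     (\<forall>x\<in>mspace \<Gamma>. \<forall>y\<in>mspace \<Gamma>. mdist \<Gamma> x y = Inf {L. edge_path G len \<phi> x y L})"

text \<open>
  Quantifying only over models whose edges are named by natural numbers is no restriction, since
  edge sets are finite.
\<close>

definition metric_graph :: "'a metric \<Rightarrow> bool" where
  "metric_graph \<Gamma> \<longleftrightarrow> (\<exists>(G :: ('a, nat) pre_digraph) len \<phi>. is_model \<Gamma> G len \<phi>)"

text \<open>The value is the same for all models of \<open>\<Gamma>\<close>, so the choice is immaterial.\<close>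

definition genus :: "'a metric \<Rightarrow> nat" where
  "genus \<Gamma> = (SOME g. \<exists>(G :: ('a, nat) pre_digraph) len \<phi>. is_model \<Gamma> G len \<phi> \<and>
      int g = int (card (arcs G)) - int (card (verts G)) + 1)"


section \<open>Divisors\<close>

definition Div :: "'a metric \<Rightarrow> ('a \<Rightarrow>\<^sub>0 int) monoid" where
  "Div \<Gamma> = free_Abelian_group (mspace \<Gamma>)"

definition deg :: "('a \<Rightarrow>\<^sub>0 int) \<Rightarrow> int" where
  "deg D = (\<Sum>x\<in>Poly_Mapping.keys D. Poly_Mapping.lookup D x)"

definition effective :: "('a \<Rightarrow>\<^sub>0 int) \<Rightarrow> bool" where
  "effective D \<longleftrightarrow> (\<forall>x. 0 \<le> Poly_Mapping.lookup D x)"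

definition Div0 :: "'a metric \<Rightarrow> ('a \<Rightarrow>\<^sub>0 int) monoid" where
  "Div0 \<Gamma> = (Div \<Gamma>)\<lparr>carrier := kernel (Div \<Gamma>) integer_group deg\<rparr>"


section \<open>Piecewise linear functions and principal divisors\<close>

text \<open>On every edge \<open>e\<close> of the model, \<open>f\<close> is linear with integer slope \<open>m e\<close> from tail to head.\<close>

definition linear_on_edges ::
    "('a, 'e) pre_digraph \<Rightarrow> ('e \<Rightarrow> real) \<Rightarrow> ('e \<Rightarrow> real \<Rightarrow> 'a) \<Rightarrow> ('a \<Rightarrow> real) \<Rightarrow> ('e \<Rightarrow> int) \<Rightarrow> bool" where
  "linear_on_edges G len \<phi> f m \<longleftrightarrow>
     (\<forall>e\<in>arcs G. \<forall>t\<in>{0..len e}. f (\<phi> e t) = f (\<phi> e 0) + of_int (m e) * t)"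

text \<open>
  A function on \<open>\<Gamma>\<close> is represented by any function on the ambient type; its values outside of
  \<open>mspace \<Gamma>\<close> play no role.
\<close>

definition PL_Z :: "'a metric \<Rightarrow> ('a \<Rightarrow> real) set" where
  "PL_Z \<Gamma> = {f. continuous_map (mtopology_of \<Gamma>) euclideanreal f \<and>
     (\<exists>(G :: ('a, nat) pre_digraph) len \<phi> m. is_model \<Gamma> G len \<phi> \<and> linear_on_edges G len \<phi> f m)}"

text \<open>
  The sum of the outgoing slopes at a vertex \<open>v\<close>: the slope along an arc \<open>e\<close> is \<open>m e\<close> at its tail
  and \<open>- m e\<close> at its head, and a loop contributes at both of its ends.
\<close>

definition outgoing_slope_sum :: "('a, 'e) pre_digraph \<Rightarrow> ('e \<Rightarrow> int) \<Rightarrow> 'a \<Rightarrow> int" where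
  "outgoing_slope_sum G m v =
     (\<Sum>e | e \<in> arcs G \<and> tail G e = v. m e) + (\<Sum>e | e \<in> arcs G \<and> head G e = v. - m e)"

text \<open>
  In a model on whose edges \<open>f\<close> is linear, the two outgoing slopes at an interior point of an edge
  cancel, so only vertices contribute.  The resulting divisor does not depend on the model.
\<close>

definition Laplacian :: "'a metric \<Rightarrow> ('a \<Rightarrow> real) \<Rightarrow> ('a \<Rightarrow>\<^sub>0 int)" where
  "Laplacian \<Gamma> f = (SOME D. \<exists>(G :: ('a, nat) pre_digraph) len \<phi> m.
      is_model \<Gamma> G len \<phi> \<and> linear_on_edges G len \<phi> f m \<and>
      D = - (\<Sum>v\<in>verts G. frag_cmul (outgoing_slope_sum G m v) (frag_of v)))"


section \<open>The Jacobian and the Abel--Jacobi map\<close>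

definition Prin :: "'a metric \<Rightarrow> ('a \<Rightarrow>\<^sub>0 int) set" where
  "Prin \<Gamma> = Laplacian \<Gamma> ` PL_Z \<Gamma>"

definition Jac :: "'a metric \<Rightarrow> ('a \<Rightarrow>\<^sub>0 int) set monoid" where
  "Jac \<Gamma> = Div0 \<Gamma> Mod Prin \<Gamma>"

definition torsion :: "('g, 'm) monoid_scheme \<Rightarrow> 'g set" where
  "torsion A = {x \<in> carrier A. \<exists>n::nat. 0 < n \<and> x [^]\<^bsub>A\<^esub> n = \<one>\<^bsub>A\<^esub>}"

text \<open>A point of \<open>\<Gamma>\<^sup>d\<close> is a function in \<open>{..<d} \<rightarrow>\<^sub>E mspace \<Gamma>\<close>.\<close>

definition Abel_Jacobi ::
    "'a metric \<Rightarrow> nat \<Rightarrow> ('a \<Rightarrow>\<^sub>0 int) \<Rightarrow> (nat \<Rightarrow> 'a) \<Rightarrow> ('a \<Rightarrow>\<^sub>0 int) set" where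
  "Abel_Jacobi \<Gamma> d D p = Prin \<Gamma> #>\<^bsub>Div0 \<Gamma>\<^esub> ((\<Sum>i<d. frag_of (p i)) - D)"

definition Manin_Mumford :: "'a metric \<Rightarrow> nat \<Rightarrow> bool" where
  "Manin_Mumford \<Gamma> d \<longleftrightarrow>
     (\<forall>D\<in>carrier (Div \<Gamma>). effective D \<longrightarrow> deg D = int d \<longrightarrow>
        finite (Abel_Jacobi \<Gamma> d D ` ({..<d} \<rightarrow>\<^sub>E mspace \<Gamma>) \<inter> torsion (Jac \<Gamma>)))"

end

theory Submission
  imports Defs
begin

text \<open>
  Points on one edge move linearly in the Jacobian: the class of the point at distance \<open>t\<close> along the
  edge \<open>e\<close> is \<open>c (tail e) + \<delta> e t\<close> with \<open>\<delta> e\<close> additive, and the \<open>\<delta> e\<close> satisfy Kirchhoff's law at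
  every vertex.  These facts are all that the counting argument uses, so it is carried out for a graph
  with such data, in which vertices of valence at most two can be removed until there are at most
  \<open>3 g - 3\<close> edges.  Firing cuts on which every edge carries a chip shows that, for \<open>d \<le> g\<close>, every sum
  of \<open>d\<close> points is equivalent to one with its points on \<open>d\<close> distinct edges.  Once the edges are
  fixed, two different torsion classes would produce infinitely many, namely those which divide
  the segment between them in a rational ratio.  Hence torsion classes inject into the \<open>d\<close>-subsets of
  the edges.  For \<open>d \<ge> g\<close> the Manin--Mumford condition fails: chips in the interior of the edges
  outside a spanning tree move rigidly, and there are infinitely many torsion displacements of them.
\<close>

section \<open>Connectedness in terms of cuts\<close>

text \<open>Distinct edges alone are too weak an invariant for adding one chip after another: the
  induction also keeps a spanning tree free of chips. While there are fewer than \<open>g\<close>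
  chips, some edge lies outside both the tree and the chips, and firing steers the new chip towards
  it. The bound \<open>3 * g - 3\<close> stems from \<open>3 * card V \<le> 2 * card E\<close>,
  which gives \<open>card E \<le> 3 * (card E - card V)\<close>, and the difference is
  \<open>g - 1\<close>. The reduction to this case asks for \<open>g \<ge> 2\<close>; since the
  Manin--Mumford condition fails for \<open>d \<ge> g\<close>, it yields
  \<open>1 \<le> d < g\<close>. The analytic obstacle is that principal divisors come from functions
  that are linear on unrelated models, while \<open>Laplacian\<close> selects a model by choice.
  Slopes are therefore read off from small spheres of the metric. These are the same for all
  functions, so that \<open>Prin \<Gamma>\<close> is seen to be a subgroup without a common model of
  two functions.\<close>

definition joins :: "('e \<Rightarrow> 'v) \<Rightarrow> ('e \<Rightarrow> 'v) \<Rightarrow> 'e \<Rightarrow> 'v set \<Rightarrow> 'v set \<Rightarrow> bool" where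
  "joins src tgt e A B \<longleftrightarrow> src e \<in> A \<and> tgt e \<in> B \<or> src e \<in> B \<and> tgt e \<in> A"

text \<open>Connectedness of the graph with vertices \<open>W\<close> and those edges of
  \<open>T\<close> that have both ends in \<open>W\<close>, in terms of cuts. Edges leaving
  \<open>W\<close> are ignored, so one edge set can be tested on several vertex sets; the empty
  \<open>W\<close> counts as connected.\<close>

definition cut_conn :: "('e \<Rightarrow> 'v) \<Rightarrow> ('e \<Rightarrow> 'v) \<Rightarrow> 'e set \<Rightarrow> 'v set \<Rightarrow> bool" where
  "cut_conn src tgt T W \<longleftrightarrow> (\<forall>Z. Z \<subset> W \<longrightarrow> Z \<noteq> {} \<longrightarrow> (\<exists>e\<in>T. joins src tgt e Z (W - Z)))"

lemma joins_commute: "joins src tgt e A B \<longleftrightarrow> joins src tgt e B A"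
  by (auto simp: joins_def)

lemma cut_connD:
  assumes "cut_conn src tgt T W" "Z \<subset> W" "Z \<noteq> {}"
  obtains e where "e \<in> T" "joins src tgt e Z (W - Z)"
  using assms unfolding cut_conn_def by blast

lemma cut_conn_mono: "cut_conn src tgt T W \<Longrightarrow> T \<subseteq> T' \<Longrightarrow> cut_conn src tgt T' W"
  unfolding cut_conn_def by blast

lemma cut_conn_singleton: "cut_conn src tgt T {v}"
  unfolding cut_conn_def by (metis psubset_eq subset_singletonD)

lemma cut_conn_cong:
  assumes "cut_conn src tgt T W" "\<And>e. e \<in> T \<Longrightarrow> src e \<in> W \<Longrightarrow> tgt e \<in> W \<Longrightarrow> e \<in> T'"
  shows "cut_conn src tgt T' W"
  unfolding cut_conn_def
proof (intro allI impI)
  fix Z assume Z: "Z \<subset> W" "Z \<noteq> {}"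
  then obtain e where "e \<in> T" "joins src tgt e Z (W - Z)" using assms(1) cut_connD by metis
  then show "\<exists>e\<in>T'. joins src tgt e Z (W - Z)" using assms(2)[of e] Z by (auto simp: joins_def)
qed

text \<open>The common vertex \<open>v\<close> does the work: a set that contains it and fills both
  \<open>A\<close> and \<open>B\<close> is the whole union, and a set that avoids it and misses both
  is empty. Any other set cuts \<open>A\<close> or \<open>B\<close> properly.\<close>

lemma cut_conn_Un:
  assumes A: "cut_conn src tgt T A" and B: "cut_conn src tgt T B" and v: "v \<in> A" "v \<in> B"
  shows "cut_conn src tgt T (A \<union> B)"
  unfolding cut_conn_def
proof (intro allI impI)
  fix Z assume Z: "Z \<subset> A \<union> B" "Z \<noteq> {}"
  have "(Z \<inter> A \<subset> A \<and> Z \<inter> A \<noteq> {}) \<or> (Z \<inter> B \<subset> B \<and> Z \<inter> B \<noteq> {})"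
    using Z v by blast
  then show "\<exists>e\<in>T. joins src tgt e Z (A \<union> B - Z)"
  proof
    assume "Z \<inter> A \<subset> A \<and> Z \<inter> A \<noteq> {}"
    then obtain e where "e \<in> T" "joins src tgt e (Z \<inter> A) (A - Z \<inter> A)" using A cut_connD by metis
    then show ?thesis by (auto simp: joins_def)
  next
    assume "Z \<inter> B \<subset> B \<and> Z \<inter> B \<noteq> {}"
    then obtain e where "e \<in> T" "joins src tgt e (Z \<inter> B) (B - Z \<inter> B)" using B cut_connD by metis
    then show ?thesis by (auto simp: joins_def)
  qed
qed

lemma cut_conn_pair:
  assumes "e \<in> T" "joins src tgt e {v} {w}"
  shows "cut_conn src tgt T {v, w}"
  unfolding cut_conn_def
proof (intro allI impI)
  fix Z assume Z: "Z \<subset> {v, w}" "Z \<noteq> {}"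
  then have "v \<noteq> w" and "Z = {v} \<or> Z = {w}" by auto
  then have "joins src tgt e Z ({v, w} - Z)" using assms(2) by (auto simp: joins_def)
  with assms(1) show "\<exists>e\<in>T. joins src tgt e Z ({v, w} - Z)" by blast
qed

lemma cut_conn_join:
  assumes A: "cut_conn src tgt T A" and B: "cut_conn src tgt T B" and e: "e \<in> T" "joins src tgt e A B"
  shows "cut_conn src tgt T (A \<union> B)"
proof -
  obtain v w where vw: "v \<in> A" "w \<in> B" "joins src tgt e {v} {w}"
    using e(2) by (auto simp: joins_def)
  have "cut_conn src tgt T (A \<union> {v, w})"
    using cut_conn_Un[OF A cut_conn_pair[OF e(1) vw(3)]] vw by simp
  from cut_conn_Un[OF this B, of w] vw show ?thesis
    by (simp add: insert_absorb)
qed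

lemma cut_conn_insert:
  assumes "cut_conn src tgt T A" "e \<in> T" "joins src tgt e A {w}"
  shows "cut_conn src tgt T (insert w A)"
  using cut_conn_join[OF assms(1) cut_conn_singleton assms(2,3)] by simp

lemma ex_maximal_subset:
  assumes "finite W" "Z0 \<subseteq> W" "Q Z0"
  obtains Z where "Z \<subseteq> W" "Q Z" "\<And>x. x \<in> W \<Longrightarrow> x \<notin> Z \<Longrightarrow> \<not> Q (insert x Z)"
proof -
  let ?S = "{Z. Z \<subseteq> W \<and> Q Z}"
  have fin: "finite ?S" using assms(1) by simp
  have ne: "?S \<noteq> {}" using assms by auto
  obtain Z where Z: "Z \<in> ?S" "\<forall>Y\<in>?S. Z \<subseteq> Y \<longrightarrow> Z = Y"
    using finite_has_maximal[OF fin ne] by auto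
  have "\<not> Q (insert x Z)" if "x \<in> W" "x \<notin> Z" for x
  proof
    assume "Q (insert x Z)"
    then have "insert x Z \<in> ?S" using Z \<open>x \<in> W\<close> by simp
    then have "Z = insert x Z" using Z(2) by blast
    then show False using \<open>x \<notin> Z\<close> by blast
  qed
  then show ?thesis using Z(1) by (intro that[of Z]) auto
qed

text \<open>The tree is grown as a maximal vertex set \<open>Z\<close> that is spanned by a tree
  inside it; a tree is recorded as a connected edge set with one edge fewer than vertices.\<close>

lemma ex_spanning_tree:
  assumes fin: "finite W" "finite T" and W: "v \<in> W" and conn: "cut_conn src tgt T W"
  obtains S where "S \<subseteq> T" "cut_conn src tgt S W" "card S + 1 = card W"
proof -
  define Q where "Q Z \<longleftrightarrow> v \<in> Z \<and> (\<exists>S. S \<subseteq> T \<and> (\<forall>e\<in>S. src e \<in> Z \<and> tgt e \<in> Z) \<and> cut_conn src tgt S Z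
      \<and> card S + 1 = card Z)" for Z
  have "Q {v}" unfolding Q_def by (auto intro!: exI[of _ "{}"] cut_conn_singleton)
  then obtain Z where Z: "Z \<subseteq> W" "Q Z" and mx: "\<And>x. x \<in> W \<Longrightarrow> x \<notin> Z \<Longrightarrow> \<not> Q (insert x Z)"
    using ex_maximal_subset[of W "{v}" Q] fin W by auto
  obtain S where S: "S \<subseteq> T" "\<forall>e\<in>S. src e \<in> Z \<and> tgt e \<in> Z" "cut_conn src tgt S Z"
      "card S + 1 = card Z" "v \<in> Z"
    using Z(2) Q_def by auto
  have "Z = W"
  proof (rule ccontr)
    assume "Z \<noteq> W"
    then have "Z \<subset> W" using Z by auto
    then obtain e where e: "e \<in> T" "joins src tgt e Z (W - Z)" using cut_connD[OF conn] S(5) by blast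
    then obtain w where w: "w \<in> W" "w \<notin> Z" "joins src tgt e Z {w}" by (auto simp: joins_def)
    have "e \<notin> S" using S(2) w by (auto simp: joins_def)
    moreover have "finite S" "finite Z" using S(1) Z(1) fin finite_subset by auto
    ultimately have "card (insert e S) + 1 = card (insert w Z)" using S(4) w by simp
    moreover have "cut_conn src tgt (insert e S) (insert w Z)"
      using cut_conn_insert[OF cut_conn_mono[OF S(3)] _ w(3)] by blast
    moreover have "\<forall>e'\<in>insert e S. src e' \<in> insert w Z \<and> tgt e' \<in> insert w Z"
      using S(2) w by (auto simp: joins_def)
    moreover have "insert e S \<subseteq> T" "v \<in> insert w Z" using S e by auto
    ultimately have "Q (insert w Z)" unfolding Q_def by metis
    then show False using mx w by blast
  qed
  then show ?thesis using that[of S] S by simp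
qed

lemma card_le_cut_conn:
  assumes "finite W" "finite T" "cut_conn src tgt T W"
  shows "card W \<le> card T + 1"
proof (cases "W = {}")
  case False
  then obtain v where "v \<in> W" by auto
  from ex_spanning_tree[OF assms(1,2) this assms(3)] obtain S where "S \<subseteq> T" "card S + 1 = card W" by metis
  then have "card S \<le> card T" "card S + 1 = card W" using card_mono[OF assms(2)] by auto
  then show ?thesis by linarith
qed simp

text \<open>\<open>W'\<close> is the component of \<open>v\<close> in \<open>W - {p}\<close>. The
  other components hang on \<open>p\<close>, so they stay connected with the rest when
  \<open>W'\<close> is cut off. This serves to push a chip at \<open>p\<close> further towards
  \<open>v\<close>.\<close>

lemma cut_conn_remove_vertex:
  assumes fin: "finite V" and WV: "W \<subseteq> V" and W: "cut_conn src tgt T W"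
    and U: "cut_conn src tgt T (insert p (V - W))"
    and p: "p \<in> W" and v: "v \<in> W" and pv: "p \<noteq> v"
  obtains W' e where "W' \<subset> W" "v \<in> W'" "cut_conn src tgt T W'" "cut_conn src tgt T (V - W')"
    "e \<in> T" "joins src tgt e {p} W'" "p \<notin> W'"
proof -
  define Q where "Q Z \<longleftrightarrow> v \<in> Z \<and> cut_conn src tgt T Z" for Z
  have "Q {v}" by (simp add: Q_def cut_conn_singleton)
  moreover have "finite (W - {p})" using fin WV finite_subset by auto
  ultimately obtain W' where W': "W' \<subseteq> W - {p}" "Q W'"
      and mx: "\<And>x. x \<in> W - {p} \<Longrightarrow> x \<notin> W' \<Longrightarrow> \<not> Q (insert x W')"
    using ex_maximal_subset[of "W - {p}" "{v}" Q] v pv by auto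
  have noext: "x = p" if "e \<in> T" "joins src tgt e W' {x}" "x \<in> W" "x \<notin> W'" for e x
    using mx[of x] that W'(2) cut_conn_insert[of src tgt T W' e x] unfolding Q_def by auto
  have "W' \<subset> W" using W' p by auto
  moreover have "v \<in> W'" "cut_conn src tgt T W'" using W'(2) Q_def by auto
  ultimately obtain e where e: "e \<in> T" "joins src tgt e W' (W - W')" using W cut_connD by (metis empty_iff)
  then obtain x where x: "x \<in> W" "x \<notin> W'" "joins src tgt e W' {x}" by (auto simp: joins_def)
  have "joins src tgt e {p} W'" using noext[OF e(1) x(3,1,2)] x(3) by (simp add: joins_commute)
  \<comment> \<open>A set without \<open>p\<close> has an edge to its outside in \<open>W\<close>,
    which by \<open>noext\<close> cannot end in \<open>W'\<close>; a set with \<open>p\<close> is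
    replaced by its complement.\<close>
  have rest: "cut_conn src tgt T (W - W')"
    unfolding cut_conn_def
  proof (intro allI impI)
    fix Z assume Z: "Z \<subset> W - W'" "Z \<noteq> {}"
    have *: "\<exists>e\<in>T. joins src tgt e Y (W - W' - Y)" if Y: "Y \<subset> W - W'" "Y \<noteq> {}" "p \<notin> Y" for Y
    proof -
      have "Y \<subset> W" using Y by auto
      then obtain e where e: "e \<in> T" "joins src tgt e Y (W - Y)" using W Y cut_connD by metis
      have "\<not> joins src tgt e Y W'"
      proof
        assume "joins src tgt e Y W'"
        then obtain y where "y \<in> Y" "joins src tgt e W' {y}" by (auto simp: joins_def)
        then show False using noext[of e y] e(1) Y by auto
      qed
      then show ?thesis using e by (auto simp: joins_def)
    qed
    show "\<exists>e\<in>T. joins src tgt e Z (W - W' - Z)"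
    proof (cases "p \<in> Z")
      case True
      then have "\<exists>e\<in>T. joins src tgt e (W - W' - Z) (W - W' - (W - W' - Z))" using Z by (intro *) auto
      moreover have "W - W' - (W - W' - Z) = Z" using Z by auto
      ultimately show ?thesis by (simp add: joins_commute)
    qed (use * Z in auto)
  qed
  have "insert p (V - W) \<union> (W - W') = V - W'" using WV W' p by auto
  with cut_conn_Un[OF U rest, of p] p W'(1) have "cut_conn src tgt T (V - W')" by auto
  then show ?thesis using that[of W' e] \<open>W' \<subset> W\<close> W' e \<open>joins src tgt e {p} W'\<close> Q_def by auto
qed

text \<open>Here \<open>e\<close> is a bridge and \<open>W\<close> is the side of \<open>v\<close>
  after its removal. The far side stays connected because only one end of \<open>e\<close> lies
  there: of a set and its complement in the far side, one avoids \<open>e\<close>.\<close>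

lemma cut_conn_remove_edge:
  assumes fin: "finite V" and V: "cut_conn src tgt T V" and e: "e \<in> T" and v: "v \<in> V"
    and nc: "\<not> cut_conn src tgt (T - {e}) V"
  obtains W where "W \<subset> V" "v \<in> W" "cut_conn src tgt T W" "cut_conn src tgt T (V - W)"
    "joins src tgt e (V - W) W" "\<And>e'. e' \<in> T \<Longrightarrow> joins src tgt e' (V - W) W \<Longrightarrow> e' = e"
proof -
  define Q where "Q Z \<longleftrightarrow> v \<in> Z \<and> cut_conn src tgt (T - {e}) Z" for Z
  have "Q {v}" by (simp add: Q_def cut_conn_singleton)
  then obtain W where W: "W \<subseteq> V" "Q W"
      and mx: "\<And>x. x \<in> V \<Longrightarrow> x \<notin> W \<Longrightarrow> \<not> Q (insert x W)"
    using ex_maximal_subset[of V "{v}" Q] v fin by auto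
  have vW: "v \<in> W" using W Q_def by auto
  have WV: "W \<subset> V" using W nc unfolding Q_def by auto
  have nocross: "e' = e" if e'T: "e' \<in> T" and e'j: "joins src tgt e' (V - W) W" for e'
  proof (rule ccontr)
    assume ne: "e' \<noteq> e"
    obtain x where "x \<in> V - W" "joins src tgt e' W {x}" using e'j by (auto simp: joins_def)
    then have "Q (insert x W)" using cut_conn_insert[of src tgt "T - {e}" W e' x] e'T ne W(2)
      unfolding Q_def by auto
    then show False using mx \<open>x \<in> V - W\<close> by auto
  qed
  obtain e' where e': "e' \<in> T" "joins src tgt e' W (V - W)" using cut_connD[OF V WV] vW by blast
  then have je: "joins src tgt e (V - W) W" using nocross[of e'] by (auto simp: joins_commute)
  have "cut_conn src tgt T (V - W)"
    unfolding cut_conn_def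
  proof (intro allI impI)
    fix Z assume Z: "Z \<subset> V - W" "Z \<noteq> {}"
    have *: "\<exists>e\<in>T. joins src tgt e Y (V - W - Y)" 
      if Y: "Y \<subset> V - W" "Y \<noteq> {}" "src e \<notin> Y" "tgt e \<notin> Y" for Y
    proof -
      have "Y \<subset> V" using Y by auto
      then obtain e1 where e1: "e1 \<in> T" "joins src tgt e1 Y (V - Y)" using V Y cut_connD by metis
      have "e1 \<noteq> e" using e1(2) Y by (auto simp: joins_def)
      then have "\<not> joins src tgt e1 (V - W) W" using nocross e1 by auto
      then show ?thesis using e1 Y by (auto simp: joins_def intro!: bexI[of _ e1])
    qed
    show "\<exists>e\<in>T. joins src tgt e Z (V - W - Z)"
    proof (cases "src e \<in> Z \<or> tgt e \<in> Z")
      case True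
      then have "src e \<notin> V - W - Z \<and> tgt e \<notin> V - W - Z"
        using je Z(1) by (auto simp: joins_def)
      then have "\<exists>e\<in>T. joins src tgt e (V - W - Z) (V - W - (V - W - Z))" using Z by (intro *) auto
      moreover have "V - W - (V - W - Z) = Z" using Z by auto
      ultimately show ?thesis by (simp add: joins_commute)
    qed (use * Z in auto)
  qed
  moreover have "cut_conn src tgt T W" using W(2) cut_conn_mono[of src tgt "T - {e}" W T] unfolding Q_def by auto
  ultimately show ?thesis using that[of W] WV vW je nocross by blast
qed

section \<open>Graphs with additive edge functions\<close>

lemma frag_cmul_minus2 [simp]: "frag_cmul k (- x) = - frag_cmul k x"
  by (rule poly_mapping_eqI) simp

lemma frag_cmul_diff2: "frag_cmul k (x - y) = frag_cmul k x - frag_cmul k y"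
  using frag_cmul_distrib2[of k x "- y"] by (simp del: minus_frag_cmul)

section \<open>Congruence modulo a subgroup of divisors\<close>

locale frag_subgroup =
  fixes P :: "('a \<Rightarrow>\<^sub>0 int) set"
  assumes zero_mem: "0 \<in> P" and diff_mem: "\<And>x y. x \<in> P \<Longrightarrow> y \<in> P \<Longrightarrow> x - y \<in> P"
begin

text \<open>With \<open>Prin \<Gamma>\<close> in place of \<open>P\<close> this is linear
  equivalence of divisors.\<close>

definition eqv :: "('a \<Rightarrow>\<^sub>0 int) \<Rightarrow> ('a \<Rightarrow>\<^sub>0 int) \<Rightarrow> bool" (infix \<open>\<doteq>\<close> 50) where
  "x \<doteq> y \<longleftrightarrow> x - y \<in> P"

lemma uminus_mem: "x \<in> P \<Longrightarrow> - x \<in> P"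
  using diff_mem[OF zero_mem] by force

lemma add_mem: "x \<in> P \<Longrightarrow> y \<in> P \<Longrightarrow> x + y \<in> P"
  using diff_mem[of x "- y"] uminus_mem[of y] by simp

lemma eqv_refl [simp]: "x \<doteq> x"
  by (simp add: eqv_def zero_mem)

lemma eqv_sym: "x \<doteq> y \<Longrightarrow> y \<doteq> x"
  unfolding eqv_def using uminus_mem by fastforce

lemma eqv_trans [trans]: "x \<doteq> y \<Longrightarrow> y \<doteq> z \<Longrightarrow> x \<doteq> z"
  unfolding eqv_def using add_mem[of "x - y" "y - z"] by simp

lemma eqv_add: "x \<doteq> y \<Longrightarrow> x' \<doteq> y' \<Longrightarrow> x + x' \<doteq> y + y'"
  unfolding eqv_def using add_mem[of "x - y" "x' - y'"] by (simp add: algebra_simps)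

lemma eqv_minus: "x \<doteq> y \<Longrightarrow> - x \<doteq> - y"
  unfolding eqv_def using uminus_mem[of "x - y"] by (simp add: algebra_simps)

lemma eqv_diff: "x \<doteq> y \<Longrightarrow> x' \<doteq> y' \<Longrightarrow> x - x' \<doteq> y - y'"
  using eqv_add[of x y "- x'" "- y'"] eqv_minus[of x' y'] by simp

lemma eqv_sum: "(\<And>i. i \<in> A \<Longrightarrow> f i \<doteq> g i) \<Longrightarrow> sum f A \<doteq> sum g A"
  by (induction A rule: infinite_finite_induct) (auto intro: eqv_add)

lemma cmul_mem: "x \<in> P \<Longrightarrow> frag_cmul k x \<in> P"
  by (rule frag_closure_minus_cmul[where P = "\<lambda>x. x \<in> P"]) (auto intro: zero_mem diff_mem)

lemma eqv_cmul: "x \<doteq> y \<Longrightarrow> frag_cmul k x \<doteq> frag_cmul k y"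
  unfolding eqv_def using cmul_mem[of "x - y" k] by (simp add: frag_cmul_diff2)

lemma eqv_0_iff: "x \<doteq> 0 \<longleftrightarrow> x \<in> P"
  by (simp add: eqv_def)

lemma eqv_cmul_of_additive:
  assumes "\<And>x y. 0 \<le> x \<Longrightarrow> 0 \<le> y \<Longrightarrow> x + y \<le> l \<Longrightarrow> h (x + y) \<doteq> h x + h y"
    and "0 \<le> (x :: real)" "real n * x \<le> l" "0 \<le> l"
  shows "h (real n * x) \<doteq> frag_cmul (int n) (h x)"
  using assms(3)
proof (induction n)
  case 0
  have "h 0 \<doteq> h 0 + h 0" using assms(1)[of 0 0] assms(4) by simp
  from eqv_diff[OF this, of "h 0" "h 0"] show ?case by (simp add: eqv_sym)
next
  case (Suc n)
  have "real n * x \<le> real (Suc n) * x" using assms(2) by (intro mult_right_mono) auto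
  then have IH: "h (real n * x) \<doteq> frag_cmul (int n) (h x)" using Suc by linarith
  have "h (real n * x + x) \<doteq> h (real n * x) + h x"
    using Suc(2) assms(2) by (intro assms(1)) (auto simp: algebra_simps)
  also have "\<dots> \<doteq> frag_cmul (int n) (h x) + h x" using IH by (intro eqv_add) auto
  finally show ?case by (simp add: algebra_simps frag_cmul_distrib)
qed

text \<open>A map into the quotient by \<open>P\<close> that is additive as long as sums stay below
  \<open>l\<close> extends to the whole line as \<open>n\<close> times its value at
  \<open>x / n\<close>. The extension allows displacements longer than an edge and in both
  directions.\<close>

lemma extend_additive:
  assumes h: "\<And>x y. 0 \<le> x \<Longrightarrow> 0 \<le> y \<Longrightarrow> x + y \<le> l \<Longrightarrow> h (x + y) \<doteq> h x + h y"
    and l: "0 < (l :: real)"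
  obtains \<delta> where "\<And>x y. \<delta> (x + y) \<doteq> \<delta> x + \<delta> y" "\<And>x. 0 \<le> x \<Longrightarrow> x \<le> l \<Longrightarrow> \<delta> x \<doteq> h x"
proof -
  have hn: "h (real n * x) \<doteq> frag_cmul (int n) (h x)" if "0 \<le> x" "real n * x \<le> l" for n x
    using eqv_cmul_of_additive[OF h that] l by simp
  \<comment> \<open>A number of parts for which \<open>x / k x \<le> l\<close>; \<open>Suc\<close>
    keeps it positive.\<close>
  define k where "k x = Suc (nat \<lceil>x / l\<rceil>)" for x :: real
  have k: "x / real (k x) \<le> l" if "0 \<le> x" for x
  proof -
    have "x / l \<le> real (k x)" unfolding k_def using real_nat_ceiling_ge[of "x / l"] by linarith
    then show ?thesis using l by (simp add: field_simps k_def)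
  qed
  have kpos: "0 < k x" for x by (simp add: k_def)
  define D where "D x = frag_cmul (int (k x)) (h (x / real (k x)))" for x
  \<comment> \<open>Independence of the number \<open>n\<close> of parts: both \<open>x / n\<close>
    and \<open>x / k x\<close> are multiples of \<open>y\<close>.\<close>
  have D: "frag_cmul (int n) (h (x / real n)) \<doteq> D x" if x: "0 \<le> x" and n: "0 < n" "x / real n \<le> l" for x n
  proof -
    define y where "y = x / (real n * real (k x))"
    have y: "0 \<le> y" "real (k x) * y = x / real n" "real n * y = x / real (k x)"
      using x n(1) kpos[of x] by (auto simp: y_def)
    have "h (x / real n) \<doteq> frag_cmul (int (k x)) (h y)"
      using hn[of y "k x"] y n(2) by simp
    from eqv_cmul[OF this, of "int n"]
    have 1: "frag_cmul (int n) (h (x / real n)) \<doteq> frag_cmul (int n * int (k x)) (h y)" by simp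
    have "h (x / real (k x)) \<doteq> frag_cmul (int n) (h y)"
      using hn[of y n] y k[OF x] by simp
    from eqv_cmul[OF this, of "int (k x)"]
    have "D x \<doteq> frag_cmul (int n * int (k x)) (h y)" unfolding D_def by (simp add: mult.commute)
    with 1 show ?thesis using eqv_sym eqv_trans by blast
  qed
  have Dadd: "D (x + y) \<doteq> D x + D y" if "0 \<le> x" "0 \<le> y" for x y
  proof -
    define n where "n = k (x + y)"
    have n: "0 < n" "(x + y) / real n \<le> l" using kpos k that unfolding n_def by auto
    have xn: "x / real n + y / real n \<le> l" using n by (simp add: add_divide_distrib)
    have le: "x / real n \<le> l" "y / real n \<le> l" using xn that by (auto intro: order_trans[rotated])
    have "D (x + y) \<doteq> frag_cmul (int n) (h ((x + y) / real n))" using D[of "x + y" n] that n eqv_sym by simp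
    also have "\<dots> \<doteq> frag_cmul (int n) (h (x / real n) + h (y / real n))"
      using h[of "x / real n" "y / real n"] that n xn by (intro eqv_cmul) (auto simp: add_divide_distrib)
    also have "\<dots> = frag_cmul (int n) (h (x / real n)) + frag_cmul (int n) (h (y / real n))"
      by (rule frag_cmul_distrib2)
    also have "\<dots> \<doteq> D x + D y" using D that n le by (intro eqv_add) auto
    finally show ?thesis .
  qed
  define \<delta> where "\<delta> x = D (max x 0) - D (max (- x) 0)" for x
  have "\<delta> (x + y) \<doteq> \<delta> x + \<delta> y" for x y
  proof -
    let ?p = "\<lambda>x::real. max x 0" and ?m = "\<lambda>x::real. max (- x) 0"
    \<comment> \<open>So far \<open>D\<close> is additive on nonnegative arguments only, so the
      negative parts are moved to the other side of the equation.\<close>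
    have "D (?p (x + y)) + (D (?m x) + D (?m y)) \<doteq> D (?p (x + y) + (?m x + ?m y))"
      by (rule eqv_sym, rule eqv_trans[OF Dadd]) (auto intro!: eqv_add Dadd)
    also have "?p (x + y) + (?m x + ?m y) = ?m (x + y) + (?p x + ?p y)" by (auto simp: max_def)
    also have "D \<dots> \<doteq> D (?m (x + y)) + (D (?p x) + D (?p y))"
      by (rule eqv_trans[OF Dadd]) (auto intro!: eqv_add Dadd)
    finally show ?thesis unfolding \<delta>_def eqv_def by (simp add: algebra_simps)
  qed
  moreover have "\<delta> x \<doteq> h x" if "0 \<le> x" "x \<le> l" for x
  proof -
    have "h x \<doteq> D x" using D[of x 1] that by simp
    moreover have "D 0 \<doteq> 0" using Dadd[of 0 0] by (simp add: eqv_def uminus_mem[of "- D 0", simplified])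
    ultimately have "D x - D 0 \<doteq> h x - 0" by (intro eqv_diff eqv_sym[of "h x"])
    then show ?thesis using that by (simp add: \<delta>_def max_def)
  qed
  ultimately show ?thesis using that by blast
qed

end

text \<open>\<open>\<delta> e x\<close> is the change of class when a chip moves by \<open>x\<close>
  along \<open>e\<close>, and \<open>c v\<close> is the class of the vertex \<open>v\<close>. The
  two ends of a loop cancel in Kirchhoff's law. Vertices and edges have types of their own, apart
  from the points of the divisors, since the graph is going to be altered while \<open>P\<close>
  stays fixed.\<close>

locale tropical_graph = frag_subgroup P
  for P :: "('a \<Rightarrow>\<^sub>0 int) set" +
  fixes V :: "'v set" and E :: "'e set" and src tgt :: "'e \<Rightarrow> 'v" and len :: "'e \<Rightarrow> real"
    and \<delta> :: "'e \<Rightarrow> real \<Rightarrow> 'a \<Rightarrow>\<^sub>0 int" and c :: "'v \<Rightarrow> 'a \<Rightarrow>\<^sub>0 int"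
  assumes finV: "finite V" and finE: "finite E" and V_ne: "V \<noteq> {}"
    and src_in: "\<And>e. e \<in> E \<Longrightarrow> src e \<in> V" and tgt_in: "\<And>e. e \<in> E \<Longrightarrow> tgt e \<in> V"
    and conn: "cut_conn src tgt E V"
    and len_pos: "\<And>e. e \<in> E \<Longrightarrow> 0 < len e"
    and \<delta>_add: "\<And>e x y. e \<in> E \<Longrightarrow> \<delta> e (x + y) - (\<delta> e x + \<delta> e y) \<in> P"
    and kirchhoff: "\<And>v x. v \<in> V \<Longrightarrow>
      (\<Sum>e\<in>E. frag_cmul (of_bool (src e = v) - of_bool (tgt e = v)) (\<delta> e x)) \<in> P"
    and c_tgt: "\<And>e. e \<in> E \<Longrightarrow> c (tgt e) - (c (src e) + \<delta> e (len e)) \<in> P"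
begin

abbreviation pt :: "'e \<Rightarrow> real \<Rightarrow> 'a \<Rightarrow>\<^sub>0 int" where
  "pt e x \<equiv> c (src e) + \<delta> e x"

lemma \<delta>_add': "e \<in> E \<Longrightarrow> \<delta> e (x + y) \<doteq> \<delta> e x + \<delta> e y"
  using \<delta>_add by (simp add: eqv_def)

lemma \<delta>_0: "e \<in> E \<Longrightarrow> \<delta> e 0 \<doteq> 0"
  using \<delta>_add'[of e 0 0] by (simp add: eqv_def uminus_mem[of "- \<delta> e 0", simplified])

lemma \<delta>_minus: "e \<in> E \<Longrightarrow> \<delta> e (- x) \<doteq> - \<delta> e x"
  using eqv_trans[OF eqv_sym[OF \<delta>_add'[of e x "- x"]], of 0] \<delta>_0[of e] by (simp add: eqv_def add.commute)

lemma \<delta>_diff: "e \<in> E \<Longrightarrow> \<delta> e (x - y) \<doteq> \<delta> e x - \<delta> e y"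
  using eqv_trans[OF \<delta>_add'[of e x "- y"] eqv_add[OF eqv_refl \<delta>_minus[of e y]]] by simp

lemma \<delta>_mult: "e \<in> E \<Longrightarrow> \<delta> e (real n * x) \<doteq> frag_cmul (int n) (\<delta> e x)"
proof (induction n)
  case (Suc n)
  have "\<delta> e (real n * x + x) \<doteq> \<delta> e (real n * x) + \<delta> e x" using \<delta>_add' Suc by simp
  also have "\<dots> \<doteq> frag_cmul (int n) (\<delta> e x) + \<delta> e x" using Suc by (intro eqv_add) auto
  finally show ?case by (simp add: algebra_simps frag_cmul_distrib)
qed (simp add: \<delta>_0)

lemma pt_0: "e \<in> E \<Longrightarrow> pt e 0 \<doteq> c (src e)"
  using eqv_add[OF eqv_refl \<delta>_0[of e], of "c (src e)"] by simp

lemma pt_len: "e \<in> E \<Longrightarrow> pt e (len e) \<doteq> c (tgt e)"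
  using c_tgt by (intro eqv_sym[of "c (tgt e)"]) (simp add: eqv_def)

lemma pt_add: "e \<in> E \<Longrightarrow> pt e (x + y) \<doteq> pt e x + \<delta> e y"
  using eqv_add[OF eqv_refl \<delta>_add'[of e x y], of "c (src e)"] by (simp add: add.assoc)

definition cut_sign :: "'v set \<Rightarrow> 'e \<Rightarrow> int" where
  "cut_sign U e = of_bool (src e \<in> U) - of_bool (tgt e \<in> U)"

text \<open>Firing \<open>U\<close>: when Kirchhoff's law is summed over \<open>U\<close>, the edges
  inside \<open>U\<close> cancel. What remains says that moving a chip by \<open>x\<close> away from
  \<open>U\<close> on every edge of the cut preserves the class.\<close>

lemma cut_mem:
  assumes "U \<subseteq> V"
  shows "(\<Sum>e\<in>E. frag_cmul (cut_sign U e) (\<delta> e x)) \<in> P"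
proof -
  have finU: "finite U" using assms finV finite_subset by blast
  have sgn: "cut_sign U e = (\<Sum>v\<in>U. of_bool (src e = v) - of_bool (tgt e = v))" for e
    using finU by (simp add: cut_sign_def sum_subtractf of_bool_def)
  have cm: "frag_cmul (sum f U) y = (\<Sum>v\<in>U. frag_cmul (f v) y)" for f :: "'v \<Rightarrow> int" and y :: "'a \<Rightarrow>\<^sub>0 int"
    using finU by (induction U rule: finite_induct) (simp_all add: frag_cmul_distrib)
  have "(\<Sum>e\<in>E. frag_cmul (cut_sign U e) (\<delta> e x)) =
      (\<Sum>v\<in>U. \<Sum>e\<in>E. frag_cmul (of_bool (src e = v) - of_bool (tgt e = v)) (\<delta> e x))"
    unfolding sgn cm by (rule sum.swap)
  also have "\<dots> \<doteq> (\<Sum>v\<in>U. 0)"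
    using kirchhoff assms by (intro eqv_sum) (auto simp: eqv_0_iff)
  finally show ?thesis by (simp add: eqv_0_iff)
qed

end

section \<open>Moving chips to distinct edges\<close>

context tropical_graph begin

text \<open>The edges with chips avoid the spanning set \<open>T\<close>, which the bound on
  \<open>card T\<close> makes a tree. When \<open>k\<close> is the genus, these are the classes of
  the break divisors.\<close>

definition placed :: "nat \<Rightarrow> ('a \<Rightarrow>\<^sub>0 int) \<Rightarrow> bool" where
  "placed k x \<longleftrightarrow> (\<exists>T I s. T \<subseteq> E \<and> I \<subseteq> E - T \<and> cut_conn src tgt T V \<and> card T + 1 \<le> card V
      \<and> card I = k \<and> (\<forall>i\<in>I. 0 \<le> s i \<and> s i \<le> len i) \<and> x \<doteq> (\<Sum>i\<in>I. pt i (s i)))"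

text \<open>One chip sits at the vertex \<open>p\<close> and is to be brought to the free edge
  \<open>f\<close>. The edges \<open>T\<close> connect \<open>W\<close> and also its complement, the
  two being glued at \<open>p\<close>; the region \<open>W\<close> around \<open>src f\<close> is
  going to shrink.\<close>

definition vertex_config where
  "vertex_config f W p T I s x \<longleftrightarrow> W \<subseteq> V \<and> p \<in> W \<and> src f \<in> W \<and> cut_conn src tgt T W
    \<and> cut_conn src tgt T (insert p (V - W)) \<and> T \<subseteq> E \<and> I \<subseteq> E - T \<and> f \<in> E - T - I \<and> card T + 1 \<le> card V
    \<and> (\<forall>i\<in>I. 0 \<le> s i \<and> s i \<le> len i) \<and> x \<doteq> c p + (\<Sum>i\<in>I. pt i (s i))"

text \<open>The intermediate state: the chip lies on an edge \<open>e\<close> of the cut, and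
  \<open>T\<close> is a spanning tree with one edge missing, connected on either side of the
  cut.\<close>

definition edge_config where
  "edge_config f W e T I s x \<longleftrightarrow> W \<subseteq> V \<and> src f \<in> W \<and> cut_conn src tgt T W
    \<and> cut_conn src tgt T (V - W) \<and> e \<in> I \<and> joins src tgt e (V - W) W
    \<and> T \<subseteq> E \<and> I \<subseteq> E - T \<and> f \<in> E - T - I \<and> card T + 2 \<le> card V
    \<and> (\<forall>i\<in>I. 0 \<le> s i \<and> s i \<le> len i) \<and> x \<doteq> (\<Sum>i\<in>I. pt i (s i))"

text \<open>
  If an edge without a chip joins \<open>V - W\<close> to \<open>W\<close>, it completes the spanning set.  Otherwise all
  edges of the cut carry chips, and these are moved towards \<open>W\<close> until one of them arrives.
\<close>

lemma edge_config_step: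
  assumes "edge_config f W e T I s x"
  shows "placed (card I) x \<or> (\<exists>T' I' s' p. vertex_config f W p T' I' s' x \<and> card I' + 1 = card I)"
proof (cases "\<exists>h\<in>E - I. joins src tgt h (V - W) W")
  case True
  then obtain h where h: "h \<in> E - I" "joins src tgt h (V - W) W" by blast
  have a: "W \<subseteq> V" "cut_conn src tgt T W" "cut_conn src tgt T (V - W)" "T \<subseteq> E" "I \<subseteq> E - T"
    "card T + 2 \<le> card V" "\<forall>i\<in>I. 0 \<le> s i \<and> s i \<le> len i" "x \<doteq> (\<Sum>i\<in>I. pt i (s i))"
    using assms unfolding edge_config_def by blast+
  have "cut_conn src tgt (insert h T) ((V - W) \<union> W)"
    using a h by (intro cut_conn_join[of _ _ _ _ _ h]) (auto intro: cut_conn_mono)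
  moreover have "(V - W) \<union> W = V" using a(1) by auto
  moreover have "card (insert h T) + 1 \<le> card V" using a(6) card_insert_le_m1[of "card T + 1" T h] by simp
  ultimately have "placed (card I) x" unfolding placed_def
    using a h by (intro exI[of _ "insert h T"] exI[of _ I] exI[of _ s]) auto
  then show ?thesis ..
next
  case False
  have a: "W \<subseteq> V" "src f \<in> W" "cut_conn src tgt T W" "cut_conn src tgt T (V - W)" "T \<subseteq> E" "I \<subseteq> E - T"
    "card T + 2 \<le> card V" "\<And>i. i \<in> I \<Longrightarrow> 0 \<le> s i \<and> s i \<le> len i" "x \<doteq> (\<Sum>i\<in>I. pt i (s i))"
    "e \<in> I" "joins src tgt e (V - W) W" "f \<in> E - T - I"
    using assms unfolding edge_config_def by blast+
  define Cut where "Cut = {i \<in> E. joins src tgt i (V - W) W}"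
  have Cut: "Cut \<subseteq> I" "e \<in> Cut" "finite Cut"
    using False a finE unfolding Cut_def by auto
  have IE: "I \<subseteq> E" using a by auto
  have finI: "finite I" using IE finE finite_subset by blast
  \<comment> \<open>The distance from the chip on \<open>i\<close> to the end of \<open>i\<close> in
    \<open>W\<close>. Firing \<open>V - W\<close> by the smallest of these distances keeps all chips
    on their edges and brings one of them to a vertex of \<open>W\<close>.\<close>
  define room where "room i = (if src i \<in> W then s i else len i - s i)" for i
  define \<epsilon> where "\<epsilon> = Min (room ` Cut)"
  have "\<epsilon> \<in> room ` Cut" unfolding \<epsilon>_def using Cut by (intro Min_in) auto
  then obtain i where i: "i \<in> Cut" "\<epsilon> = room i" by auto
  have \<epsilon>_le: "\<epsilon> \<le> room j" if "j \<in> Cut" for j unfolding \<epsilon>_def using Cut that by (intro Min_le) auto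
  have "0 \<le> \<epsilon>" using i Cut a(8) unfolding room_def by force
  have sgn: "cut_sign (V - W) j = (if j \<in> Cut then if src j \<in> W then - 1 else 1 else 0)" if "j \<in> E" for j
    using that src_in[of j] tgt_in[of j] by (auto simp: cut_sign_def Cut_def joins_def)
  define s' where "s' j = s j + of_int (cut_sign (V - W) j) * \<epsilon>" for j
  have s': "0 \<le> s' j \<and> s' j \<le> len j" if "j \<in> I" for j
  proof -
    have "j \<in> E" using that IE by auto
    then show ?thesis using a(8)[OF that] \<epsilon>_le[of j] \<open>0 \<le> \<epsilon>\<close>
      by (auto simp: s'_def sgn room_def split: if_splits)
  qed
  have ptj: "pt j (s' j) \<doteq> pt j (s j) + frag_cmul (cut_sign (V - W) j) (\<delta> j \<epsilon>)" if "j \<in> I" for j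
  proof -
    have j: "j \<in> E" using that IE by auto
    have "pt j (s' j) \<doteq> pt j (s j) + \<delta> j (of_int (cut_sign (V - W) j) * \<epsilon>)"
      unfolding s'_def by (rule pt_add[OF j])
    also have "\<dots> \<doteq> pt j (s j) + frag_cmul (cut_sign (V - W) j) (\<delta> j \<epsilon>)"
      using \<delta>_minus[OF j, of \<epsilon>] \<delta>_0[OF j] by (intro eqv_add) (auto simp: sgn[OF j])
    finally show ?thesis .
  qed
  have "(\<Sum>j\<in>I. pt j (s' j)) \<doteq> (\<Sum>j\<in>I. pt j (s j)) + (\<Sum>j\<in>I. frag_cmul (cut_sign (V - W) j) (\<delta> j \<epsilon>))"
    unfolding sum.distrib[symmetric] by (intro eqv_sum ptj)
  also have "(\<Sum>j\<in>I. frag_cmul (cut_sign (V - W) j) (\<delta> j \<epsilon>)) = (\<Sum>j\<in>E. frag_cmul (cut_sign (V - W) j) (\<delta> j \<epsilon>))"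
    using finE IE Cut sgn by (intro sum.mono_neutral_left) auto
  also have "(\<Sum>j\<in>I. pt j (s j)) + \<dots> \<doteq> x + 0"
    using a(9) cut_mem[of "V - W" \<epsilon>] by (intro eqv_add) (auto simp: eqv_0_iff intro: eqv_sym)
  finally have "x \<doteq> (\<Sum>j\<in>I. pt j (s' j))" using eqv_sym by simp
  also have "\<dots> = pt i (s' i) + (\<Sum>j\<in>I - {i}. pt j (s' j))"
    using finI i Cut by (intro sum.remove) auto
  finally have x: "x \<doteq> pt i (s' i) + (\<Sum>j\<in>I - {i}. pt j (s' j))" .
  define w where "w = (if src i \<in> W then src i else tgt i)"
  have iE: "i \<in> E" using i Cut IE by auto
  have si: "s' i = (if src i \<in> W then 0 else len i)"
    using i sgn[OF iE] by (simp add: s'_def room_def)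
  have "pt i (s' i) \<doteq> c w" using pt_0[OF iE] pt_len[OF iE] by (simp add: si w_def)
  then have x': "x \<doteq> c w + (\<Sum>j\<in>I - {i}. pt j (s' j))"
    using x eqv_add[OF _ eqv_refl] eqv_trans by blast
  have wW: "w \<in> W" "joins src tgt i (V - W) {w}" using i by (auto simp: w_def Cut_def joins_def)
  \<comment> \<open>The edge \<open>i\<close>, now free of chips, replaces the missing tree edge;
    \<open>W\<close> is unchanged.\<close>
  have "vertex_config f W w (insert i T) (I - {i}) s' x"
    unfolding vertex_config_def
  proof (intro conjI ballI)
    show "cut_conn src tgt (insert i T) (insert w (V - W))"
      using a wW by (intro cut_conn_insert[of _ _ _ _ i]) (auto intro: cut_conn_mono)
    show "cut_conn src tgt (insert i T) W" using a by (auto intro: cut_conn_mono)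
    show "card (insert i T) + 1 \<le> card V" using a(7) card_insert_le_m1[of "card T + 1" T i] by simp
    show "f \<in> E - insert i T - (I - {i})" using a i Cut by auto
  qed (use a wW s' iE x' i Cut in auto)
  moreover have "card (I - {i}) + 1 = card I" using finI i Cut by (metis Suc_eq_plus1 card_Suc_Diff1 in_mono)
  ultimately show ?thesis by blast
qed

text \<open>Each round replaces \<open>W\<close> by the component of \<open>src f\<close> in
  \<open>W - {p}\<close>, which is strictly smaller. Hence the chip finds a place on the way or
  arrives at \<open>src f\<close>, where it can be put on \<open>f\<close>.\<close>

lemma placed_of_vertex_config:
  "vertex_config f W p T I s x \<Longrightarrow> placed (card I + 1) x"
proof (induction "card W" arbitrary: W p T I s rule: less_induct)
  case less
  have a: "W \<subseteq> V" "p \<in> W" "src f \<in> W" "cut_conn src tgt T W" "cut_conn src tgt T (insert p (V - W))"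
    "T \<subseteq> E" "I \<subseteq> E - T" "f \<in> E - T - I" "card T + 1 \<le> card V" "\<And>i. i \<in> I \<Longrightarrow> 0 \<le> s i \<and> s i \<le> len i"
    "x \<doteq> c p + (\<Sum>i\<in>I. pt i (s i))"
    using less.prems unfolding vertex_config_def by blast+
  have fin: "finite I" "finite T" using a finE finite_subset by (metis Diff_subset order_trans)+
  show ?case
  proof (cases "p = src f")
    case True
    have "insert p (V - W) \<union> W = V" using a by auto
    with cut_conn_Un[OF a(5,4), of p] a(2) have V: "cut_conn src tgt T V" by simp
    define s' where "s' = s(f := 0)"
    have "(\<Sum>i\<in>insert f I. pt i (s' i)) = pt f 0 + (\<Sum>i\<in>I. pt i (s' i))"
      using fin a by (simp add: s'_def)
    also have "(\<Sum>i\<in>I. pt i (s' i)) = (\<Sum>i\<in>I. pt i (s i))"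
      using a by (intro sum.cong) (auto simp: s'_def)
    also have "pt f 0 + \<dots> \<doteq> c p + (\<Sum>i\<in>I. pt i (s i))"
      using pt_0[of f] a True by (intro eqv_add) auto
    also have "\<dots> \<doteq> x" using a(11) eqv_sym by blast
    finally have "x \<doteq> (\<Sum>i\<in>insert f I. pt i (s' i))" by (rule eqv_sym)
    moreover have "card (insert f I) = card I + 1" using fin a by simp
    moreover have "\<forall>i\<in>insert f I. 0 \<le> s' i \<and> s' i \<le> len i"
      using a less_imp_le[OF len_pos] by (auto simp: s'_def)
    ultimately show ?thesis
      unfolding placed_def using a V by (intro exI[of _ T] exI[of _ "insert f I"] exI[of _ s']) auto
  next
    case False
    obtain W' e where W': "W' \<subset> W" "src f \<in> W'" "cut_conn src tgt T W'" "cut_conn src tgt T (V - W')"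
      "e \<in> T" "joins src tgt e {p} W'" "p \<notin> W'"
      using cut_conn_remove_vertex[OF finV a(1,4,5,2,3) False] .
    have je: "joins src tgt e (V - W') W'" using W' a by (auto simp: joins_def)
    \<comment> \<open>The chip at \<open>p\<close> is regarded as lying on the tree edge
      \<open>e\<close>, at its end \<open>p\<close>; in return \<open>e\<close> leaves the
      tree.\<close>
    define t where "t = (if src e = p then 0 else len e)"
    have eE: "e \<in> E" using W' a by auto
    have t: "0 \<le> t" "t \<le> len e" using len_pos[OF eE] by (auto simp: t_def)
    have "tgt e = p" if "src e \<noteq> p" using W'(6) that by (auto simp: joins_def)
    then have pte: "pt e t \<doteq> c p" using pt_0[OF eE] pt_len[OF eE] by (auto simp: t_def)
    define s' where "s' = s(e := t)"
    have eI: "e \<notin> I" using a W' by auto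
    have "(\<Sum>i\<in>insert e I. pt i (s' i)) = pt e t + (\<Sum>i\<in>I. pt i (s' i))"
      using fin eI by (simp add: s'_def)
    also have "(\<Sum>i\<in>I. pt i (s' i)) = (\<Sum>i\<in>I. pt i (s i))"
      using eI by (intro sum.cong) (auto simp: s'_def)
    also have "pt e t + \<dots> \<doteq> c p + (\<Sum>i\<in>I. pt i (s i))" using pte by (intro eqv_add) auto
    also have "\<dots> \<doteq> x" using a(11) eqv_sym by blast
    finally have x: "x \<doteq> (\<Sum>i\<in>insert e I. pt i (s' i))" by (rule eqv_sym)
    have "edge_config f W' e (T - {e}) (insert e I) s' x"
      unfolding edge_config_def
    proof (intro conjI ballI)
      show "cut_conn src tgt (T - {e}) W'" by (rule cut_conn_cong[OF W'(3)]) (use je in \<open>auto simp: joins_def\<close>)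
      show "cut_conn src tgt (T - {e}) (V - W')" by (rule cut_conn_cong[OF W'(4)]) (use je in \<open>auto simp: joins_def\<close>)
      have "card (T - {e}) + 1 = card T" using fin W' by (metis Suc_eq_plus1 card_Suc_Diff1)
      then show "card (T - {e}) + 2 \<le> card V" using a by linarith
    qed (use a W' je t x eE eI in \<open>auto simp: s'_def\<close>)
    from edge_config_step[OF this] have
      "placed (card I + 1) x \<or> (\<exists>T' I' s' p. vertex_config f W' p T' I' s' x \<and> card I' = card I)"
      using fin eI by simp
    moreover have "card W' < card W" using W' a finV by (meson finite_subset psubset_card_mono)
    ultimately show ?thesis using less.hyps by metis
  qed
qed

text \<open>The bound on \<open>card I\<close> leaves an edge \<open>f\<close> outside
  \<open>T\<close> and \<open>I\<close>, and the chip starts its way from \<open>p\<close> with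
  \<open>W = V\<close>.\<close>

lemma placed_add_vertex:
  assumes T: "T \<subseteq> E" "cut_conn src tgt T V" "card T + 1 \<le> card V" and I: "I \<subseteq> E - T" "card I + card V \<le> card E"
    and s: "\<And>i. i \<in> I \<Longrightarrow> 0 \<le> s i \<and> s i \<le> len i" and p: "p \<in> V"
    and x: "x \<doteq> c p + (\<Sum>i\<in>I. pt i (s i))"
  shows "placed (card I + 1) x"
proof -
  have "card (T \<union> I) \<le> card T + card I" by (rule card_Un_le)
  then have "card (T \<union> I) < card E" using T I by linarith
  then have "T \<union> I \<noteq> E" by auto
  then obtain f where f: "f \<in> E - T - I" using T I by blast
  have "vertex_config f V p T I s x"
    unfolding vertex_config_def using assms f src_in by (auto simp: cut_conn_singleton)
  from placed_of_vertex_config[OF this] show ?thesis .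
qed

lemma placed_add_edge:
  assumes T: "T \<subseteq> E" "cut_conn src tgt T V" "card T + 1 \<le> card V" and I: "I \<subseteq> E - T" "card I + card V \<le> card E"
    and s: "\<And>i. i \<in> I \<Longrightarrow> 0 \<le> s i \<and> s i \<le> len i" and e: "e \<in> E" "0 \<le> t" "t \<le> len e"
    and x: "x \<doteq> pt e t + (\<Sum>i\<in>I. pt i (s i))"
  shows "placed (card I + 1) x"
proof (cases "e \<in> I")
  case True
  have finI: "finite I" using I finE finite_subset by blast
  \<comment> \<open>Two chips on one edge slide in opposite directions, which keeps the sum of their
    coordinates, until one of them reaches the end \<open>p\<close>; the other is then at
    \<open>r\<close>.\<close>
  define r where "r = (if s e + t \<le> len e then s e + t else s e + t - len e)"
  define p where "p = (if s e + t \<le> len e then src e else tgt e)"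
  have r: "0 \<le> r" "r \<le> len e" using s[OF True] e by (auto simp: r_def)
  have "pt e t + pt e (s e) \<doteq> c p + pt e r"
  proof -
    have 1: "pt e (s e + t) \<doteq> pt e (s e) + \<delta> e t" by (rule pt_add[OF e(1)])
    then have 2: "pt e t + pt e (s e) \<doteq> c (src e) + pt e (s e + t)"
      using eqv_add[OF eqv_refl[of "c (src e)"] eqv_sym[OF 1]] by (simp add: algebra_simps)
    show ?thesis
    proof (cases "s e + t \<le> len e")
      case False
      have "pt e (s e + t - len e + len e) \<doteq> pt e (s e + t - len e) + \<delta> e (len e)" by (rule pt_add[OF e(1)])
      then have "c (src e) + pt e (s e + t) \<doteq> pt e (len e) + pt e (s e + t - len e)"
        using eqv_add[OF eqv_refl[of "c (src e)"]] by (fastforce simp: algebra_simps)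
      also have "\<dots> \<doteq> c (tgt e) + pt e (s e + t - len e)" using pt_len[OF e(1)] by (intro eqv_add) auto
      finally show ?thesis using 2 eqv_trans False by (simp add: r_def p_def)
    qed (use 2 in \<open>simp add: r_def p_def\<close>)
  qed
  from eqv_add[OF this eqv_refl[of "\<Sum>i\<in>I - {e}. pt i (s i)"]]
  have "pt e t + (\<Sum>i\<in>I. pt i (s i)) \<doteq> c p + pt e r + (\<Sum>i\<in>I - {e}. pt i (s i))"
    unfolding sum.remove[OF finI True, of "\<lambda>i. pt i (s i)"] by (simp only: add.assoc)
  also have "(\<Sum>i\<in>I - {e}. pt i (s i)) = (\<Sum>i\<in>I - {e}. pt i ((s(e := r)) i))" by (intro sum.cong) auto
  also have "c p + pt e r + \<dots> = c p + (\<Sum>i\<in>I. pt i ((s(e := r)) i))"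
    using sum.remove[OF finI True, of "\<lambda>i. pt i ((s(e := r)) i)"] by (simp add: add.assoc)
  finally have "x \<doteq> c p + (\<Sum>i\<in>I. pt i ((s(e := r)) i))" using x eqv_trans by blast
  moreover have "p \<in> V" using src_in tgt_in e by (simp add: p_def)
  moreover have "\<And>i. i \<in> I \<Longrightarrow> 0 \<le> (s(e := r)) i \<and> (s(e := r)) i \<le> len i" using s r by auto
  ultimately show ?thesis by (intro placed_add_vertex[OF T I]) auto
next
  case False
  have fin: "finite I" "finite T" using T I finE finite_subset by blast+
  define s' where "s' = s(e := t)"
  have "(\<Sum>i\<in>insert e I. pt i (s' i)) = pt e t + (\<Sum>i\<in>I. pt i (s' i))"
    using fin False by (simp add: s'_def)
  also have "(\<Sum>i\<in>I. pt i (s' i)) = (\<Sum>i\<in>I. pt i (s i))"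
    using False by (intro sum.cong) (auto simp: s'_def)
  finally have x': "x \<doteq> (\<Sum>i\<in>insert e I. pt i (s' i))" using x by simp
  have s': "\<forall>i\<in>insert e I. 0 \<le> s' i \<and> s' i \<le> len i" using s e by (simp add: s'_def)
  have cI: "card (insert e I) = card I + 1" using fin False by simp
  have cTe: "card (T - {e}) \<le> card T" using fin by (simp add: card_mono)
  show ?thesis
  proof (cases "cut_conn src tgt (T - {e}) V")
    case True
    then show ?thesis unfolding placed_def using T I x' s' cI cTe e
      by (intro exI[of _ "T - {e}"] exI[of _ "insert e I"] exI[of _ s']) auto
  next
    case nc: False
    \<comment> \<open>Now \<open>e\<close> is a bridge of the tree. Giving it the chip splits the
      tree, and the side with the source of a free edge \<open>f\<close> is taken as
      \<open>W\<close>.\<close>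
    have eT: "e \<in> T" using nc T by (metis Diff_empty Diff_insert0)
    have "card (T \<union> I) \<le> card T + card I" by (rule card_Un_le)
    then have "card (T \<union> I) < card E" using T I by linarith
    then have "T \<union> I \<noteq> E" by auto
    then obtain f where f: "f \<in> E - T - I" using T I by blast
    then have "src f \<in> V" using src_in by auto
    then obtain W where W: "W \<subset> V" "src f \<in> W" "cut_conn src tgt T W" "cut_conn src tgt T (V - W)"
      "joins src tgt e (V - W) W"
      using cut_conn_remove_edge[OF finV T(2) eT _ nc, of "src f"] by metis
    have "edge_config f W e (T - {e}) (insert e I) s' x"
      unfolding edge_config_def
    proof (intro conjI)
      show "cut_conn src tgt (T - {e}) W" by (rule cut_conn_cong[OF W(3)]) (use W(5) in \<open>auto simp: joins_def\<close>)
      show "cut_conn src tgt (T - {e}) (V - W)" by (rule cut_conn_cong[OF W(4)]) (use W(5) in \<open>auto simp: joins_def\<close>)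
      have "card (T - {e}) + 1 = card T" using fin eT by (metis Suc_eq_plus1 card_Suc_Diff1)
      then show "card (T - {e}) + 2 \<le> card V" using T by linarith
    qed (use W f T I eT x' s' in auto)
    from edge_config_step[OF this] consider "placed (card I + 1) x"
      | T' I' r p where "vertex_config f W p T' I' r x" "card I' = card I"
      using cI by auto
    then show ?thesis
    proof cases
      case 2
      from placed_of_vertex_config[OF 2(1)] 2(2) show ?thesis by simp
    qed
  qed
qed

text \<open>Stated up to \<open>\<doteq>\<close>, so that the predicate remains literally the same
  when the graph is simplified below.\<close>

definition is_point :: "('a \<Rightarrow>\<^sub>0 int) \<Rightarrow> bool" where
  "is_point q \<longleftrightarrow> (\<exists>v\<in>V. q \<doteq> c v) \<or> (\<exists>e\<in>E. \<exists>t. 0 \<le> t \<and> t \<le> len e \<and> q \<doteq> pt e t)"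

lemma placed_add_point:
  assumes "placed k x" "k + card V \<le> card E" "is_point q"
  shows "placed (Suc k) (q + x)"
proof -
  obtain T I s where T: "T \<subseteq> E" "cut_conn src tgt T V" "card T + 1 \<le> card V"
    and I: "I \<subseteq> E - T" "card I = k" and s: "\<And>i. i \<in> I \<Longrightarrow> 0 \<le> s i \<and> s i \<le> len i"
    and x: "x \<doteq> (\<Sum>i\<in>I. pt i (s i))"
    using assms(1) unfolding placed_def by blast
  have cI: "card I + card V \<le> card E" using I assms by simp
  from assms(3) show ?thesis unfolding is_point_def
  proof (elim disjE bexE exE conjE)
    fix v assume "v \<in> V" "q \<doteq> c v"
    then show ?thesis using placed_add_vertex[OF T I(1) cI s, of v "q + x"] eqv_add[OF _ x] I(2) by simp
  next
    fix e t assume "e \<in> E" "0 \<le> t" "t \<le> len e" "q \<doteq> pt e t"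
    then show ?thesis using placed_add_edge[OF T I(1) cI s, of e t "q + x"] eqv_add[OF _ x] I(2) by simp
  qed
qed

lemma placed_sum_points:
  assumes "k + card V \<le> card E + 1" "\<And>i. i < k \<Longrightarrow> is_point (q i)"
  shows "placed k (\<Sum>i<k. q i)"
  using assms
proof (induction k)
  case 0
  obtain v where "v \<in> V" using V_ne by blast
  then obtain T where "T \<subseteq> E" "cut_conn src tgt T V" "card T + 1 = card V"
    using ex_spanning_tree[OF finV finE _ conn] by metis
  then show ?case unfolding placed_def by (intro exI[of _ T] exI[of _ "{}"]) auto
next
  case (Suc k)
  then show ?case using placed_add_point[of k "\<Sum>i<k. q i" "q k"] by (simp add: add.commute)
qed

end

section \<open>Removing vertices of valence at most two\<close>

context tropical_graph begin

lemma is_point_vertex: "v \<in> V \<Longrightarrow> q \<doteq> c v \<Longrightarrow> is_point q"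
  unfolding is_point_def by blast

lemma is_point_edge: "e \<in> E \<Longrightarrow> 0 \<le> t \<Longrightarrow> t \<le> len e \<Longrightarrow> q \<doteq> pt e t \<Longrightarrow> is_point q"
  unfolding is_point_def by blast

text \<open>Turning an edge around replaces the coordinate \<open>t\<close> by
  \<open>len e - t\<close>. It brings the edges at a vertex into the directions that the two
  removals below assume.\<close>

lemma reverse_edge:
  assumes e: "e \<in> E"
  defines "src' \<equiv> src(e := tgt e)" and "tgt' \<equiv> tgt(e := src e)" and "\<delta>' \<equiv> \<delta>(e := \<lambda>x. - \<delta> e x)"
  shows "tropical_graph P V E src' tgt' len \<delta>' c"
    and "tropical_graph.is_point P V E src' len \<delta>' c = is_point"
proof -
  have j: "joins src' tgt' a A B = joins src tgt a A B" for a A B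
    by (auto simp: joins_def src'_def tgt'_def)
  show tr: "tropical_graph P V E src' tgt' len \<delta>' c"
  proof unfold_locales
    show "finite V" "finite E" "V \<noteq> {}" by (rule finV finE V_ne)+
    show "src' a \<in> V" if "a \<in> E" for a using that e src_in tgt_in by (auto simp: src'_def)
    show "tgt' a \<in> V" if "a \<in> E" for a using that e src_in tgt_in by (auto simp: tgt'_def)
    show "cut_conn src' tgt' E V" using conn by (simp add: cut_conn_def j)
    show "0 < len a" if "a \<in> E" for a using that by (rule len_pos)
    show "\<delta>' a (x + y) - (\<delta>' a x + \<delta>' a y) \<in> P" if "a \<in> E" for a x y
      using \<delta>_add[OF that, of x y] uminus_mem[OF \<delta>_add[OF that, of x y]] by (auto simp: \<delta>'_def algebra_simps)
    show "(\<Sum>a\<in>E. frag_cmul (of_bool (src' a = v) - of_bool (tgt' a = v)) (\<delta>' a x)) \<in> P" if "v \<in> V" for v x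
    proof -
      have "frag_cmul (of_bool (src' a = v) - of_bool (tgt' a = v)) (\<delta>' a x) =
          frag_cmul (of_bool (src a = v) - of_bool (tgt a = v)) (\<delta> a x)" for a
        by (auto simp: src'_def tgt'_def \<delta>'_def)
      then show ?thesis using kirchhoff[OF that, of x] by simp
    qed
    show "c (tgt' a) - (c (src' a) + \<delta>' a (len a)) \<in> P" if "a \<in> E" for a
      using c_tgt[OF that] uminus_mem[OF c_tgt[OF that]] by (auto simp: src'_def tgt'_def \<delta>'_def algebra_simps)
  qed
  interpret R: tropical_graph P V E src' tgt' len \<delta>' c by (rule tr)
  have rev: "R.pt a t \<doteq> pt a (if a = e then len a - t else t)" if "a \<in> E" for a t
  proof (cases "a = e")
    case True
    have "pt e (len e + - t) \<doteq> pt e (len e) + \<delta> e (- t)" by (rule pt_add[OF e])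
    also have "\<dots> \<doteq> c (tgt e) + - \<delta> e t" by (intro eqv_add pt_len e \<delta>_minus)
    finally show ?thesis using True eqv_sym by (simp add: src'_def \<delta>'_def)
  qed (simp add: src'_def \<delta>'_def)
  show "R.is_point = is_point"
  proof (intro ext iffI)
    fix q assume "R.is_point q"
    then show "is_point q" unfolding R.is_point_def
    proof (elim disjE bexE exE conjE)
      fix a t assume a: "a \<in> E" "0 \<le> t" "t \<le> len a" "q \<doteq> R.pt a t"
      show ?thesis using a eqv_trans[OF a(4) rev[OF a(1)]]
        by (intro is_point_edge[of a "if a = e then len a - t else t"]) auto
    qed (auto intro: is_point_vertex)
  next
    fix q assume "is_point q"
    then show "R.is_point q" unfolding is_point_def
    proof (elim disjE bexE exE conjE)
      fix a t assume a: "a \<in> E" "0 \<le> t" "t \<le> len a" "q \<doteq> pt a t"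
      have "R.pt a (if a = e then len a - t else t) \<doteq> pt a t"
        using rev[OF a(1), of "if a = e then len a - t else t"] by (auto split: if_splits)
      then show ?thesis using a eqv_trans[OF a(4) eqv_sym]
        by (intro R.is_point_edge[of a "if a = e then len a - t else t"]) auto
    qed (auto intro: R.is_point_vertex)
  qed
qed

text \<open>Kirchhoff's law at a vertex of valence one says that \<open>\<delta> e\<close> vanishes
  modulo \<open>P\<close>. So all points of \<open>e\<close> are equivalent to \<open>src e\<close>,
  and the edge can be contracted.\<close>

lemma remove_leaf:
  assumes e: "e \<in> E" "tgt e = v" "src e \<noteq> v" and iso: "\<And>a. a \<in> E - {e} \<Longrightarrow> src a \<noteq> v \<and> tgt a \<noteq> v"
  shows "tropical_graph P (V - {v}) (E - {e}) src tgt len \<delta> c"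
    and "tropical_graph.is_point P (V - {v}) (E - {e}) src len \<delta> c = is_point"
proof -
  have vV: "v \<in> V" using e tgt_in by blast
  have \<delta>0: "\<delta> e x \<in> P" for x
  proof -
    have "(\<Sum>a\<in>E. frag_cmul (of_bool (src a = v) - of_bool (tgt a = v)) (\<delta> a x)) =
        (\<Sum>a\<in>{e}. frag_cmul (of_bool (src a = v) - of_bool (tgt a = v)) (\<delta> a x))"
      using e iso finE by (intro sum.mono_neutral_right) auto
    then show ?thesis using kirchhoff[OF vV, of x] e uminus_mem by fastforce
  qed
  have cv: "c v \<doteq> c (src e)"
    using add_mem[OF c_tgt[OF e(1)] \<delta>0[of "len e"]] e by (simp add: eqv_def algebra_simps)
  show tr: "tropical_graph P (V - {v}) (E - {e}) src tgt len \<delta> c"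
  proof unfold_locales
    show "finite (V - {v})" "finite (E - {e})" using finV finE by auto
    show "V - {v} \<noteq> {}" using src_in[of e] e by auto
    show "src a \<in> V - {v}" if "a \<in> E - {e}" for a using that src_in iso by auto
    show "tgt a \<in> V - {v}" if "a \<in> E - {e}" for a using that tgt_in iso by auto
    show "cut_conn src tgt (E - {e}) (V - {v})"
      unfolding cut_conn_def
    proof (intro allI impI)
      fix Y assume Y: "Y \<subset> V - {v}" "Y \<noteq> {}"
      \<comment> \<open>The vertex \<open>v\<close> joins the side of \<open>src e\<close>, so that
        \<open>e\<close> does not cross the cut.\<close>
      define Y' where "Y' = (if src e \<in> Y then insert v Y else Y)"
      have "Y' \<subset> V" using Y vV by (auto simp: Y'_def)
      then obtain a where a: "a \<in> E" "joins src tgt a Y' (V - Y')"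
        using conn Y cut_connD[of src tgt E V Y'] by (auto simp: Y'_def split: if_splits)
      have "a \<noteq> e" using a e Y by (auto simp: joins_def Y'_def split: if_splits)
      moreover have "joins src tgt a Y (V - {v} - Y)"
        using a iso[of a] \<open>a \<noteq> e\<close> by (auto simp: joins_def Y'_def split: if_splits)
      ultimately show "\<exists>a\<in>E - {e}. joins src tgt a Y (V - {v} - Y)" using a by blast
    qed
    show "0 < len a" if "a \<in> E - {e}" for a using that len_pos by auto
    show "\<delta> a (x + y) - (\<delta> a x + \<delta> a y) \<in> P" if "a \<in> E - {e}" for a x y using that \<delta>_add by auto
    show "c (tgt a) - (c (src a) + \<delta> a (len a)) \<in> P" if "a \<in> E - {e}" for a using that c_tgt by auto
    show "(\<Sum>a\<in>E - {e}. frag_cmul (of_bool (src a = u) - of_bool (tgt a = u)) (\<delta> a x)) \<in> P" if "u \<in> V - {v}" for u x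
      using diff_mem[OF kirchhoff[of u x] cmul_mem[OF \<delta>0[of x], of "of_bool (src e = u) - of_bool (tgt e = u)"]] that
        sum.remove[OF finE e(1), of "\<lambda>a. frag_cmul (of_bool (src a = u) - of_bool (tgt a = u)) (\<delta> a x)"]
      by simp
  qed
  interpret R: tropical_graph P "V - {v}" "E - {e}" src tgt len \<delta> c by (rule tr)
  show "R.is_point = is_point"
  proof (intro ext iffI)
    fix q assume "R.is_point q"
    then show "is_point q" unfolding R.is_point_def is_point_def by blast
  next
    fix q assume q: "is_point q"
    have src: "src e \<in> V - {v}" using src_in e by auto
    from q show "R.is_point q" unfolding is_point_def
    proof (elim disjE bexE exE conjE)
      fix u assume "u \<in> V" "q \<doteq> c u"
      then show ?thesis using R.is_point_vertex[of u q] R.is_point_vertex[OF src, of q] eqv_trans[OF _ cv] by (cases "u = v") auto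
    next
      fix a t assume a: "a \<in> E" "0 \<le> t" "t \<le> len a" "q \<doteq> pt a t"
      have "pt e t \<doteq> c (src e)" using \<delta>0 by (simp add: eqv_def)
      then show ?thesis using a R.is_point_edge[of a t q] R.is_point_vertex[OF src, of q] eqv_trans[of q "pt e t"]
        by (cases "a = e") auto
    qed
  qed
qed

text \<open>Kirchhoff's law at a vertex of valence two says that \<open>\<delta> e1\<close> and
  \<open>\<delta> e2\<close> agree modulo \<open>P\<close>. As \<open>\<delta> e1\<close> is defined
  on all reals, it serves for the longer edge as it stands.\<close>

lemma merge_edges:
  assumes e1: "e1 \<in> E" "tgt e1 = v" "src e1 \<noteq> v" and e2: "e2 \<in> E" "src e2 = v" "tgt e2 \<noteq> v"
    and iso: "\<And>a. a \<in> E - {e1, e2} \<Longrightarrow> src a \<noteq> v \<and> tgt a \<noteq> v"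
  defines "tgt' \<equiv> tgt(e1 := tgt e2)" and "len' \<equiv> len(e1 := len e1 + len e2)"
  shows "tropical_graph P (V - {v}) (E - {e2}) src tgt' len' \<delta> c"
    and "tropical_graph.is_point P (V - {v}) (E - {e2}) src len' \<delta> c = is_point"
proof -
  have ne: "e1 \<noteq> e2" using e1 e2 by auto
  have vV: "v \<in> V" using e1 tgt_in by blast
  have \<delta>eq: "\<delta> e2 x \<doteq> \<delta> e1 x" for x
  proof -
    have "(\<Sum>a\<in>E. frag_cmul (of_bool (src a = v) - of_bool (tgt a = v)) (\<delta> a x)) =
        (\<Sum>a\<in>{e1, e2}. frag_cmul (of_bool (src a = v) - of_bool (tgt a = v)) (\<delta> a x))"
      using e1 e2 iso finE by (intro sum.mono_neutral_right) auto
    then show ?thesis using kirchhoff[OF vV, of x] e1 e2 ne by (simp add: eqv_def)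
  qed
  have cv: "c v \<doteq> pt e1 (len e1)" using eqv_sym[OF pt_len[OF e1(1)]] e1(2) by simp
  have pt2: "pt e2 t \<doteq> pt e1 (len e1 + t)" for t
  proof -
    have "pt e2 t \<doteq> pt e1 (len e1) + \<delta> e1 t" using eqv_add[OF cv \<delta>eq[of t]] e2 by simp
    also have "\<dots> \<doteq> pt e1 (len e1 + t)" by (rule eqv_sym[OF pt_add[OF e1(1)]])
    finally show ?thesis .
  qed
  show tr: "tropical_graph P (V - {v}) (E - {e2}) src tgt' len' \<delta> c"
  proof unfold_locales
    show "finite (V - {v})" "finite (E - {e2})" using finV finE by auto
    show "V - {v} \<noteq> {}" using src_in[of e1] e1 by auto
    show "src a \<in> V - {v}" if "a \<in> E - {e2}" for a using that src_in iso[of a] e1 by (cases "a = e1") auto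
    show "tgt' a \<in> V - {v}" if "a \<in> E - {e2}" for a
      using that tgt_in iso[of a] e2 by (cases "a = e1") (auto simp: tgt'_def)
    show "cut_conn src tgt' (E - {e2}) (V - {v})"
      unfolding cut_conn_def
    proof (intro allI impI)
      fix Y assume Y: "Y \<subset> V - {v}" "Y \<noteq> {}"
      show "\<exists>a\<in>E - {e2}. joins src tgt' a Y (V - {v} - Y)"
      proof (cases "joins src tgt' e1 Y (V - {v} - Y)")
        case True
        then show ?thesis using e1 ne by blast
      next
        case False
        define Y' where "Y' = (if src e1 \<in> Y then insert v Y else Y)"
        have "Y' \<subset> V" using Y vV by (auto simp: Y'_def)
        then obtain a where a: "a \<in> E" "joins src tgt a Y' (V - Y')"
          using conn Y cut_connD[of src tgt E V Y'] by (auto simp: Y'_def split: if_splits)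
        have "src e1 \<in> Y \<longleftrightarrow> tgt e2 \<in> Y"
          using False e1 e2 src_in[of e1] tgt_in[of e2] by (auto simp: joins_def tgt'_def)
        then have ae: "a \<noteq> e1" "a \<noteq> e2" using a e1 e2 Y by (auto simp: joins_def Y'_def split: if_splits)
        then have "joins src tgt' a Y (V - {v} - Y)"
          using a iso[of a] by (auto simp: joins_def Y'_def tgt'_def split: if_splits)
        then show ?thesis using a ae by blast
      qed
    qed
    show "0 < len' a" if "a \<in> E - {e2}" for a using that len_pos e1 e2 by (auto simp: len'_def add_pos_pos)
    show "\<delta> a (x + y) - (\<delta> a x + \<delta> a y) \<in> P" if "a \<in> E - {e2}" for a x y using that \<delta>_add by auto
    show "c (tgt' a) - (c (src a) + \<delta> a (len' a)) \<in> P" if "a \<in> E - {e2}" for a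
    proof (cases "a = e1")
      case True
      have "c (tgt e2) \<doteq> pt e1 (len e1 + len e2)" using eqv_trans[OF eqv_sym[OF pt_len[OF e2(1)]] pt2] .
      then show ?thesis by (simp add: True tgt'_def len'_def eqv_def)
    qed (use that c_tgt in \<open>auto simp: tgt'_def len'_def\<close>)
    show "(\<Sum>a\<in>E - {e2}. frag_cmul (of_bool (src a = u) - of_bool (tgt' a = u)) (\<delta> a x)) \<in> P" if u: "u \<in> V - {v}" for u x
    proof -
      let ?E = "E - {e2} - {e1}"
      let ?g = "\<lambda>a. frag_cmul (of_bool (src a = u) - of_bool (tgt a = u)) (\<delta> a x)"
      let ?g' = "\<lambda>a. frag_cmul (of_bool (src a = u) - of_bool (tgt' a = u)) (\<delta> a x)"
      have sR: "sum ?g' (E - {e2}) = ?g' e1 + sum ?g' ?E" using finE e1 ne by (intro sum.remove) auto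
      have sE: "sum ?g' ?E = sum ?g ?E" by (intro sum.cong) (auto simp: tgt'_def)
      have "?g' e1 = frag_cmul (- of_bool (tgt e2 = u)) (\<delta> e1 x) + frag_cmul (of_bool (src e1 = u)) (\<delta> e1 x)"
        unfolding frag_cmul_distrib[symmetric] by (simp add: tgt'_def)
      also have "\<dots> \<doteq> frag_cmul (- of_bool (tgt e2 = u)) (\<delta> e2 x) + frag_cmul (of_bool (src e1 = u)) (\<delta> e1 x)"
        by (intro eqv_add eqv_cmul eqv_refl eqv_sym[OF \<delta>eq])
      also have "\<dots> = ?g e2 + ?g e1" using u e1 e2 by auto
      finally have "?g' e1 + sum ?g ?E \<doteq> ?g e2 + ?g e1 + sum ?g ?E" by (intro eqv_add) auto
      also have "\<dots> = sum ?g E"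
        using sum.remove[OF finE e2(1), of ?g] sum.remove[of "E - {e2}" e1 ?g] finE e1 ne by (simp add: add.assoc)
      also have "sum ?g E \<doteq> 0" using kirchhoff u by (simp add: eqv_0_iff)
      finally show ?thesis using sR sE by (simp add: eqv_0_iff)
    qed
  qed
  interpret R: tropical_graph P "V - {v}" "E - {e2}" src tgt' len' \<delta> c by (rule tr)
  have pos: "0 < len e1" "0 < len e2" using len_pos e1 e2 by auto
  show "R.is_point = is_point"
  proof (intro ext iffI)
    fix q assume "R.is_point q"
    then show "is_point q" unfolding R.is_point_def
    proof (elim disjE bexE exE conjE)
      fix a t assume a: "a \<in> E - {e2}" "0 \<le> t" "t \<le> len' a" "q \<doteq> pt a t"
      show ?thesis
      proof (cases "a = e1 \<and> len e1 < t")
        case True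
        have "pt e1 t \<doteq> pt e2 (t - len e1)" using eqv_sym[OF pt2[of "t - len e1"]] by simp
        then have "q \<doteq> pt e2 (t - len e1)" using a(4) True eqv_trans by blast
        moreover have "0 \<le> t - len e1" "t - len e1 \<le> len e2" using a(3) True by (auto simp: len'_def)
        ultimately show ?thesis using e2 is_point_edge by blast
      next
        case False
        then have "t \<le> len a" using a(3) by (auto simp: len'_def split: if_splits)
        then show ?thesis using a is_point_edge by blast
      qed
    qed (auto intro: is_point_vertex)
  next
    fix q assume q: "is_point q"
    from q show "R.is_point q" unfolding is_point_def
    proof (elim disjE bexE exE conjE)
      fix u assume u: "u \<in> V" "q \<doteq> c u"
      show ?thesis
      proof (cases "u = v")
        case True
        then have "q \<doteq> pt e1 (len e1)" using eqv_trans[OF u(2)] cv by simp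
        then show ?thesis using e1 ne pos by (intro R.is_point_edge[of e1 "len e1"]) (auto simp: len'_def)
      qed (use u in \<open>auto intro: R.is_point_vertex\<close>)
    next
      fix a t assume a: "a \<in> E" "0 \<le> t" "t \<le> len a" "q \<doteq> pt a t"
      show ?thesis
      proof (cases "a = e2")
        case True
        then have "q \<doteq> pt e1 (len e1 + t)" using eqv_trans[OF a(4)] pt2[of t] by simp
        then show ?thesis using a True e1 ne pos by (intro R.is_point_edge[of e1 "len e1 + t"]) (auto simp: len'_def)
      next
        case False
        then show ?thesis using a pos by (intro R.is_point_edge[of a t]) (auto simp: len'_def)
      qed
    qed
  qed
qed

text \<open>The valences sum to \<open>2 * card E\<close>, so some vertex \<open>v\<close> has
  valence at most two. Since \<open>card V < card E\<close>, it is not the only vertex. Removing it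
  together with one edge keeps \<open>card E - card V\<close>.\<close>

lemma ex_smaller_tropical_graph:
  assumes few: "2 * card E < 3 * card V" and more: "card V < card E"
  shows "\<exists>(V' :: 'v set) (E' :: 'e set) src' tgt' len' \<delta>' c'. tropical_graph P V' E' src' tgt' len' \<delta>' c'
    \<and> card V' + 1 = card V \<and> card E' + 1 = card E
    \<and> tropical_graph.is_point P V' E' src' len' \<delta>' c' = is_point" (is ?thesis)
proof -
  define dg where "dg v = card {e\<in>E. src e = v} + card {e\<in>E. tgt e = v}" for v
  have sum_fib: "(\<Sum>v\<in>V. card {e\<in>E. f e = v}) = card E" if "f ` E \<subseteq> V" for f
    using sum.group[OF finE finV that, of "\<lambda>_. 1::nat"] by simp
  have "(\<Sum>v\<in>V. dg v) = 2 * card E"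
    unfolding dg_def sum.distrib using sum_fib[of src] sum_fib[of tgt] src_in tgt_in by fastforce
  then have "(\<Sum>v\<in>V. dg v) < (\<Sum>v\<in>V. 3)" using few by simp
  then obtain v where v: "v \<in> V" "dg v < 3" using sum_mono[of V "\<lambda>_. 3" dg] by (meson leD leI)
  have "V \<noteq> {v}"
  proof
    assume V: "V = {v}"
    then have "{e\<in>E. src e = v} = E" "{e\<in>E. tgt e = v} = E" using src_in tgt_in by auto
    then show False using v more V by (simp add: dg_def)
  qed
  then have "{v} \<subset> V" using v by auto
  then have "\<exists>e\<in>E. joins src tgt e {v} (V - {v})" using conn unfolding cut_conn_def by simp
  then obtain e where e: "e \<in> E" "joins src tgt e {v} (V - {v})" ..
  define N where "N = {a\<in>E. src a = v \<or> tgt a = v}"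
  have eN: "e \<in> N" and e_nl: "src e \<noteq> tgt e" using e by (auto simp: N_def joins_def)
  have NU: "N = {a\<in>E. src a = v} \<union> {a\<in>E. tgt a = v}" by (auto simp: N_def)
  \<comment> \<open>A loop at \<open>v\<close> counts twice and, with the edge \<open>e\<close> to
    another vertex, would give valence three.\<close>
  have nl: "src a \<noteq> tgt a" if "a \<in> N" for a
  proof
    assume l: "src a = tgt a"
    then have "{a, e} \<subseteq> N" "a \<noteq> e" "a \<in> {a\<in>E. src a = v} \<inter> {a\<in>E. tgt a = v}"
      using that eN e_nl by (auto simp: N_def)
    then have "2 \<le> card N" "1 \<le> card ({a\<in>E. src a = v} \<inter> {a\<in>E. tgt a = v})"
      using finE card_mono[of N "{a, e}"] by (auto simp: N_def Suc_le_eq card_gt_0_iff)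
    then show False using v(2) card_Un_Int[of "{a\<in>E. src a = v}" "{a\<in>E. tgt a = v}"] finE
      by (simp add: dg_def NU)
  qed
  have cN: "card N \<le> 2" using v(2) card_Un_le[of "{a\<in>E. src a = v}" "{a\<in>E. tgt a = v}"]
    by (simp add: dg_def NU)
  have finN: "finite N" using finE by (simp add: N_def)
  have IH: ?thesis
    if "tropical_graph P V' E' src' tgt' len' \<delta>' c'" "card V' + 1 = card V" "card E' + 1 = card E"
      "tropical_graph.is_point P V' E' src' len' \<delta>' c' = is_point"
    for V' :: "'v set" and E' :: "'e set" and src' tgt' len' \<delta>' c'
    by (rule exI[of _ V'], rule exI[of _ E'], rule exI[of _ src'], rule exI[of _ tgt'], rule exI[of _ len'],
        rule exI[of _ \<delta>'], rule exI[of _ c']) (intro conjI that)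
  have cV: "card (V - {v}) + 1 = card V" using v(1) finV by (simp add: card_Suc_Diff1 del: card_Diff_insert card_Diff_singleton)
  have cE: "card (E - {a}) + 1 = card E" if "a \<in> E" for a
    using that finE by (simp add: card_Suc_Diff1 del: card_Diff_insert card_Diff_singleton)
  show ?thesis
  proof (cases "N = {e}")
    case True
    \<comment> \<open>Stated for a changed orientation, since \<open>e\<close> may first have to be
      reversed.\<close>
    have orient: ?thesis
      if "tropical_graph P V E src' tgt' len' \<delta>' c'" "tropical_graph.is_point P V E src' len' \<delta>' c' = is_point"
        "tgt' e = v" "src' e \<noteq> v" "\<And>a. a \<in> E - {e} \<Longrightarrow> src' a = src a \<and> tgt' a = tgt a"
      for src' tgt' len' \<delta>' c'
    proof -
      interpret R: tropical_graph P V E src' tgt' len' \<delta>' c' by fact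
      have iso: "src' a \<noteq> v \<and> tgt' a \<noteq> v" if "a \<in> E - {e}" for a
        using that \<open>\<And>a. a \<in> E - {e} \<Longrightarrow> src' a = src a \<and> tgt' a = tgt a\<close>[of a] True by (auto simp: N_def)
      show ?thesis
        by (rule IH[OF R.remove_leaf(1)[OF e(1) that(3,4) iso] cV cE[OF e(1)]
          R.remove_leaf(2)[OF e(1) that(3,4) iso, unfolded that(2)]])
    qed
    show ?thesis
    proof (cases "tgt e = v")
      case True
      then show ?thesis using e_nl by (intro orient[OF tropical_graph_axioms]) simp_all
    next
      case False
      then have "src e = v" using eN by (auto simp: N_def)
      with False show ?thesis by (intro orient[OF reverse_edge[OF e(1)]]) simp_all
    qed
  next
    case False
    then obtain e2 where e2: "e2 \<in> N" "e2 \<noteq> e" using eN by blast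
    then have "card {e, e2} = 2" "{e, e2} \<subseteq> N" using eN by auto
    then have N: "N = {e, e2}" using cN card_seteq[OF finN] by metis
    have e2E: "e2 \<in> E" using e2 by (simp add: N_def)
    have orient2: ?thesis
      if "tropical_graph P V E src' tgt' len' \<delta>' c'" "tropical_graph.is_point P V E src' len' \<delta>' c' = is_point"
        "tgt' e = v" "src' e \<noteq> v" "src' e2 = v" "tgt' e2 \<noteq> v"
        "\<And>a. a \<in> E - {e, e2} \<Longrightarrow> src' a = src a \<and> tgt' a = tgt a"
      for src' tgt' len' \<delta>' c'
    proof -
      interpret R: tropical_graph P V E src' tgt' len' \<delta>' c' by fact
      have iso: "src' a \<noteq> v \<and> tgt' a \<noteq> v" if "a \<in> E - {e, e2}" for a
        using that \<open>\<And>a. a \<in> E - {e, e2} \<Longrightarrow> src' a = src a \<and> tgt' a = tgt a\<close>[of a] N by (auto simp: N_def)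
      show ?thesis
        by (rule IH[OF R.merge_edges(1)[OF e(1) that(3,4) e2E that(5,6) iso] cV cE[OF e2E]
          R.merge_edges(2)[OF e(1) that(3,4) e2E that(5,6) iso, unfolded that(2)]])
    qed
    have orient: ?thesis
      if "tropical_graph P V E src' tgt' len' \<delta>' c'" "tropical_graph.is_point P V E src' len' \<delta>' c' = is_point"
        "tgt' e = v" "src' e \<noteq> v" "\<And>a. a \<in> E - {e} \<Longrightarrow> src' a = src a \<and> tgt' a = tgt a"
      for src' tgt' len' \<delta>' c'
    proof -
      interpret R: tropical_graph P V E src' tgt' len' \<delta>' c' by fact
      have e2': "src' e2 = src e2" "tgt' e2 = tgt e2" using that(5)[of e2] e2 e2E by auto
      show ?thesis
      proof (cases "src e2 = v")
        case True
        show ?thesis by (rule orient2[OF that(1-4)]) (use True e2' nl[OF e2(1)] that(5) in simp_all)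
      next
        case False
        then have "tgt e2 = v" using e2 by (auto simp: N_def)
        have "src' a = src a \<and> tgt' a = tgt a" if "a \<in> E - {e, e2}" for a
          using that \<open>\<And>a. a \<in> E - {e} \<Longrightarrow> src' a = src a \<and> tgt' a = tgt a\<close>[of a] by blast
        then show ?thesis using that(2,3,4) e2' e2(2) False \<open>tgt e2 = v\<close>
          by (intro orient2[OF R.reverse_edge(1)[OF e2E] R.reverse_edge(2)[OF e2E, unfolded that(2)]]) simp_all
      qed
    qed
    show ?thesis
    proof (cases "tgt e = v")
      case True
      then show ?thesis using e_nl by (intro orient[OF tropical_graph_axioms]) simp_all
    next
      case False
      then have "src e = v" using eN by (auto simp: N_def)
      with False show ?thesis by (intro orient[OF reverse_edge[OF e(1)]]) simp_all
    qed
  qed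
qed

end

text \<open>The removals stop as soon as the mean valence is at least three. Then
  \<open>card E' \<le> 3 * (card E' - card V')\<close>, and this difference is that of the original
  graph.\<close>

lemma tropical_reduction:
  fixes P :: "('a \<Rightarrow>\<^sub>0 int) set" and V :: "'v set" and E :: "'e set"
  assumes "tropical_graph P V E src tgt len \<delta> c" and "card V < card E"
  shows "\<exists>(V' :: 'v set) (E' :: 'e set) src' tgt' len' \<delta>' c'. tropical_graph P V' E' src' tgt' len' \<delta>' c'
    \<and> card V' + card E = card V + card E' \<and> 3 * card V' \<le> 2 * card E'
    \<and> tropical_graph.is_point P V' E' src' len' \<delta>' c' = tropical_graph.is_point P V E src len \<delta> c"
  using assms
proof (induction "card E" arbitrary: V E src tgt len \<delta> c rule: less_induct)
  case less
  show ?case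
  proof (cases "3 * card V \<le> 2 * card E")
    case True
    show ?thesis
      by (rule exI[of _ V], rule exI[of _ E], rule exI[of _ src], rule exI[of _ tgt], rule exI[of _ len], rule exI[of _ \<delta>], rule exI[of _ c])
        (use less.prems(1) True in simp)
  next
    case False
    then obtain V' E' src' tgt' len' \<delta>' c' where 1: "tropical_graph P (V' :: 'v set) (E' :: 'e set) src' tgt' len' \<delta>' c'"
      and 2: "card V' + 1 = card V" "card E' + 1 = card E"
      and 3: "tropical_graph.is_point P V' E' src' len' \<delta>' c' = tropical_graph.is_point P V E src len \<delta> c"
      using tropical_graph.ex_smaller_tropical_graph[OF less.prems(1) _ less.prems(2)] by (metis not_le)
    have "card E' < card E" "card V' < card E'" using 2 less.prems(2) by auto
    from less.hyps[OF this(1) 1 this(2)] obtain V'' E'' src'' tgt'' len'' \<delta>'' c''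
      where 4: "tropical_graph P (V'' :: 'v set) (E'' :: 'e set) src'' tgt'' len'' \<delta>'' c''"
        and 5: "card V'' + card E' = card V' + card E''" "3 * card V'' \<le> 2 * card E''"
        and 6: "tropical_graph.is_point P V'' E'' src'' len'' \<delta>'' c'' = tropical_graph.is_point P V' E' src' len' \<delta>' c'"
      by blast
    have "card V'' + card E = card V + card E''" using 2 5 by linarith
    then show ?thesis
      by -(rule exI[of _ V''], rule exI[of _ E''], rule exI[of _ src''], rule exI[of _ tgt''], rule exI[of _ len''], rule exI[of _ \<delta>''], rule exI[of _ c''], use 3 4 5(2) 6 in simp)
  qed
qed

section \<open>Counting torsion classes\<close>

context frag_subgroup begin

definition is_torsion :: "('a \<Rightarrow>\<^sub>0 int) \<Rightarrow> bool" where
  "is_torsion x \<longleftrightarrow> (\<exists>n::nat. 0 < n \<and> frag_cmul (int n) x \<in> P)"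

lemma is_torsion_cong: "x \<doteq> y \<Longrightarrow> is_torsion y \<Longrightarrow> is_torsion x"
  unfolding is_torsion_def eqv_0_iff[symmetric] by (meson eqv_cmul eqv_trans)

lemma is_torsion_add:
  assumes "is_torsion x" "is_torsion y"
  shows "is_torsion (x + y)"
proof -
  obtain m n where "0 < m" "frag_cmul (int m) x \<in> P" "0 < n" "frag_cmul (int n) y \<in> P"
    using assms unfolding is_torsion_def by blast
  then have "frag_cmul (int n) (frag_cmul (int m) x) + frag_cmul (int m) (frag_cmul (int n) y) \<in> P"
    using add_mem[OF cmul_mem cmul_mem] by blast
  then have "frag_cmul (int (m * n)) (x + y) \<in> P" by (simp add: frag_cmul_distrib2 mult.commute)
  with \<open>0 < m\<close> \<open>0 < n\<close> show ?thesis unfolding is_torsion_def by (intro exI[of _ "m * n"]) simp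
qed

lemma is_torsion_minus: "is_torsion x \<Longrightarrow> is_torsion (- x)"
  unfolding is_torsion_def using uminus_mem by fastforce

lemma is_torsion_div: "is_torsion (frag_cmul (int n) x) \<Longrightarrow> 0 < n \<Longrightarrow> is_torsion x"
  unfolding is_torsion_def by (metis frag_cmul_cmul nat_0_less_mult_iff of_nat_mult)

lemma is_torsion_cmul: "is_torsion x \<Longrightarrow> is_torsion (frag_cmul k x)"
  unfolding is_torsion_def using cmul_mem by (metis frag_cmul_cmul mult.commute)

end

context tropical_graph begin

definition is_point_sum :: "nat \<Rightarrow> ('a \<Rightarrow>\<^sub>0 int) \<Rightarrow> bool" where
  "is_point_sum d x \<longleftrightarrow> (\<exists>q. (\<forall>i<d. is_point (q i)) \<and> x \<doteq> (\<Sum>i<d. q i))"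

lemma is_point_sum_cell:
  assumes I: "I \<subseteq> E" "card I = d" and s: "\<And>i. i \<in> I \<Longrightarrow> 0 \<le> s i \<and> s i \<le> len i"
  shows "is_point_sum d (\<Sum>i\<in>I. pt i (s i))"
proof -
  have "finite I" using I finE finite_subset by blast
  then obtain h where h: "bij_betw h {..<d} I" using ex_bij_betw_nat_finite I(2) by (metis atLeast0LessThan)
  have "(\<Sum>i\<in>I. pt i (s i)) = (\<Sum>k<d. pt (h k) (s (h k)))"
    using sum.reindex_bij_betw[OF h, of "\<lambda>i. pt i (s i)"] by simp
  moreover have "is_point (pt (h k) (s (h k)))" if "k < d" for k
  proof -
    have "h k \<in> I" using h that by (auto simp: bij_betw_def)
    then show ?thesis using s I by (intro is_point_edge[of "h k" "s (h k)"]) auto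
  qed
  ultimately show ?thesis unfolding is_point_sum_def
    by (intro exI[of _ "\<lambda>k. pt (h k) (s (h k))"]) simp
qed

text \<open>
  Were there two torsion classes in one cell, then so would be all the classes at the points of the
  segment between them that divide it in a rational ratio, and there are infinitely many of those.
\<close>

lemma cell_torsion_unique:
  assumes I: "I \<subseteq> E" "card I = d"
    and s: "\<And>i. i \<in> I \<Longrightarrow> 0 \<le> s i \<and> s i \<le> len i" and t: "\<And>i. i \<in> I \<Longrightarrow> 0 \<le> t i \<and> t i \<le> len i"
    and F: "finite F" "\<And>x. is_point_sum d x \<Longrightarrow> is_torsion (x - D) \<Longrightarrow> \<exists>r\<in>F. x \<doteq> r"
    and tors: "is_torsion ((\<Sum>i\<in>I. pt i (s i)) - D)" "is_torsion ((\<Sum>i\<in>I. pt i (t i)) - D)"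
  shows "(\<Sum>i\<in>I. pt i (t i)) \<doteq> (\<Sum>i\<in>I. pt i (s i))"
proof -
  define \<eta> where "\<eta> x = (\<Sum>i\<in>I. \<delta> i (x * (t i - s i)))" for x
  define Z where "Z x = (\<Sum>i\<in>I. pt i (s i + x * (t i - s i)))" for x
  have Z\<eta>: "Z x \<doteq> Z 0 + \<eta> x" for x
    unfolding Z_def \<eta>_def sum.distrib[symmetric] using I pt_add by (intro eqv_sum) auto
  have Z01: "Z 0 = (\<Sum>i\<in>I. pt i (s i))" "Z 1 = (\<Sum>i\<in>I. pt i (t i))" by (simp_all add: Z_def)
  have \<eta>_mult: "\<eta> (real n * x) \<doteq> frag_cmul (int n) (\<eta> x)" for n x
    unfolding \<eta>_def frag_cmul_sum using I \<delta>_mult by (intro eqv_sum) (auto simp: mult.assoc)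
  have \<eta>1: "\<eta> 1 \<doteq> Z 1 - Z 0" using eqv_diff[OF Z\<eta>[of 1] eqv_refl[of "Z 0"]] eqv_sym by simp
  have "is_torsion ((Z 1 - D) + - (Z 0 - D))" using tors Z01 by (intro is_torsion_add is_torsion_minus) auto
  then have tor1: "is_torsion (\<eta> 1)" using is_torsion_cong[OF \<eta>1] by simp
  have inF: "\<exists>r\<in>F. Z (real j / real N) \<doteq> r" if "0 < N" "j \<le> N" for j N
  proof (rule F(2))
    let ?x = "real j / real N"
    have x: "0 \<le> ?x" "?x \<le> 1" using that by auto
    have "0 \<le> s i + ?x * (t i - s i) \<and> s i + ?x * (t i - s i) \<le> len i" if "i \<in> I" for i
    proof -
      have "s i + y * (t i - s i) = (1 - y) * s i + y * t i" for y by (simp add: algebra_simps)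
      then have "s i + ?x * (t i - s i) = (1 - ?x) * s i + ?x * t i" .
      moreover have "(1 - ?x) * s i + ?x * t i \<le> (1 - ?x) * len i + ?x * len i"
        using s[OF that] t[OF that] x by (intro add_mono mult_left_mono) auto
      moreover have "(1 - ?x) * len i + ?x * len i = len i" by (simp add: algebra_simps)
      moreover have "0 \<le> (1 - ?x) * s i + ?x * t i" using s[OF that] t[OF that] x by simp
      ultimately show ?thesis by linarith
    qed
    then show "is_point_sum d (Z ?x)" unfolding Z_def using I by (intro is_point_sum_cell) auto
    \<comment> \<open>An \<open>N\<close>-th part of the torsion displacement
      \<open>\<eta> 1\<close> is again torsion.\<close>
    have "frag_cmul (int N) (\<eta> (1 / real N)) \<doteq> \<eta> 1" using \<eta>_mult[of N "1 / real N"] that eqv_sym by simp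
    then have "is_torsion (\<eta> (1 / real N))" using is_torsion_div is_torsion_cong[OF _ tor1] that by blast
    then have "is_torsion (\<eta> ?x)"
      using is_torsion_cong[OF \<eta>_mult[of j "1 / real N"]] is_torsion_cmul by simp
    then have "is_torsion ((Z 0 - D) + \<eta> ?x)" using tors Z01 by (intro is_torsion_add) auto
    then show "is_torsion (Z ?x - D)"
      using is_torsion_cong eqv_diff[OF Z\<eta>[of ?x] eqv_refl[of D]] by (simp add: algebra_simps)
  qed
  \<comment> \<open>Among the \<open>card F + 1\<close> parameters \<open>j / N\<close> two give the
    same class. Their numerators differ by at most \<open>card F\<close>, hence by a divisor of the
    factorial \<open>N\<close>, and a multiple of the resulting relation is
    \<open>\<eta> 1 \<in> P\<close>.\<close>
  define N where "N = (fact (card F) :: nat)"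
  have N: "0 < N" "card F \<le> N" by (simp_all add: N_def fact_ge_self)
  have "\<exists>r. r \<in> F \<and> Z (real j / real N) \<doteq> r" if "j \<le> card F" for j
    using inF[OF N(1), of j] that N(2) by auto
  then obtain r where r: "\<And>j. j \<le> card F \<Longrightarrow> r j \<in> F \<and> Z (real j / real N) \<doteq> r j" by metis
  have "\<not> inj_on r {..card F}"
  proof
    assume "inj_on r {..card F}"
    then have "card {..card F} \<le> card F" using r F(1) by (intro card_inj_on_le[of r]) auto
    then show False by simp
  qed
  then obtain j k where jk: "j < k" "k \<le> card F" "r j = r k"
    unfolding inj_on_def by (metis atMost_iff linorder_neqE_nat)
  have "Z (real k / real N) \<doteq> r j" using r[OF jk(2)] jk(3) by simp
  moreover have "Z (real j / real N) \<doteq> r j" using r[of j] jk by simp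
  ultimately have "Z (real k / real N) \<doteq> Z (real j / real N)" using eqv_trans eqv_sym by blast
  then have "Z 0 + \<eta> (real k / real N) \<doteq> Z (real j / real N)"
    using eqv_trans[OF eqv_sym[OF Z\<eta>]] by blast
  then have "Z 0 + \<eta> (real k / real N) \<doteq> Z 0 + \<eta> (real j / real N)"
    using eqv_trans Z\<eta> by blast
  then have "\<eta> (real k / real N) \<doteq> \<eta> (real j / real N)" by (simp add: eqv_def)
  moreover have \<eta>N: "\<eta> (real i / real N) \<doteq> frag_cmul (int i) (\<eta> (1 / real N))" for i
    using \<eta>_mult[of i "1 / real N"] by simp
  ultimately have "frag_cmul (int k) (\<eta> (1 / real N)) \<doteq> \<eta> (real j / real N)"
    using eqv_trans[OF eqv_sym[OF \<eta>N]] by blast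
  then have "frag_cmul (int k) (\<eta> (1 / real N)) \<doteq> frag_cmul (int j) (\<eta> (1 / real N))"
    using eqv_trans \<eta>N by blast
  then have *: "frag_cmul (int (k - j)) (\<eta> (1 / real N)) \<in> P"
    using jk by (simp add: eqv_def frag_cmul_diff_distrib of_nat_diff)
  have "k - j dvd N" unfolding N_def using jk by (intro dvd_fact) auto
  then obtain l where "N = (k - j) * l" by blast
  then have "frag_cmul (int N) (\<eta> (1 / real N)) \<in> P"
    using cmul_mem[OF *, of "int l"] by (simp add: mult.commute)
  then have "\<eta> 1 \<in> P" using \<eta>_mult[of N "1 / real N"] N eqv_trans[of "\<eta> 1" _ 0]
    by (simp add: eqv_0_iff[symmetric])
  then have "Z 1 - Z 0 \<doteq> 0" using eqv_trans[OF eqv_sym[OF \<eta>1], of 0] by (simp add: eqv_0_iff)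
  then show ?thesis by (simp add: Z01 eqv_def)
qed

text \<open>\<open>F\<close> represents all torsion classes among the sums of \<open>d\<close>
  points, which is how finiteness enters; \<open>A\<close> consists of pairwise inequivalent ones.
  Each member of \<open>A\<close> is placed in a cell, that is, on a set of \<open>d\<close>
  edges.\<close>

lemma torsion_bound:
  assumes d: "d + card V \<le> card E + 1"
    and F: "finite F" "\<And>x. is_point_sum d x \<Longrightarrow> is_torsion (x - D) \<Longrightarrow> \<exists>r\<in>F. x \<doteq> r"
    and A: "\<And>x. x \<in> A \<Longrightarrow> is_point_sum d x \<and> is_torsion (x - D)"
      "\<And>x y. x \<in> A \<Longrightarrow> y \<in> A \<Longrightarrow> x \<doteq> y \<Longrightarrow> x = y"
  shows "card A \<le> card E choose d"
proof -
  have "\<exists>I s. I \<subseteq> E \<and> card I = d \<and> (\<forall>i\<in>I. 0 \<le> s i \<and> s i \<le> len i) \<and> x \<doteq> (\<Sum>i\<in>I. pt i (s i))"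
    if xA: "x \<in> A" for x
  proof -
    obtain q where q: "\<And>i. i < d \<Longrightarrow> is_point (q i)" "x \<doteq> (\<Sum>i<d. q i)"
      using A(1)[OF xA] unfolding is_point_sum_def by blast
    obtain T I s where "I \<subseteq> E - T" "card I = d" "\<forall>i\<in>I. 0 \<le> s i \<and> s i \<le> len i"
      "(\<Sum>i<d. q i) \<doteq> (\<Sum>i\<in>I. pt i (s i))"
      using placed_sum_points[OF d, of q] q(1) unfolding placed_def by blast
    then show ?thesis using eqv_trans[OF q(2)] by blast
  qed
  then have "\<forall>x\<in>A. \<exists>I s. I \<subseteq> E \<and> card I = d \<and> (\<forall>i\<in>I. 0 \<le> s i \<and> s i \<le> len i) \<and> x \<doteq> (\<Sum>i\<in>I. pt i (s i))" ..
  from this[unfolded bchoice_iff] obtain I s where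
    "\<forall>x\<in>A. I x \<subseteq> E \<and> card (I x) = d \<and> (\<forall>i\<in>I x. 0 \<le> s x i \<and> s x i \<le> len i)
      \<and> x \<doteq> (\<Sum>i\<in>I x. pt i (s x i))" by blast
  then have I: "\<And>x. x \<in> A \<Longrightarrow> I x \<subseteq> E \<and> card (I x) = d"
    and s: "\<And>x i. x \<in> A \<Longrightarrow> i \<in> I x \<Longrightarrow> 0 \<le> s x i \<and> s x i \<le> len i"
    and xs: "\<And>x. x \<in> A \<Longrightarrow> x \<doteq> (\<Sum>i\<in>I x. pt i (s x i))" by auto
  have "inj_on I A"
  proof (rule inj_onI)
    fix x y assume xy: "x \<in> A" "y \<in> A" "I x = I y"
    have tor: "is_torsion ((\<Sum>i\<in>I z. pt i (s z i)) - D)" if "z \<in> A" for z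
      using is_torsion_cong[OF eqv_diff[OF eqv_sym[OF xs[OF that]] eqv_refl]] A(1)[OF that] by blast
    have "(\<Sum>i\<in>I x. pt i (s y i)) \<doteq> (\<Sum>i\<in>I x. pt i (s x i))"
    proof (rule cell_torsion_unique[OF _ _ _ _ F])
      show "I x \<subseteq> E" "card (I x) = d" using I[OF xy(1)] by auto
      show "is_torsion ((\<Sum>i\<in>I x. pt i (s x i)) - D)" "is_torsion ((\<Sum>i\<in>I x. pt i (s y i)) - D)"
        using tor[OF xy(1)] tor[OF xy(2)] xy(3) by auto
    qed (use s xy in auto)
    then have "(\<Sum>i\<in>I x. pt i (s y i)) \<doteq> x" using eqv_trans eqv_sym[OF xs[OF xy(1)]] by blast
    then have "y \<doteq> x" using eqv_trans[OF xs[OF xy(2)]] xy(3) by simp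
    then show "x = y" using A(2) xy eqv_sym by blast
  qed
  then have "card A \<le> card {I. I \<subseteq> E \<and> card I = d}"
    using I finE by (intro card_inj_on_le[of I]) auto
  then show ?thesis by (simp add: n_subsets[OF finE])
qed

lemma torsion_bound_genus:
  assumes E: "card V < card E" and d: "d + card V \<le> card E + 1"
    and F: "finite F" "\<And>x. is_point_sum d x \<Longrightarrow> is_torsion (x - D) \<Longrightarrow> \<exists>r\<in>F. x \<doteq> r"
    and A: "\<And>x. x \<in> A \<Longrightarrow> is_point_sum d x \<and> is_torsion (x - D)"
      "\<And>x y. x \<in> A \<Longrightarrow> y \<in> A \<Longrightarrow> x \<doteq> y \<Longrightarrow> x = y"
  shows "card A \<le> 3 * (card E - card V) choose d"
proof -
  obtain V' :: "'v set" and E' :: "'e set" and src' tgt' len' \<delta>' c' where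
    tr: "tropical_graph P V' E' src' tgt' len' \<delta>' c'"
    and cd: "card V' + card E = card V + card E'" "3 * card V' \<le> 2 * card E'"
    and pts: "tropical_graph.is_point P V' E' src' len' \<delta>' c' = is_point"
    using tropical_reduction[OF tropical_graph_axioms E] by (elim exE conjE)
  interpret R: tropical_graph P V' E' src' tgt' len' \<delta>' c' by (rule tr)
  have ps: "R.is_point_sum = is_point_sum"
    unfolding R.is_point_sum_def is_point_sum_def pts ..
  have "card A \<le> card E' choose d"
  proof (rule R.torsion_bound[of d F D, unfolded ps])
    show "d + card V' \<le> card E' + 1" using d cd(1) by linarith
  qed (fact F A)+
  also have "\<dots> \<le> 3 * (card E - card V) choose d"
    using cd E by (intro binomial_right_mono) auto
  finally show ?thesis .
qed

end

section \<open>Relations between the edge functions\<close>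

text \<open>The flow is applied both to potentials in \<open>int\<close> and to potentials in the group of divisors.\<close>

lemma ex_flow:
  fixes src tgt :: "'e \<Rightarrow> 'v"
  assumes T: "finite T" "cut_conn src tgt T V" and src: "\<And>e. e \<in> T \<Longrightarrow> src e \<in> V \<and> tgt e \<in> V"
    and u: "u \<in> V" and v: "v \<in> V"
  shows "\<exists>z. (\<forall>c :: 'v \<Rightarrow> int. (\<Sum>e\<in>T. z e * (c (tgt e) - c (src e))) = c v - c u) \<and>
    (\<forall>c :: 'v \<Rightarrow> 'a \<Rightarrow>\<^sub>0 int. (\<Sum>e\<in>T. frag_cmul (z e) (c (tgt e) - c (src e))) = c v - c u)"
proof -
  define Q where "Q z w \<longleftrightarrow> (\<forall>c :: 'v \<Rightarrow> int. (\<Sum>e\<in>T. z e * (c (tgt e) - c (src e))) = c w - c u) \<and>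
    (\<forall>c :: 'v \<Rightarrow> 'a \<Rightarrow>\<^sub>0 int. (\<Sum>e\<in>T. frag_cmul (z e) (c (tgt e) - c (src e))) = c w - c u)" for z w
  \<comment> \<open>The vertices that a unit flow from \<open>u\<close> can reach. Crossing one more
    edge of \<open>T\<close> adds this edge to the flow, with the sign of its direction.\<close>
  define R where "R = {w \<in> V. \<exists>z. Q z w}"
  have "Q (\<lambda>_. 0) u" by (simp add: Q_def)
  then have uR: "u \<in> R" using u by (auto simp: R_def)
  have upd: "(\<Sum>e\<in>T. (z e + (if e = a then k else 0)) * (c (tgt e) - c (src e))) =
      (\<Sum>e\<in>T. z e * (c (tgt e) - c (src e))) + k * (c (tgt a) - c (src a))"
    if "a \<in> T" for z a k and c :: "'v \<Rightarrow> int"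
    using T(1) that by (simp add: distrib_right sum.distrib if_distrib[of "\<lambda>k. k * _"] cong: if_cong)
  have upd': "(\<Sum>e\<in>T. frag_cmul (z e + (if e = a then k else 0)) (c (tgt e) - c (src e))) =
      (\<Sum>e\<in>T. frag_cmul (z e) (c (tgt e) - c (src e))) + frag_cmul k (c (tgt a) - c (src a))"
    if "a \<in> T" for z a k and c :: "'v \<Rightarrow> 'a \<Rightarrow>\<^sub>0 int"
    using T(1) that by (simp add: frag_cmul_distrib sum.distrib if_distrib[of "\<lambda>k. frag_cmul k _"] cong: if_cong)
  have "R = V"
  proof (rule ccontr)
    assume "R \<noteq> V"
    then have "R \<subset> V" by (auto simp: R_def)
    then obtain a where a: "a \<in> T" "joins src tgt a R (V - R)" using T(2) uR unfolding cut_conn_def by blast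
    then consider "src a \<in> R" "tgt a \<in> V - R" | "tgt a \<in> R" "src a \<in> V - R" by (auto simp: joins_def)
    then show False
    proof cases
      case 1
      then obtain z where "Q z (src a)" by (auto simp: R_def)
      then have "Q (\<lambda>e. z e + (if e = a then 1 else 0)) (tgt a)"
        unfolding Q_def upd[OF a(1)] upd'[OF a(1)] by simp
      then show False using 1 by (auto simp: R_def)
    next
      case 2
      then obtain z where "Q z (tgt a)" by (auto simp: R_def)
      then have "Q (\<lambda>e. z e + (if e = a then - 1 else 0)) (src a)"
        unfolding Q_def upd[OF a(1)] upd'[OF a(1)] by simp
      then show False using 2 by (auto simp: R_def)
    qed
  qed
  then show ?thesis using v unfolding R_def Q_def by blast
qed

context tropical_graph begin

lemma \<delta>_cmul: "e \<in> E \<Longrightarrow> \<delta> e (of_int k * x) \<doteq> frag_cmul k (\<delta> e x)"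
proof (cases k rule: int_cases2)
  case (nonneg n)
  assume "e \<in> E"
  then show ?thesis using nonneg \<delta>_mult by simp
next
  case (nonpos n)
  assume e: "e \<in> E"
  have "\<delta> e (- (real n * x)) \<doteq> - \<delta> e (real n * x)" by (rule \<delta>_minus[OF e])
  also have "\<dots> \<doteq> - frag_cmul (int n) (\<delta> e x)" by (intro eqv_minus \<delta>_mult e)
  finally show ?thesis using nonpos by simp
qed

lemma \<delta>_sum: "finite A \<Longrightarrow> e \<in> E \<Longrightarrow> \<delta> e (\<Sum>a\<in>A. f a) \<doteq> (\<Sum>a\<in>A. \<delta> e (f a))"
proof (induction A rule: finite_induct)
  case (insert a A)
  have "\<delta> e (f a + sum f A) \<doteq> \<delta> e (f a) + \<delta> e (sum f A)" using \<delta>_add' insert by blast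
  also have "\<dots> \<doteq> \<delta> e (f a) + (\<Sum>a\<in>A. \<delta> e (f a))" using insert by (intro eqv_add) auto
  finally show ?case using insert by simp
qed (simp add: \<delta>_0)

text \<open>
  The relation expresses that the boundary of the fundamental cycle of \<open>i\<close> vanishes, with the tree
  edges eliminated by means of their fundamental cuts.
\<close>

lemma ex_relation:
  assumes T: "T \<subseteq> E" "cut_conn src tgt T V" "card T + 1 = card V" and i: "i \<in> E - T"
  obtains x where "0 < x i" "(\<Sum>j\<in>E - T. \<delta> j (x j)) \<in> P"
proof -
  have finT: "finite T" using T finE finite_subset by blast
  \<comment> \<open>Without \<open>e\<close> the tree has too few edges to connect \<open>V\<close>.
    A cut \<open>U\<close> that it misses is the fundamental cut of \<open>e\<close>.\<close>
  have "\<exists>U. U \<subset> V \<and> U \<noteq> {} \<and> (\<forall>a\<in>T - {e}. \<not> joins src tgt a U (V - U))" if e: "e \<in> T" for e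
  proof -
    have "\<not> cut_conn src tgt (T - {e}) V"
    proof
      assume "cut_conn src tgt (T - {e}) V"
      then have "card V \<le> card (T - {e}) + 1" using finV finT by (intro card_le_cut_conn) auto
      moreover have "card (T - {e}) < card T" using e finT by (rule card_Diff1_less[rotated])
      ultimately show False using T by linarith
    qed
    then show ?thesis unfolding cut_conn_def by blast
  qed
  then obtain U where U: "\<And>e. e \<in> T \<Longrightarrow> U e \<subset> V" "\<And>e. e \<in> T \<Longrightarrow> U e \<noteq> {}"
    "\<And>e a. e \<in> T \<Longrightarrow> a \<in> T \<Longrightarrow> a \<noteq> e \<Longrightarrow> \<not> joins src tgt a (U e) (V - U e)"
    by (metis Diff_iff singletonD)
  define \<sigma> where "\<sigma> e a = cut_sign (U e) a" for e a
  have \<sigma>0: "\<sigma> e a = 0" if "e \<in> T" "a \<in> T" "a \<noteq> e" for e a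
    using U(3)[OF that] src_in[of a] tgt_in[of a] that T by (auto simp: \<sigma>_def cut_sign_def joins_def)
  have \<sigma>1: "\<sigma> e e * \<sigma> e e = 1" if e: "e \<in> T" for e
  proof -
    obtain a where a: "a \<in> T" "joins src tgt a (U e) (V - U e)"
      using T(2) U(1,2)[OF e] unfolding cut_conn_def by blast
    then have "a = e" using U(3)[OF e] by blast
    then show ?thesis using a by (auto simp: \<sigma>_def cut_sign_def joins_def)
  qed
  have finI: "finite (E - T)" using finE by simp
  \<comment> \<open>The firing relation of the fundamental cut, solved for the tree edge
    \<open>e\<close>, whose own coefficient is plus or minus one.\<close>
  have \<delta>T: "\<delta> e y \<doteq> - (\<Sum>j\<in>E - T. frag_cmul (\<sigma> e e * \<sigma> e j) (\<delta> j y))" if e: "e \<in> T" for e y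
  proof -
    have "(\<Sum>a\<in>E. frag_cmul (\<sigma> e a) (\<delta> a y)) =
        (\<Sum>a\<in>T. frag_cmul (\<sigma> e a) (\<delta> a y)) + (\<Sum>a\<in>E - T. frag_cmul (\<sigma> e a) (\<delta> a y))"
      using sum.subset_diff[OF T(1) finE] by (simp add: add.commute)
    also have "(\<Sum>a\<in>T. frag_cmul (\<sigma> e a) (\<delta> a y)) = (\<Sum>a\<in>{e}. frag_cmul (\<sigma> e a) (\<delta> a y))"
      using e finT \<sigma>0[OF e] by (intro sum.mono_neutral_right) auto
    finally have "frag_cmul (\<sigma> e e) (\<delta> e y) + (\<Sum>a\<in>E - T. frag_cmul (\<sigma> e a) (\<delta> a y)) \<in> P"
      using cut_mem[of "U e" y] U(1)[OF e] by (simp add: \<sigma>_def)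
    from cmul_mem[OF this, of "\<sigma> e e"] show ?thesis
      by (simp add: frag_cmul_distrib2 frag_cmul_sum \<sigma>1[OF e] eqv_def)
  qed
  have iE: "i \<in> E" using i by simp
  \<comment> \<open>The way back along the tree in the fundamental cycle of \<open>i\<close>, as a
    flow from \<open>tgt i\<close> to \<open>src i\<close>.\<close>
  obtain z where z: "\<And>c :: 'v \<Rightarrow> int. (\<Sum>e\<in>T. z e * (c (tgt e) - c (src e))) = c (src i) - c (tgt i)"
    "\<And>c :: 'v \<Rightarrow> 'a \<Rightarrow>\<^sub>0 int. (\<Sum>e\<in>T. frag_cmul (z e) (c (tgt e) - c (src e))) = c (src i) - c (tgt i)"
    using ex_flow[OF finT T(2), of "tgt i" "src i"] src_in tgt_in T iE by blast
  \<comment> \<open>The flow is evaluated on the indicator function of \<open>U e\<close>: a cycle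
    crosses a cut equally often in both directions, which ties its coefficient at \<open>e\<close>
    to the sign of \<open>i\<close> in the cut.\<close>
  have ze: "z e * \<sigma> e e = - \<sigma> e i" if e: "e \<in> T" for e
  proof -
    have "(\<Sum>a\<in>T. z a * (of_bool (tgt a \<in> U e) - of_bool (src a \<in> U e))) = (\<Sum>a\<in>T. - (z a * \<sigma> e a))"
      by (intro sum.cong) (auto simp: \<sigma>_def cut_sign_def algebra_simps)
    also have "\<dots> = (\<Sum>a\<in>{e}. - (z a * \<sigma> e a))"
      using e finT \<sigma>0[OF e] by (intro sum.mono_neutral_right) auto
    finally show ?thesis using z(1)[of "\<lambda>v. of_bool (v \<in> U e)"] by (simp add: \<sigma>_def cut_sign_def)
  qed
  \<comment> \<open>The length pairing of the fundamental cycles of \<open>i\<close> and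
    \<open>j\<close>. For \<open>j = i\<close> it is the length of the cycle, hence
    positive.\<close>
  define x where "x j = (if j = i then len i else 0) + (\<Sum>e\<in>T. of_int (\<sigma> e i * \<sigma> e j) * len e)" for j
  have "0 \<le> (\<Sum>e\<in>T. of_int (\<sigma> e i * \<sigma> e i) * len e)"
    using len_pos T by (intro sum_nonneg mult_nonneg_nonneg) (auto simp: less_imp_le subset_iff)
  then have "0 < x i" using len_pos[OF iE] by (simp add: x_def)
  moreover have "(\<Sum>j\<in>E - T. \<delta> j (x j)) \<in> P"
  proof -
    have "\<delta> j (x j) \<doteq> (if j = i then \<delta> i (len i) else 0) + (\<Sum>e\<in>T. frag_cmul (\<sigma> e i * \<sigma> e j) (\<delta> j (len e)))"
      if "j \<in> E - T" for j
    proof -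
      have j: "j \<in> E" using that by simp
      have "\<delta> j (x j) \<doteq> \<delta> j (if j = i then len i else 0) + \<delta> j (\<Sum>e\<in>T. of_int (\<sigma> e i * \<sigma> e j) * len e)"
        unfolding x_def by (rule \<delta>_add'[OF j])
      also have "\<dots> \<doteq> (if j = i then \<delta> i (len i) else 0) + (\<Sum>e\<in>T. \<delta> j (of_int (\<sigma> e i * \<sigma> e j) * len e))"
        using \<delta>_0[OF j] by (intro eqv_add \<delta>_sum j finT) auto
      also have "\<dots> \<doteq> (if j = i then \<delta> i (len i) else 0) + (\<Sum>e\<in>T. frag_cmul (\<sigma> e i * \<sigma> e j) (\<delta> j (len e)))"
        by (intro eqv_add eqv_sum \<delta>_cmul j) auto
      finally show ?thesis .
    qed
    then have "(\<Sum>j\<in>E - T. \<delta> j (x j)) \<doteq>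
        (\<Sum>j\<in>E - T. (if j = i then \<delta> i (len i) else 0) + (\<Sum>e\<in>T. frag_cmul (\<sigma> e i * \<sigma> e j) (\<delta> j (len e))))"
      by (intro eqv_sum)
    also have "\<dots> = \<delta> i (len i) + (\<Sum>e\<in>T. \<Sum>j\<in>E - T. frag_cmul (\<sigma> e i * \<sigma> e j) (\<delta> j (len e)))"
      using finI i by (simp add: sum.distrib sum.swap[of _ T])
    also have "\<dots> \<doteq> \<delta> i (len i) + (\<Sum>e\<in>T. frag_cmul (z e) (c (tgt e) - c (src e)))"
    proof (intro eqv_add eqv_sum eqv_refl)
      fix e assume e: "e \<in> T"
      then have eE: "e \<in> E" using T by auto
      have zz: "z e * (\<sigma> e e * k) = - (\<sigma> e i * k)" for k using ze[OF e] by (metis mult.assoc mult_minus_left)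
      have "c (tgt e) - c (src e) \<doteq> \<delta> e (len e)" using c_tgt[OF eE] by (simp add: eqv_def algebra_simps)
      also have "\<dots> \<doteq> - (\<Sum>j\<in>E - T. frag_cmul (\<sigma> e e * \<sigma> e j) (\<delta> j (len e)))" by (rule \<delta>T[OF e])
      finally have "frag_cmul (z e) (c (tgt e) - c (src e)) \<doteq>
          frag_cmul (z e) (- (\<Sum>j\<in>E - T. frag_cmul (\<sigma> e e * \<sigma> e j) (\<delta> j (len e))))" by (rule eqv_cmul)
      also have "\<dots> = - (\<Sum>j\<in>E - T. frag_cmul (z e * (\<sigma> e e * \<sigma> e j)) (\<delta> j (len e)))"
        by (simp add: frag_cmul_sum)
      also have "\<dots> = (\<Sum>j\<in>E - T. frag_cmul (\<sigma> e i * \<sigma> e j) (\<delta> j (len e)))"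
        unfolding zz sum_negf[symmetric] by simp
      finally show "(\<Sum>j\<in>E - T. frag_cmul (\<sigma> e i * \<sigma> e j) (\<delta> j (len e))) \<doteq> frag_cmul (z e) (c (tgt e) - c (src e))"
        by (rule eqv_sym)
    qed
    also have "\<dots> = \<delta> i (len i) + (c (src i) - c (tgt i))" by (simp only: z(2))
    also have "\<dots> \<doteq> 0" using uminus_mem[OF c_tgt[OF iE]] by (simp add: eqv_def algebra_simps)
    finally show ?thesis by (simp add: eqv_0_iff)
  qed
  ultimately show ?thesis using that by blast
qed

end

section \<open>Paths and spheres in a model\<close>

lemma connected_iff_cut_conn:
  assumes "wf_digraph G"
  shows "Digraph_Component.connected G \<longleftrightarrow>
    verts G \<noteq> {} \<and> cut_conn (tail G) (head G) (arcs G) (verts G)"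
proof -
  interpret wf_digraph G by fact
  let ?S = "with_proj (mk_symmetric G)"
  have adj: "(u, v) \<in> arcs_ends ?S \<longleftrightarrow> (\<exists>e\<in>arcs G. joins (tail G) (head G) e {u} {v})" for u v
    by (auto simp: parcs_mk_symmetric joins_def)
  show ?thesis
  proof
    assume c: "Digraph_Component.connected G"
    then have ne: "verts G \<noteq> {}" by (simp add: connected_def strongly_connected_def)
    have "cut_conn (tail G) (head G) (arcs G) (verts G)"
      unfolding cut_conn_def
    proof (intro allI impI)
      fix Y assume Y: "Y \<subset> verts G" "Y \<noteq> {}"
      then obtain u v where uv: "u \<in> Y" "v \<in> verts G" "v \<notin> Y" by blast
      then have "u \<rightarrow>\<^sup>*\<^bsub>?S\<^esub> v" using c Y by (auto simp: connected_def strongly_connected_def)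
      then have "(u, v) \<in> rtrancl_on (verts G) (arcs_ends ?S)" by (simp add: reachable_def)
      then have "v \<in> Y \<or> (\<exists>e\<in>arcs G. joins (tail G) (head G) e Y (verts G - Y))"
      proof (induction rule: rtrancl_on_induct)
        case (step y z)
        then obtain e where "e \<in> arcs G" "joins (tail G) (head G) e {y} {z}" using adj by blast
        then show ?case using step by (auto simp: joins_def)
      qed (use uv in simp)
      then show "\<exists>e\<in>arcs G. joins (tail G) (head G) e Y (verts G - Y)" using uv by blast
    qed
    with ne show "verts G \<noteq> {} \<and> cut_conn (tail G) (head G) (arcs G) (verts G)" ..
  next
    assume c: "verts G \<noteq> {} \<and> cut_conn (tail G) (head G) (arcs G) (verts G)"
    have "(u, v) \<in> rtrancl_on (verts G) (arcs_ends ?S)" if u: "u \<in> verts G" and v: "v \<in> verts G" for u v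
    proof -
      define R where "R = {w \<in> verts G. (u, w) \<in> rtrancl_on (verts G) (arcs_ends ?S)}"
      have "u \<in> R" using u by (simp add: R_def)
      have "R = verts G"
      proof (rule ccontr)
        assume "R \<noteq> verts G"
        then have "R \<subset> verts G" by (auto simp: R_def)
        then obtain e where e: "e \<in> arcs G" "joins (tail G) (head G) e R (verts G - R)"
          using c \<open>u \<in> R\<close> unfolding cut_conn_def by blast
        then have "(tail G e \<in> R \<and> head G e \<in> verts G - R) \<or> (head G e \<in> R \<and> tail G e \<in> verts G - R)"
          by (auto simp: joins_def)
        then obtain y z where yz: "y \<in> R" "z \<in> verts G - R" "joins (tail G) (head G) e {y} {z}"
          unfolding joins_def by blast
        then have "(y, z) \<in> arcs_ends ?S" using adj e by blast
        then have "z \<in> R" using yz by (auto simp: R_def intro: rtrancl_on_into_rtrancl_on)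
        then show False using yz by simp
      qed
      then show ?thesis using v by (auto simp: R_def)
    qed
    then show "Digraph_Component.connected G"
      using c by (simp add: connected_def strongly_connected_def reachable_def)
  qed
qed

section \<open>Lengths of paths\<close>

lemma edge_path_nonneg: "edge_path G len \<phi> x y l \<Longrightarrow> 0 \<le> l"
  by (induction rule: edge_path.induct) auto

lemma edge_path_segment:
  "e \<in> arcs G \<Longrightarrow> s \<in> {0..len e} \<Longrightarrow> t \<in> {0..len e} \<Longrightarrow> edge_path G len \<phi> (\<phi> e s) (\<phi> e t) \<bar>t - s\<bar>"
  using edge_path_step[OF edge_path_refl, of e G s len t \<phi>] by simp

lemma edge_path_trans:
  assumes "edge_path G len \<phi> y z l'" "edge_path G len \<phi> x y l"
  shows "edge_path G len \<phi> x z (l + l')"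
  using assms
proof (induction rule: edge_path.induct)
  case (edge_path_step y e s L t)
  then have "edge_path G len \<phi> x (\<phi> e t) (l + L + \<bar>t - s\<bar>)" by (intro edge_path.edge_path_step) auto
  then show ?case by (simp add: add.assoc)
qed simp

lemma edge_path_sym: "edge_path G len \<phi> x y l \<Longrightarrow> edge_path G len \<phi> y x l"
proof (induction rule: edge_path.induct)
  case (edge_path_step x e s L t)
  have "edge_path G len \<phi> (\<phi> e t) (\<phi> e s) \<bar>s - t\<bar>" using edge_path_step by (intro edge_path_segment) auto
  from edge_path_trans[OF edge_path_step(5) this] show ?case by (simp add: abs_minus_commute add.commute)
qed (rule edge_path_refl)

locale graph_model =
  fixes \<Gamma> :: "'a metric" and G :: "('a, nat) pre_digraph" and len :: "nat \<Rightarrow> real" and \<phi> :: "nat \<Rightarrow> real \<Rightarrow> 'a"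
  assumes is_model: "is_model \<Gamma> G len \<phi>"
begin

sublocale fin_digraph G
  using is_model by (simp add: is_model_def)

lemma verts_ne: "verts G \<noteq> {}" and G_cut_conn: "cut_conn (tail G) (head G) (arcs G) (verts G)"
  using is_model connected_iff_cut_conn[of G] wf_digraph_axioms by (simp_all add: is_model_def)

lemma len_pos: "e \<in> arcs G \<Longrightarrow> 0 < len e"
  and \<phi>_0: "e \<in> arcs G \<Longrightarrow> \<phi> e 0 = tail G e"
  and \<phi>_len: "e \<in> arcs G \<Longrightarrow> \<phi> e (len e) = head G e"
  and \<phi>_not_vert: "e \<in> arcs G \<Longrightarrow> 0 < t \<Longrightarrow> t < len e \<Longrightarrow> \<phi> e t \<notin> verts G"
  using is_model by (auto simp: is_model_def)

lemma \<phi>_in_verts_iff: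
  assumes "e \<in> arcs G" "0 \<le> t" "t \<le> len e"
  shows "\<phi> e t \<in> verts G \<longleftrightarrow> t = 0 \<or> t = len e"
  using \<phi>_not_vert[OF assms(1), of t] assms \<phi>_0 \<phi>_len by fastforce

lemma \<phi>_eqD:
  assumes "\<phi> e s = \<phi> e' t" "e \<in> arcs G" "e' \<in> arcs G" "0 < s" "s < len e" "0 \<le> t" "t \<le> len e'"
  shows "e = e'" "s = t"
proof -
  have "\<phi> e' t \<notin> verts G" using \<phi>_not_vert[of e s] assms by simp
  then have "t \<noteq> 0" "t \<noteq> len e'" using assms \<phi>_0 \<phi>_len head_in_verts tail_in_verts by metis+
  then have t: "0 < t" "t < len e'" using assms by auto
  have "inj_on (\<lambda>(e, t). \<phi> e t) (SIGMA e:arcs G. {0<..<len e})" using is_model by (simp add: is_model_def)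
  from inj_onD[OF this, of "(e, s)" "(e', t)"] assms t show "e = e'" "s = t" by auto
qed

lemma mspace_eq: "mspace \<Gamma> = verts G \<union> (\<Union>e\<in>arcs G. \<phi> e ` {0..len e})"
  using is_model by (simp add: is_model_def)

lemma vert_in_mspace: "v \<in> verts G \<Longrightarrow> v \<in> mspace \<Gamma>"
  by (simp add: mspace_eq)

lemma \<phi>_in_mspace: "e \<in> arcs G \<Longrightarrow> 0 \<le> t \<Longrightarrow> t \<le> len e \<Longrightarrow> \<phi> e t \<in> mspace \<Gamma>"
  by (force simp: mspace_eq)

lemma mspace_cases:
  assumes "x \<in> mspace \<Gamma>"
  obtains "x \<in> verts G" | e t where "e \<in> arcs G" "0 < t" "t < len e" "x = \<phi> e t"
proof -
  from assms consider "x \<in> verts G" | e t where "e \<in> arcs G" "0 \<le> t" "t \<le> len e" "x = \<phi> e t"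
    by (auto simp: mspace_eq)
  then show ?thesis
  proof cases
    case 2
    then show ?thesis using that(1) that(2)[of e t] \<phi>_in_verts_iff[of e t] by (cases "t = 0 \<or> t = len e") auto
  qed (rule that(1))
qed

lemma mdist_eq: "x \<in> mspace \<Gamma> \<Longrightarrow> y \<in> mspace \<Gamma> \<Longrightarrow> mdist \<Gamma> x y = Inf {l. edge_path G len \<phi> x y l}"
  using is_model by (simp add: is_model_def)

lemma ex_edge_path:
  assumes x: "x \<in> mspace \<Gamma>" and y: "y \<in> mspace \<Gamma>"
  shows "\<exists>l. edge_path G len \<phi> x y l"
proof -
  have to_vert: "\<exists>v\<in>verts G. \<exists>l. edge_path G len \<phi> x v l" if x: "x \<in> mspace \<Gamma>" for x
    using x
  proof (cases rule: mspace_cases)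
    case 1
    then show ?thesis using edge_path_refl by metis
  next
    case (2 e t)
    then have "edge_path G len \<phi> (\<phi> e t) (\<phi> e 0) \<bar>0 - t\<bar>" by (intro edge_path_segment) auto
    then show ?thesis using 2 \<phi>_0 tail_in_verts by metis
  qed
  obtain u k where u: "u \<in> verts G" "edge_path G len \<phi> x u k" using to_vert[OF x] by blast
  obtain v k' where v: "v \<in> verts G" "edge_path G len \<phi> y v k'" using to_vert[OF y] by blast
  define R where "R = {w \<in> verts G. \<exists>l. edge_path G len \<phi> u w l}"
  have uR: "u \<in> R" using u edge_path_refl[of G len \<phi> u] unfolding R_def by blast
  have "R = verts G"
  proof (rule ccontr)
    assume "R \<noteq> verts G"
    then have "R \<subset> verts G" by (auto simp: R_def)
    then obtain e where e: "e \<in> arcs G" "joins (tail G) (head G) e R (verts G - R)"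
      using G_cut_conn uR unfolding cut_conn_def by blast
    have "edge_path G len \<phi> (tail G e) (head G e) (len e)"
      using edge_path_segment[OF e(1), of 0 len "len e" \<phi>] len_pos[OF e(1)] \<phi>_0 \<phi>_len e by simp
    then show False using e(2) edge_path_trans edge_path_sym unfolding joins_def R_def by fastforce
  qed
  then obtain l where "edge_path G len \<phi> u v l" using v by (auto simp: R_def)
  then show ?thesis using edge_path_trans edge_path_sym u v by metis
qed

lemma mdist_le: "x \<in> mspace \<Gamma> \<Longrightarrow> y \<in> mspace \<Gamma> \<Longrightarrow> edge_path G len \<phi> x y l \<Longrightarrow> mdist \<Gamma> x y \<le> l"
  unfolding mdist_eq by (intro cInf_lower) (auto intro!: bdd_belowI[of _ 0] edge_path_nonneg)

lemma le_mdist: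
  assumes "x \<in> mspace \<Gamma>" "y \<in> mspace \<Gamma>" "\<And>l. edge_path G len \<phi> x y l \<Longrightarrow> b \<le> l"
  shows "b \<le> mdist \<Gamma> x y"
  unfolding mdist_eq[OF assms(1,2)] using ex_edge_path[OF assms(1,2)] assms(3)
  by (intro cInf_greatest) auto

lemma mdist_\<phi>_le: "e \<in> arcs G \<Longrightarrow> 0 \<le> s \<Longrightarrow> s \<le> len e \<Longrightarrow> 0 \<le> t \<Longrightarrow> t \<le> len e \<Longrightarrow> mdist \<Gamma> (\<phi> e s) (\<phi> e t) \<le> \<bar>t - s\<bar>"
  by (intro mdist_le edge_path_segment \<phi>_in_mspace) auto

section \<open>Small spheres around a vertex\<close>

lemma ex_small:
  obtains \<epsilon> where "0 < \<epsilon>" "\<And>e. e \<in> arcs G \<Longrightarrow> 2 * \<epsilon> \<le> len e"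
proof (cases "arcs G = {}")
  case False
  define \<epsilon> where "\<epsilon> = Min (len ` arcs G) / 2"
  have "0 < \<epsilon>" using False len_pos unfolding \<epsilon>_def by simp
  moreover have "2 * \<epsilon> \<le> len e" if "e \<in> arcs G" for e using that unfolding \<epsilon>_def by simp
  ultimately show ?thesis using that by blast
qed (use that[of 1] in auto)

text \<open>The distance from \<open>v\<close>, cut off at \<open>\<epsilon>\<close>, provided that all edges have length at least \<open>2 * \<epsilon>\<close>.\<close>

definition vdist :: "real \<Rightarrow> 'a \<Rightarrow> nat \<Rightarrow> real \<Rightarrow> real" where
  "vdist \<epsilon> v e t = min \<epsilon> (min (if tail G e = v then t else \<epsilon>) (if head G e = v then len e - t else \<epsilon>))"

text \<open>\<open>vdist\<close> is computed in a coordinate on an edge. Only vertices can have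
  several coordinates, and there its value is \<open>0\<close> at \<open>v\<close> and
  \<open>\<epsilon>\<close> elsewhere.\<close>

lemma vdist_cong:
  assumes "\<And>e. e \<in> arcs G \<Longrightarrow> 2 * \<epsilon> \<le> len e" "0 < \<epsilon>"
    and "e \<in> arcs G" "0 \<le> s" "s \<le> len e" "e' \<in> arcs G" "0 \<le> t" "t \<le> len e'" "\<phi> e s = \<phi> e' t"
  shows "vdist \<epsilon> v e s = vdist \<epsilon> v e' t"
proof (cases "\<phi> e s \<in> verts G")
  case False
  then have "0 < s" "s < len e" using \<phi>_in_verts_iff[of e s] assms by auto
  then show ?thesis using \<phi>_eqD[of e s e' t] assms by simp
next
  case True
  have *: "vdist \<epsilon> v e s = (if \<phi> e s = v then 0 else \<epsilon>)"
    if "e \<in> arcs G" "s = 0 \<or> s = len e" for e s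
    using that assms(2) assms(1)[of e] \<phi>_0[of e] \<phi>_len[of e] unfolding vdist_def by auto
  have "s = 0 \<or> s = len e" "t = 0 \<or> t = len e'" using True \<phi>_in_verts_iff assms by metis+
  then show ?thesis using *[of e s] *[of e' t] assms by simp
qed

text \<open>Along a segment \<open>vdist\<close> grows by at most the length of the segment, and it
  vanishes at \<open>v\<close>. This bounds distances from below without a description of shortest
  paths.\<close>

lemma vdist_le_edge_path:
  assumes \<epsilon>: "\<And>e. e \<in> arcs G \<Longrightarrow> 2 * \<epsilon> \<le> len e" "0 < \<epsilon>" and v: "v \<in> verts G"
    and p: "edge_path G len \<phi> v y l"
  shows "y = \<phi> e t \<Longrightarrow> e \<in> arcs G \<Longrightarrow> 0 \<le> t \<Longrightarrow> t \<le> len e \<Longrightarrow> vdist \<epsilon> v e t \<le> l"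
  using p v
proof (induction arbitrary: e t rule: edge_path.induct)
  case (edge_path_refl x)
  then have "t = 0 \<or> t = len e" using \<phi>_in_verts_iff[of e t] by auto
  then have "tail G e = x \<and> t = 0 \<or> head G e = x \<and> t = len e"
    using \<phi>_0[OF edge_path_refl(2)] \<phi>_len[OF edge_path_refl(2)] edge_path_refl(1) by auto
  then show ?case by (auto simp: vdist_def min_def)
next
  case (edge_path_step x e' s L t')
  have "vdist \<epsilon> x e' s \<le> L" 
    using edge_path_step.hyps edge_path_step.prems(5) by (intro edge_path_step.IH) auto
  moreover have "vdist \<epsilon> x e' t' \<le> vdist \<epsilon> x e' s + \<bar>t' - s\<bar>"
    by (cases "tail G e' = x"; cases "head G e' = x") (simp_all add: vdist_def min_def abs_if)
  moreover have "vdist \<epsilon> x e' t' = vdist \<epsilon> x e t"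
    using edge_path_step.hyps edge_path_step.prems(1-4) by (intro vdist_cong[OF \<epsilon>]) simp_all
  ultimately show ?case by linarith
qed

definition sphere_at where "sphere_at v r =
  (\<lambda>e. \<phi> e r) ` {e \<in> arcs G. tail G e = v} \<union> (\<lambda>e. \<phi> e (len e - r)) ` {e \<in> arcs G. head G e = v}"

text \<open>The lower bound for the distance is \<open>vdist\<close>, the upper bound is the segment
  of the edge itself.\<close>

lemma sphere_vertex:
  assumes \<epsilon>: "\<And>e. e \<in> arcs G \<Longrightarrow> 2 * \<epsilon> \<le> len e" and v: "v \<in> verts G" and r: "0 < r" "r < \<epsilon>"
  shows "{y \<in> mspace \<Gamma>. mdist \<Gamma> v y = r} = sphere_at v r"
proof (intro equalityI subsetI)
  have \<epsilon>0: "0 < \<epsilon>" using r by simp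
  have vm: "v \<in> mspace \<Gamma>" using v by (rule vert_in_mspace)
  have low: "vdist \<epsilon> v e t \<le> mdist \<Gamma> v (\<phi> e t)" if e: "e \<in> arcs G" "0 \<le> t" "t \<le> len e" for e t
    by (rule le_mdist[OF vm \<phi>_in_mspace[OF e]]) (rule vdist_le_edge_path[OF \<epsilon> \<epsilon>0 v _ refl e])
  have up_tail: "mdist \<Gamma> v (\<phi> e t) \<le> t" if "e \<in> arcs G" "0 \<le> t" "t \<le> len e" "tail G e = v" for e t
    using mdist_\<phi>_le[of e 0 t] that \<phi>_0[of e] by simp
  have up_head: "mdist \<Gamma> v (\<phi> e t) \<le> len e - t" if "e \<in> arcs G" "0 \<le> t" "t \<le> len e" "head G e = v" for e t
    using mdist_\<phi>_le[of e "len e" t] that \<phi>_len[of e] by simp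
  {
    fix y assume "y \<in> sphere_at v r"
    then obtain e t where e: "e \<in> arcs G" "y = \<phi> e t" "tail G e = v \<and> t = r \<or> head G e = v \<and> t = len e - r"
      by (auto simp: sphere_at_def)
    have t: "0 \<le> t" "t \<le> len e" using e \<epsilon>[OF e(1)] r by auto
    have "mdist \<Gamma> v y \<le> r" using up_tail[OF e(1) t] up_head[OF e(1) t] e(2,3) by auto
    moreover have "vdist \<epsilon> v e t = r" using e(3) \<epsilon>[OF e(1)] r by (auto simp: vdist_def min_def)
    ultimately show "y \<in> {y \<in> mspace \<Gamma>. mdist \<Gamma> v y = r}"
      using low[OF e(1) t] e(2) \<phi>_in_mspace[OF e(1) t] by simp
  next
    fix y assume "y \<in> {y \<in> mspace \<Gamma>. mdist \<Gamma> v y = r}"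
    then have y: "y \<in> mspace \<Gamma>" "mdist \<Gamma> v y = r" by auto
    moreover have "mdist \<Gamma> v v \<le> 0" by (rule mdist_le[OF vm vm edge_path_refl])
    ultimately have "y \<noteq> v" using r by auto
    obtain l where p: "edge_path G len \<phi> v y l" using ex_edge_path[OF vm y(1)] by blast
    have "\<exists>e t. e \<in> arcs G \<and> 0 \<le> t \<and> t \<le> len e \<and> y = \<phi> e t"
      using p by (cases rule: edge_path.cases) (use \<open>y \<noteq> v\<close> in auto)
    then obtain e t where e: "e \<in> arcs G" "0 \<le> t" "t \<le> len e" "y = \<phi> e t" by blast
    have "vdist \<epsilon> v e t \<le> r" using low[OF e(1-3)] e y by simp
    then consider "tail G e = v" "t \<le> r" | "head G e = v" "len e - t \<le> r"
      using r by (cases "tail G e = v"; cases "head G e = v") (auto simp: vdist_def min_le_iff_disj)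
    then show "y \<in> sphere_at v r"
    proof cases
      case 1
      then have "t = r" using up_tail[OF e(1-3)] e y by simp
      then show ?thesis using 1 e by (auto simp: sphere_at_def)
    next
      case 2
      then have "t = len e - r" using up_head[OF e(1-3)] e y by simp
      then show ?thesis using 2 e by (auto simp: sphere_at_def)
    qed
  }
qed

text \<open>The sphere is a set, yet it has one point for each half-edge at \<open>v\<close>: as
  \<open>2 * r < len e\<close>, even the two points on a loop are distinct.\<close>

lemma sum_sphere_at:
  assumes \<epsilon>: "\<And>e. e \<in> arcs G \<Longrightarrow> 2 * \<epsilon> \<le> len e" and r: "0 < r" "r < \<epsilon>"
  shows "sum g (sphere_at v r) = (\<Sum>e | e \<in> arcs G \<and> tail G e = v. g (\<phi> e r))
    + (\<Sum>e | e \<in> arcs G \<and> head G e = v. g (\<phi> e (len e - r)))"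
proof -
  have int: "0 < r" "r < len e" "0 < len e - r" "len e - r < len e" if "e \<in> arcs G" for e
    using \<epsilon>[OF that] r by auto
  have "inj_on (\<lambda>e. \<phi> e r) {e \<in> arcs G. tail G e = v}"
    by (rule inj_onI) (use \<phi>_eqD int in \<open>auto simp: less_imp_le\<close>)
  moreover have "inj_on (\<lambda>e. \<phi> e (len e - r)) {e \<in> arcs G. head G e = v}"
  proof (rule inj_onI)
    fix a b assume "a \<in> {e \<in> arcs G. head G e = v}" "b \<in> {e \<in> arcs G. head G e = v}" "\<phi> a (len a - r) = \<phi> b (len b - r)"
    then show "a = b" using \<phi>_eqD(1)[of a "len a - r" b "len b - r"] int[of a] int[of b] by auto
  qed
  moreover have "(\<lambda>e. \<phi> e r) ` {e \<in> arcs G. tail G e = v} \<inter> (\<lambda>e. \<phi> e (len e - r)) ` {e \<in> arcs G. head G e = v} = {}"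
  proof -
    have "\<phi> a r \<noteq> \<phi> b (len b - r)" if "a \<in> arcs G" "b \<in> arcs G" for a b
    proof
      assume "\<phi> a r = \<phi> b (len b - r)"
      then have "a = b" "r = len b - r" using \<phi>_eqD[of a r b "len b - r"] int[of a] int[of b] that by auto
      then show False using \<epsilon>[of b] r that by simp
    qed
    then show ?thesis by auto
  qed
  ultimately show ?thesis unfolding sphere_at_def by (subst sum.union_disjoint) (simp_all add: sum.reindex)
qed

end

section \<open>Subdivision\<close>

context graph_model begin

text \<open>Old and new model have the same paths, a segment across the new vertex being split in
  two, so the path metric is the same as well.\<close>

lemma subdivide:
  assumes e: "e \<in> arcs G" and t: "0 < t" "t < len e" and n: "n \<notin> arcs G"
  defines "G' \<equiv> \<lparr>verts = insert (\<phi> e t) (verts G), arcs = insert n (arcs G), tail = (tail G)(n := \<phi> e t),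
    head = (head G)(e := \<phi> e t, n := head G e)\<rparr>"
    and "len' \<equiv> len(e := t, n := len e - t)" and "\<phi>' \<equiv> \<phi>(n := \<lambda>s. \<phi> e (t + s))"
  shows "is_model \<Gamma> G' len' \<phi>'"
proof -
  have ne: "n \<noteq> e" using e n by auto
  \<comment> \<open>Translation of the new coordinates into the old ones: the new edge
    \<open>n\<close> is the rest of \<open>e\<close>, shifted by \<open>t\<close>.\<close>
  define a0 where "a0 a = (if a = n then e else a)" for a
  define s0 where "s0 a s = (if a = n then t + s else s)" for a and s :: real
  have \<phi>': "\<phi>' a s = \<phi> (a0 a) (s0 a s)" for a s by (simp add: \<phi>'_def a0_def s0_def)
  have a0: "a0 a \<in> arcs G" if "a \<in> arcs G'" for a using that e by (auto simp: a0_def G'_def)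
  have s0: "0 \<le> s0 a s" "s0 a s \<le> len (a0 a)" if "a \<in> arcs G'" "0 \<le> s" "s \<le> len' a" for a s
    using that t ne by (auto simp: a0_def s0_def len'_def split: if_splits)
  have s0': "0 < s0 a s" "s0 a s < len (a0 a)" if "a \<in> arcs G'" "0 < s" "s < len' a" for a s
    using that t ne by (auto simp: a0_def s0_def len'_def split: if_splits)
  have s0_ne: "\<not> (a0 a = e \<and> s0 a s = t)" if "a \<in> arcs G'" "0 < s" "s < len' a" for a s
    using that ne by (auto simp: a0_def s0_def len'_def split: if_splits)
  have wf: "fin_digraph G'"
  proof unfold_locales
    show "tail G' a \<in> verts G'" if "a \<in> arcs G'" for a using that by (auto simp: G'_def)
    show "head G' a \<in> verts G'" if "a \<in> arcs G'" for a using that e by (auto simp: G'_def)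
    show "finite (verts G')" "finite (arcs G')" by (simp_all add: G'_def)
  qed
  have conn: "Digraph_Component.connected G'"
  proof -
    have "cut_conn (tail G') (head G') (arcs G') (verts G')"
      unfolding cut_conn_def
    proof (intro allI impI)
      fix Y assume Y: "Y \<subset> verts G'" "Y \<noteq> {}"
      have ends: "tail G e \<in> verts G" "head G e \<in> verts G" "\<phi> e t \<notin> verts G"
        using e \<phi>_not_vert[OF e t] by auto
      have ends': "tail G' e = tail G e" "head G' e = \<phi> e t" "tail G' n = \<phi> e t" "head G' n = head G e"
        "e \<in> arcs G'" "n \<in> arcs G'" "verts G' = insert (\<phi> e t) (verts G)"
        using ne e by (auto simp: G'_def)
      \<comment> \<open>If no edge crosses, the new vertex and both ends of \<open>e\<close> lie on
        the same side, and \<open>Y\<close> would restrict to a cut of \<open>G\<close> without a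
        crossing edge.\<close>
      have vY: "v \<in> Y" if "v \<in> verts G" "\<not> (\<exists>a\<in>arcs G'. joins (tail G') (head G') a Y (verts G' - Y))" for v
      proof (rule ccontr)
        assume "v \<notin> Y"
        have eY: "tail G e \<in> Y \<longleftrightarrow> \<phi> e t \<in> Y" "\<phi> e t \<in> Y \<longleftrightarrow> head G e \<in> Y"
          using that(2) ends ends' unfolding joins_def by (metis DiffI insertCI)+
        have ne': "Y \<inter> verts G \<noteq> {}"
        proof
          assume "Y \<inter> verts G = {}"
          then have "Y = {\<phi> e t}" using Y ends' by auto
          then show False using eY ends by auto
        qed
        have "Y \<inter> verts G \<subset> verts G" using that(1) \<open>v \<notin> Y\<close> by auto
        from G_cut_conn this ne'
        obtain a where a: "a \<in> arcs G" "joins (tail G) (head G) a (Y \<inter> verts G) (verts G - Y \<inter> verts G)"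
          by (rule cut_connD)
        then have "a \<noteq> e" using eY by (auto simp: joins_def)
        then have "joins (tail G') (head G') a Y (verts G' - Y)" "a \<in> arcs G'"
          using a n by (auto simp: joins_def G'_def)
        then show False using that(2) by blast
      qed
      show "\<exists>a\<in>arcs G'. joins (tail G') (head G') a Y (verts G' - Y)"
      proof (rule ccontr)
        assume nj: "\<not> (\<exists>a\<in>arcs G'. joins (tail G') (head G') a Y (verts G' - Y))"
        then have sub: "verts G \<subseteq> Y" using vY by blast
        then have "\<phi> e t \<in> verts G' - Y" using Y ends' by auto
        then have "joins (tail G') (head G') e Y (verts G' - Y)" using sub ends ends' by (auto simp: joins_def)
        then show False using nj ends' by blast
      qed
    qed
    then show ?thesis using connected_iff_cut_conn[of G'] wf by (simp add: fin_digraph.axioms(1) G'_def)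
  qed
  have part: "\<exists>a\<in>arcs G'. \<exists>u. 0 \<le> u \<and> u \<le> len' a \<and> \<phi> b s = \<phi>' a u" if "b \<in> arcs G" "0 \<le> s" "s \<le> len b" for b s
  proof (cases "b = e \<and> t < s")
    case True
    then show ?thesis using that ne by (intro bexI[of _ n] exI[of _ "s - t"]) (auto simp: \<phi>'_def len'_def G'_def)
  next
    case False
    then show ?thesis using that n ne by (intro bexI[of _ b] exI[of _ s]) (auto simp: \<phi>'_def len'_def G'_def)
  qed
  have path: "edge_path G' len' \<phi>' x y l \<longleftrightarrow> edge_path G len \<phi> x y l" for x y l
  proof
    assume "edge_path G' len' \<phi>' x y l"
    then show "edge_path G len \<phi> x y l"
    proof (induction rule: edge_path.induct)
      case (edge_path_step x a s l s')
      have "edge_path G len \<phi> x (\<phi> (a0 a) (s0 a s')) (l + \<bar>s0 a s' - s0 a s\<bar>)"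
        using edge_path_step s0[of a s] s0[of a s'] a0[of a] unfolding \<phi>'
        by (intro edge_path.edge_path_step) auto
      moreover have "s0 a s' - s0 a s = s' - s" by (simp add: s0_def)
      ultimately show ?case by (simp add: \<phi>')
    qed (rule edge_path.edge_path_refl)
  next
    have mem: "e \<in> arcs G'" "n \<in> arcs G'" using e by (auto simp: G'_def)
    have lo: "edge_path G' len' \<phi>' (\<phi> e s) (\<phi> e s') \<bar>s' - s\<bar>" if "0 \<le> s" "s \<le> t" "0 \<le> s'" "s' \<le> t" for s s'
      using edge_path_segment[OF mem(1), of s len' s' \<phi>'] that ne by (simp add: len'_def \<phi>'_def)
    have hi: "edge_path G' len' \<phi>' (\<phi> e s) (\<phi> e s') \<bar>s' - s\<bar>"
      if "t \<le> s" "s \<le> len e" "t \<le> s'" "s' \<le> len e" for s s'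
      using edge_path_segment[OF mem(2), of "s - t" len' "s' - t" \<phi>'] that by (simp add: len'_def \<phi>'_def)
    have cross: "edge_path G' len' \<phi>' (\<phi> e s) (\<phi> e s') \<bar>s' - s\<bar>"
      if "0 \<le> s" "s \<le> t" "t \<le> s'" "s' \<le> len e" for s s'
      using edge_path_trans[OF hi[of t s'] lo[of s t]] that t by simp
    have seg: "edge_path G' len' \<phi>' (\<phi> e s) (\<phi> e s') \<bar>s' - s\<bar>"
      if "0 \<le> s" "s \<le> len e" "0 \<le> s'" "s' \<le> len e" for s s'
    proof -
      consider "s \<le> t" "s' \<le> t" | "s \<le> t" "t \<le> s'" | "t \<le> s" "s' \<le> t" | "t \<le> s" "t \<le> s'" by linarith
      then show ?thesis
      proof cases
        case 3
        then show ?thesis using edge_path_sym[OF cross[of s' s]] that by (simp add: abs_minus_commute)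
      qed (use lo hi cross that in auto)
    qed
    assume "edge_path G len \<phi> x y l"
    then show "edge_path G' len' \<phi>' x y l"
    proof (induction rule: edge_path.induct)
      case (edge_path_step x a s l s')
      show ?case
      proof (cases "a = e")
        case True
        then have "edge_path G' len' \<phi>' (\<phi> a s) (\<phi> a s') \<bar>s' - s\<bar>" using seg edge_path_step.hyps by simp
        from edge_path_trans[OF this edge_path_step.IH] show ?thesis .
      next
        case False
        moreover have "a \<noteq> n" using edge_path_step.hyps n by auto
        ultimately have "edge_path G' len' \<phi>' (\<phi> a s) (\<phi> a s') \<bar>s' - s\<bar>"
          using edge_path_segment[of a G' s len' s' \<phi>'] edge_path_step.hyps by (simp add: len'_def \<phi>'_def G'_def)
        from edge_path_trans[OF this edge_path_step.IH] show ?thesis .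
      qed
    qed (rule edge_path.edge_path_refl)
  qed
  have sp: "mspace \<Gamma> = verts G' \<union> (\<Union>a\<in>arcs G'. \<phi>' a ` {0..len' a})"
  proof (intro equalityI subsetI)
    fix x assume "x \<in> mspace \<Gamma>"
    then show "x \<in> verts G' \<union> (\<Union>a\<in>arcs G'. \<phi>' a ` {0..len' a})"
    proof (cases rule: mspace_cases)
      case (2 b s)
      then obtain a u where "a \<in> arcs G'" "0 \<le> u" "u \<le> len' a" "x = \<phi>' a u" using part[of b s] by auto
      then show ?thesis by force
    qed (simp add: G'_def)
  next
    fix x assume "x \<in> verts G' \<union> (\<Union>a\<in>arcs G'. \<phi>' a ` {0..len' a})"
    then show "x \<in> mspace \<Gamma>"
    proof
      assume "x \<in> verts G'"
      then show ?thesis using vert_in_mspace \<phi>_in_mspace[OF e, of t] t by (auto simp: G'_def)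
    next
      assume "x \<in> (\<Union>a\<in>arcs G'. \<phi>' a ` {0..len' a})"
      then obtain a s where "a \<in> arcs G'" "0 \<le> s" "s \<le> len' a" "x = \<phi>' a s" by auto
      then show ?thesis using \<phi>_in_mspace[OF a0[of a] s0[of a s]] by (simp add: \<phi>')
    qed
  qed
  have edges: "0 < len' a \<and> \<phi>' a 0 = tail G' a \<and> \<phi>' a (len' a) = head G' a \<and>
      (\<forall>s\<in>{0<..<len' a}. \<phi>' a s \<notin> verts G')" if a: "a \<in> arcs G'" for a
  proof (intro conjI ballI)
    show "0 < len' a" "\<phi>' a 0 = tail G' a" "\<phi>' a (len' a) = head G' a"
      using a e t n ne len_pos[of a] \<phi>_0[of a] \<phi>_len[of a] \<phi>_len[of e]
      by (auto simp: len'_def \<phi>'_def G'_def)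
    fix s assume s: "s \<in> {0<..<len' a}"
    then have "\<phi>' a s \<notin> verts G" using \<phi>_not_vert[OF a0[OF a] s0'[OF a]] by (simp add: \<phi>')
    moreover have "\<phi>' a s \<noteq> \<phi> e t"
    proof
      assume "\<phi>' a s = \<phi> e t"
      then have "\<phi> (a0 a) (s0 a s) = \<phi> e t" by (simp add: \<phi>')
      from \<phi>_eqD[OF this a0[OF a] e] s0'[OF a, of s] s t have "a0 a = e" "s0 a s = t" by auto
      then show False using s0_ne[OF a, of s] s by auto
    qed
    ultimately show "\<phi>' a s \<notin> verts G'" by (simp add: G'_def)
  qed
  have inj: "inj_on (\<lambda>(e, t). \<phi>' e t) (SIGMA e:arcs G'. {0<..<len' e})"
  proof (rule inj_onI, clarify)
    fix a s b u assume as: "a \<in> arcs G'" "s \<in> {0<..<len' a}" and bu: "b \<in> arcs G'" "u \<in> {0<..<len' b}"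
      and "\<phi>' a s = \<phi>' b u"
    then have eq: "\<phi> (a0 a) (s0 a s) = \<phi> (a0 b) (s0 b u)" by (simp add: \<phi>')
    have "a0 a = a0 b" "s0 a s = s0 b u"
      using \<phi>_eqD[OF eq a0[OF as(1)] a0[OF bu(1)]] s0'[OF as(1), of s] s0'[OF bu(1), of u] as bu by auto
    then show "a = b \<and> s = u" using as bu ne by (auto simp: a0_def s0_def len'_def split: if_splits)
  qed
  show ?thesis unfolding is_model_def path
    using wf conn inj edges by (intro conjI ballI sp mdist_eq) blast+
qed

end

lemma ex_refinement:
  fixes G :: "('a, nat) pre_digraph"
  assumes "finite A" "A \<subseteq> mspace \<Gamma>" "is_model \<Gamma> G len \<phi>"
  shows "\<exists>(G' :: ('a, nat) pre_digraph) len' \<phi>'. is_model \<Gamma> G' len' \<phi>' \<and> verts G \<subseteq> verts G' \<and> A \<subseteq> verts G'"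
  using assms
proof (induction A rule: finite_induct)
  case empty
  then show ?case by blast
next
  case (insert x A)
  then obtain G' :: "('a, nat) pre_digraph" and len' \<phi>'
    where G': "is_model \<Gamma> G' len' \<phi>'" "verts G \<subseteq> verts G'" "A \<subseteq> verts G'" by auto
  interpret graph_model \<Gamma> G' len' \<phi>' using G'(1) by unfold_locales
  have "x \<in> mspace \<Gamma>" using insert by simp
  then show ?case
  proof (cases rule: mspace_cases)
    case 1
    then show ?thesis using G' by blast
  next
    case (2 e t)
    obtain n where "n \<notin> arcs G'" using ex_new_if_finite[OF infinite_UNIV_nat finite_arcs] by blast
    from subdivide[OF 2(1,2,3) this] show ?thesis using G' 2
      by (intro exI conjI) (assumption, auto)
  qed
qed

section \<open>Slopes read off from spheres\<close>

text \<open>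
  Spheres refer to the metric only, so that, in contrast to \<open>outgoing_slope_sum\<close>, this does not depend
  on a model.
\<close>

definition has_slope_sum :: "'a metric \<Rightarrow> ('a \<Rightarrow> real) \<Rightarrow> 'a \<Rightarrow> int \<Rightarrow> bool" where
  "has_slope_sum \<Gamma> f x a \<longleftrightarrow> (\<forall>\<^sub>F r in at_right 0.
     (\<Sum>y | y \<in> mspace \<Gamma> \<and> mdist \<Gamma> x y = r. f y - f x) = of_int a * r \<and>
     (\<forall>y. y \<in> mspace \<Gamma> \<longrightarrow> mdist \<Gamma> x y = r \<longrightarrow> (\<exists>k::int. f y - f x = of_int k * r)))"

text \<open>For every small radius the sums for \<open>f\<close> and for \<open>g\<close> run over
  the same sphere; this replaces a common model of the two functions.\<close>

lemma has_slope_sum_add: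
  assumes "has_slope_sum \<Gamma> f x a" "has_slope_sum \<Gamma> g x b"
  shows "has_slope_sum \<Gamma> (\<lambda>y. f y + g y) x (a + b)"
  using assms unfolding has_slope_sum_def
proof eventually_elim
  case (elim r)
  have "\<exists>k::int. f y + g y - (f x + g x) = of_int k * r" if y: "y \<in> mspace \<Gamma>" "mdist \<Gamma> x y = r" for y
  proof -
    obtain k k' :: int where "f y - f x = of_int k * r" "g y - g x = of_int k' * r" using elim y by blast
    then show ?thesis by (intro exI[of _ "k + k'"]) (simp add: algebra_simps)
  qed
  moreover have "(\<Sum>y | y \<in> mspace \<Gamma> \<and> mdist \<Gamma> x y = r. f y + g y - (f x + g x)) =
      (\<Sum>y | y \<in> mspace \<Gamma> \<and> mdist \<Gamma> x y = r. f y - f x) + (\<Sum>y | y \<in> mspace \<Gamma> \<and> mdist \<Gamma> x y = r. g y - g x)"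
    unfolding sum.distrib[symmetric] by (intro sum.cong) auto
  ultimately show ?case using elim by (auto simp: algebra_simps)
qed

lemma has_slope_sum_minus:
  assumes "has_slope_sum \<Gamma> f x a"
  shows "has_slope_sum \<Gamma> (\<lambda>y. - f y) x (- a)"
  using assms unfolding has_slope_sum_def
proof eventually_elim
  case (elim r)
  have "\<exists>k::int. - f y - - f x = of_int k * r" if y: "y \<in> mspace \<Gamma>" "mdist \<Gamma> x y = r" for y
  proof -
    obtain k :: int where "f y - f x = of_int k * r" using elim y by blast
    then show ?thesis by (intro exI[of _ "- k"]) (simp add: algebra_simps)
  qed
  moreover have "(\<Sum>y | y \<in> mspace \<Gamma> \<and> mdist \<Gamma> x y = r. - f y - - f x) =
      - (\<Sum>y | y \<in> mspace \<Gamma> \<and> mdist \<Gamma> x y = r. f y - f x)"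
    unfolding sum_negf[symmetric] by (intro sum.cong) auto
  ultimately show ?case using elim by auto
qed

lemma eventually_at_right_0_ex:
  assumes "\<forall>\<^sub>F r::real in at_right 0. Q r"
  obtains r where "0 < r" "Q r"
proof -
  have "\<forall>\<^sub>F r::real in at_right 0. 0 < r \<and> Q r"
    using eventually_at_right_less[of "0::real"] assms by eventually_elim auto
  then show ?thesis using eventually_happens'[OF trivial_limit_at_right_real] that by blast
qed

lemma has_slope_sum_unique:
  assumes "has_slope_sum \<Gamma> f x a" "has_slope_sum \<Gamma> f x b"
  shows "a = b"
proof -
  have "\<forall>\<^sub>F r::real in at_right 0. of_int a * r = of_int b * r"
    using assms unfolding has_slope_sum_def by eventually_elim metis
  then obtain r :: real where "0 < r" "of_int a * r = of_int b * r" by (rule eventually_at_right_0_ex)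
  then show ?thesis by simp
qed

definition right_slope :: "(real \<Rightarrow> real) \<Rightarrow> real \<Rightarrow> int \<Rightarrow> bool" where
  "right_slope h s m \<longleftrightarrow> (\<forall>\<^sub>F r in at_right 0. h (s + r) = h s + of_int m * r)"

text \<open>The outgoing slope in the direction of decreasing arguments; for a linear function it is
  minus the derivative.\<close>

definition left_slope :: "(real \<Rightarrow> real) \<Rightarrow> real \<Rightarrow> int \<Rightarrow> bool" where
  "left_slope h s m \<longleftrightarrow> (\<forall>\<^sub>F r in at_right 0. h (s - r) = h s + of_int m * r)"

context graph_model begin

lemma eventually_sphere_vertex:
  assumes v: "v \<in> verts G"
  shows "\<forall>\<^sub>F r in at_right 0. {y \<in> mspace \<Gamma>. mdist \<Gamma> v y = r} = sphere_at v r \<and>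
    (\<forall>g :: 'a \<Rightarrow> real. sum g (sphere_at v r) = (\<Sum>e | e \<in> arcs G \<and> tail G e = v. g (\<phi> e r))
    + (\<Sum>e | e \<in> arcs G \<and> head G e = v. g (\<phi> e (len e - r))))"
proof -
  obtain \<epsilon> where \<epsilon>: "0 < \<epsilon>" "\<And>e. e \<in> arcs G \<Longrightarrow> 2 * \<epsilon> \<le> len e" by (rule ex_small) blast
  show ?thesis
    unfolding eventually_at_right_field
    using \<epsilon>(1) sphere_vertex[OF \<epsilon>(2) v] sum_sphere_at[OF \<epsilon>(2)] by (intro exI[of _ \<epsilon>]) auto
qed

lemma has_slope_sum_vertex_iff:
  assumes v: "v \<in> verts G"
  shows "has_slope_sum \<Gamma> f v a \<longleftrightarrow> (\<forall>\<^sub>F r in at_right 0.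
      (\<Sum>e | e \<in> arcs G \<and> tail G e = v. f (\<phi> e r) - f v)
      + (\<Sum>e | e \<in> arcs G \<and> head G e = v. f (\<phi> e (len e - r)) - f v) = of_int a * r \<and>
      (\<forall>e\<in>arcs G. (tail G e = v \<longrightarrow> (\<exists>k::int. f (\<phi> e r) - f v = of_int k * r)) \<and>
        (head G e = v \<longrightarrow> (\<exists>k::int. f (\<phi> e (len e - r)) - f v = of_int k * r))))"
  unfolding has_slope_sum_def
proof (rule eventually_subst, use eventually_sphere_vertex[OF v] in eventually_elim)
  case (elim r)
  have set: "{y. y \<in> mspace \<Gamma> \<and> mdist \<Gamma> v y = r} = sphere_at v r" using elim by simp
  have "(\<forall>y. y \<in> mspace \<Gamma> \<longrightarrow> mdist \<Gamma> v y = r \<longrightarrow> (\<exists>k::int. f y - f v = of_int k * r)) \<longleftrightarrow>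
      (\<forall>y\<in>sphere_at v r. \<exists>k::int. f y - f v = of_int k * r)"
    unfolding set[symmetric] by blast
  also have "\<dots> \<longleftrightarrow> (\<forall>e\<in>arcs G. (tail G e = v \<longrightarrow> (\<exists>k::int. f (\<phi> e r) - f v = of_int k * r)) \<and>
        (head G e = v \<longrightarrow> (\<exists>k::int. f (\<phi> e (len e - r)) - f v = of_int k * r)))"
    unfolding sphere_at_def by auto
  finally show ?case using elim by (simp add: set)
qed

lemma has_slope_sum_vertexI:
  assumes v: "v \<in> verts G"
    and m: "\<And>e. e \<in> arcs G \<Longrightarrow> tail G e = v \<Longrightarrow> right_slope (\<lambda>s. f (\<phi> e s)) 0 (m e)"
    and m': "\<And>e. e \<in> arcs G \<Longrightarrow> head G e = v \<Longrightarrow> left_slope (\<lambda>s. f (\<phi> e s)) (len e) (m' e)"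
  shows "has_slope_sum \<Gamma> f v ((\<Sum>e | e \<in> arcs G \<and> tail G e = v. m e) + (\<Sum>e | e \<in> arcs G \<and> head G e = v. m' e))"
proof -
  have 1: "\<forall>\<^sub>F r in at_right 0. \<forall>e\<in>{e \<in> arcs G. tail G e = v}. f (\<phi> e r) - f v = of_int (m e) * r"
  proof (intro eventually_ball_finite ballI)
    fix e assume "e \<in> {e \<in> arcs G. tail G e = v}"
    then show "\<forall>\<^sub>F r in at_right 0. f (\<phi> e r) - f v = of_int (m e) * r"
      using m[of e] \<phi>_0[of e] by (auto simp: right_slope_def elim: eventually_mono)
  qed simp
  have 2: "\<forall>\<^sub>F r in at_right 0. \<forall>e\<in>{e \<in> arcs G. head G e = v}. f (\<phi> e (len e - r)) - f v = of_int (m' e) * r"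
  proof (intro eventually_ball_finite ballI)
    fix e assume "e \<in> {e \<in> arcs G. head G e = v}"
    then show "\<forall>\<^sub>F r in at_right 0. f (\<phi> e (len e - r)) - f v = of_int (m' e) * r"
      using m'[of e] \<phi>_len[of e] by (auto simp: left_slope_def elim: eventually_mono)
  qed simp
  from 1 2 show ?thesis unfolding has_slope_sum_vertex_iff[OF v]
  proof eventually_elim
    case (elim r)
    then show ?case by (auto simp: sum_distrib_right distrib_right)
  qed
qed

text \<open>Subdividing at the point makes it a vertex of valence two, to which the vertex case
  applies.\<close>

lemma has_slope_sum_interior_iff:
  assumes e: "e \<in> arcs G" and t: "0 < t" "t < len e"
  shows "has_slope_sum \<Gamma> f (\<phi> e t) a \<longleftrightarrow> (\<forall>\<^sub>F r in at_right 0.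
      (f (\<phi> e (t + r)) - f (\<phi> e t)) + (f (\<phi> e (t - r)) - f (\<phi> e t)) = of_int a * r \<and>
      (\<exists>k::int. f (\<phi> e (t + r)) - f (\<phi> e t) = of_int k * r) \<and>
      (\<exists>k::int. f (\<phi> e (t - r)) - f (\<phi> e t) = of_int k * r))"
proof -
  obtain n where n: "n \<notin> arcs G" using ex_new_if_finite[OF infinite_UNIV_nat finite_arcs] by blast
  define G' where "G' = \<lparr>verts = insert (\<phi> e t) (verts G), arcs = insert n (arcs G), tail = (tail G)(n := \<phi> e t),
    head = (head G)(e := \<phi> e t, n := head G e)\<rparr>"
  define len' where "len' = len(e := t, n := len e - t)"
  define \<phi>' where "\<phi>' = \<phi>(n := \<lambda>s. \<phi> e (t + s))"
  interpret S: graph_model \<Gamma> G' len' \<phi>'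
    using subdivide[OF e t n] by unfold_locales (simp add: G'_def len'_def \<phi>'_def)
  have ne: "n \<noteq> e" using e n by auto
  have nv: "\<phi> e t \<notin> verts G" by (rule \<phi>_not_vert[OF e t])
  have tl: "{a. a \<in> arcs G' \<and> tail G' a = \<phi> e t} = {n}"
  proof -
    have "tail G a \<noteq> \<phi> e t" if "a \<in> arcs G" for a using nv tail_in_verts[OF that] by metis
    then have "a \<in> arcs G' \<and> tail G' a = \<phi> e t \<longleftrightarrow> a = n" for a
      by (cases "a = n") (auto simp: G'_def)
    then show ?thesis by blast
  qed
  have hd: "{a. a \<in> arcs G' \<and> head G' a = \<phi> e t} = {e}"
  proof -
    have "head G a \<noteq> \<phi> e t" if "a \<in> arcs G" for a using nv head_in_verts[OF that] by metis
    then have "a \<in> arcs G' \<and> head G' a = \<phi> e t \<longleftrightarrow> a = e" for a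
      using e ne by (cases "a = n"; cases "a = e") (auto simp: G'_def)
    then show ?thesis by blast
  qed
  have ball: "(\<forall>a\<in>arcs G'. (tail G' a = \<phi> e t \<longrightarrow> A a) \<and> (head G' a = \<phi> e t \<longrightarrow> B a)) \<longleftrightarrow> A n \<and> B e" for A B
  proof -
    have "(\<forall>a\<in>arcs G'. (tail G' a = \<phi> e t \<longrightarrow> A a) \<and> (head G' a = \<phi> e t \<longrightarrow> B a)) \<longleftrightarrow>
        (\<forall>a\<in>{a. a \<in> arcs G' \<and> tail G' a = \<phi> e t}. A a) \<and> (\<forall>a\<in>{a. a \<in> arcs G' \<and> head G' a = \<phi> e t}. B a)"
      by auto
    then show ?thesis unfolding tl hd by simp
  qed
  have "\<phi> e t \<in> verts G'" by (simp add: G'_def)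
  from S.has_slope_sum_vertex_iff[OF this] show ?thesis
    unfolding tl hd ball using ne by (simp add: \<phi>'_def len'_def)
qed

lemma has_slope_sum_interiorI:
  assumes "e \<in> arcs G" "0 < t" "t < len e"
    and "right_slope (\<lambda>s. f (\<phi> e s)) t m" "left_slope (\<lambda>s. f (\<phi> e s)) t m'"
  shows "has_slope_sum \<Gamma> f (\<phi> e t) (m + m')"
  unfolding has_slope_sum_interior_iff[OF assms(1-3)]
  using assms(4,5) unfolding right_slope_def left_slope_def
  by eventually_elim (auto simp: algebra_simps)

lemma eventually_le_len: "0 < l \<Longrightarrow> \<forall>\<^sub>F r::real in at_right 0. 0 < r \<and> r < l"
  unfolding eventually_at_right_field by (intro exI[of _ l]) auto

text \<open>The link between slopes computed in a model and slopes read off from spheres. With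
  \<open>has_slope_sum_unique\<close> it shows that the divisor of \<open>f\<close> is the same in
  all models on whose edges \<open>f\<close> is linear.\<close>

lemma linear_has_slope_sum:
  assumes lin: "linear_on_edges G len \<phi> f m"
  shows "v \<in> verts G \<Longrightarrow> has_slope_sum \<Gamma> f v (outgoing_slope_sum G m v)"
    and "x \<in> mspace \<Gamma> \<Longrightarrow> x \<notin> verts G \<Longrightarrow> has_slope_sum \<Gamma> f x 0"
proof -
  have f: "f (\<phi> e t) = f (\<phi> e 0) + of_int (m e) * t" if "e \<in> arcs G" "0 \<le> t" "t \<le> len e" for e t
    using lin that unfolding linear_on_edges_def by (metis atLeastAtMost_iff)
  have right: "right_slope (\<lambda>s. f (\<phi> e s)) t (m e)" if e: "e \<in> arcs G" "0 \<le> t" "t < len e" for e t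
  proof -
    have "0 < len e - t" using e by simp
    from eventually_le_len[OF this] show ?thesis unfolding right_slope_def
    proof eventually_elim
      case (elim r)
      then show ?case using e f[of e t] f[of e "t + r"] by (simp add: algebra_simps)
    qed
  qed
  have left: "left_slope (\<lambda>s. f (\<phi> e s)) t (- m e)" if e: "e \<in> arcs G" "0 < t" "t \<le> len e" for e t
    using eventually_le_len[OF e(2)] unfolding left_slope_def
  proof eventually_elim
    case (elim r)
    then show ?case using e f[of e t] f[of e "t - r"] by (simp add: algebra_simps)
  qed
  show "has_slope_sum \<Gamma> f v (outgoing_slope_sum G m v)" if "v \<in> verts G"
    unfolding outgoing_slope_sum_def
  proof (rule has_slope_sum_vertexI[OF that])
    show "right_slope (\<lambda>s. f (\<phi> e s)) 0 (m e)" if "e \<in> arcs G" for e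
      using right[OF that, of 0] len_pos[OF that] by simp
    show "left_slope (\<lambda>s. f (\<phi> e s)) (len e) (- m e)" if "e \<in> arcs G" for e
      using left[OF that, of "len e"] len_pos[OF that] by simp
  qed
  show "has_slope_sum \<Gamma> f x 0" if "x \<in> mspace \<Gamma>" "x \<notin> verts G"
    using that(1)
  proof (cases rule: mspace_cases)
    case (2 e t)
    then show ?thesis using has_slope_sum_interiorI[of e t f "m e" "- m e"] right[of e t] left[of e t] by simp
  qed (use that in simp)
qed

section \<open>Continuity on edges and on the whole graph\<close>

lemma continuous_on_edge:
  assumes "continuous_map (mtopology_of \<Gamma>) euclideanreal f" "e \<in> arcs G"
  shows "continuous_on {0..len e} (\<lambda>t. f (\<phi> e t))"
proof -
  have "Lipschitz_continuous_map (submetric euclidean_metric {0..len e}) \<Gamma> (\<phi> e)"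
    unfolding Lipschitz_continuous_map_def
    using assms(2) by (auto simp: \<phi>_in_mspace dist_real_def abs_minus_commute intro!: exI[of _ 1] mdist_\<phi>_le[THEN order_trans])
  from Lipschitz_continuous_imp_continuous_map[OF this]
  have "continuous_map (top_of_set {0..len e}) (mtopology_of \<Gamma>) (\<phi> e)"
    by (simp add: mtopology_of_submetric)
  from continuous_map_compose[OF this assms(1)] show ?thesis by (simp add: o_def)
qed

text \<open>The bounds on the edges add up along a path, and the distance is the infimum of path
  lengths.\<close>

lemma Lipschitz_imp_continuous_map:
  assumes B: "0 < B" and f: "\<And>e s t. e \<in> arcs G \<Longrightarrow> 0 \<le> s \<Longrightarrow> s \<le> len e \<Longrightarrow> 0 \<le> t \<Longrightarrow> t \<le> len e \<Longrightarrow>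
      \<bar>f (\<phi> e t) - f (\<phi> e s)\<bar> \<le> B * \<bar>t - s\<bar>"
  shows "continuous_map (mtopology_of \<Gamma>) euclideanreal f"
proof -
  have path: "\<bar>f y - f x\<bar> \<le> B * l" if "edge_path G len \<phi> x y l" for x y l
    using that
  proof (induction rule: edge_path.induct)
    case (edge_path_step x e s l t)
    have "\<bar>f (\<phi> e t) - f (\<phi> e s)\<bar> \<le> B * \<bar>t - s\<bar>" using edge_path_step by (intro f) auto
    then show ?case using edge_path_step.IH by (simp add: distrib_left)
  qed simp
  have "\<bar>f x - f y\<bar> / B \<le> mdist \<Gamma> x y" if "x \<in> mspace \<Gamma>" "y \<in> mspace \<Gamma>" for x y
    using that
  proof (rule le_mdist)
    fix l assume "edge_path G len \<phi> x y l"
    from path[OF this] show "\<bar>f x - f y\<bar> / B \<le> l" using B by (simp add: field_simps abs_minus_commute)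
  qed
  then have "\<bar>f x - f y\<bar> \<le> B * mdist \<Gamma> x y" if "x \<in> mspace \<Gamma>" "y \<in> mspace \<Gamma>" for x y
    using that B by (simp add: field_simps)
  then have "Lipschitz_continuous_map \<Gamma> euclidean_metric f"
    unfolding Lipschitz_continuous_map_def by (auto simp: dist_real_def)
  from Lipschitz_continuous_imp_continuous_map[OF this] show ?thesis by simp
qed

end

text \<open>The midpoint equality fails at the last point where a positive maximum is attained.\<close>

lemma le_0_if_local_midpoint:
  fixes h :: "real \<Rightarrow> real"
  assumes cont: "continuous_on {a..b} h" and ends: "h a = 0" "h b = 0"
    and mid: "\<And>t. a < t \<Longrightarrow> t < b \<Longrightarrow> \<forall>\<^sub>F r in at_right 0. h (t + r) + h (t - r) = 2 * h t"
    and t: "t \<in> {a..b}"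
  shows "h t \<le> 0"
proof (rule ccontr)
  assume pos: "\<not> h t \<le> 0"
  obtain s where s: "s \<in> {a..b}" "\<And>u. u \<in> {a..b} \<Longrightarrow> h u \<le> h s"
    using continuous_attains_sup[OF compact_Icc _ cont] t by fastforce
  define M where "M = {u \<in> {a..b}. h u = h s}"
  have "closed M" unfolding M_def using continuous_closed_preimage_constant[OF cont] by (simp add: conj_commute)
  moreover have "bounded M" unfolding M_def by (rule bounded_subset[OF bounded_closed_interval]) auto
  ultimately have "compact M" by (simp add: compact_eq_bounded_closed)
  then obtain u where u: "u \<in> M" "\<And>w. w \<in> M \<Longrightarrow> w \<le> u"
    using compact_attains_sup[of M] s by (auto simp: M_def)
  have hu: "h u = h s" "0 < h u" using u s(2)[OF t] pos by (auto simp: M_def)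
  then have ab: "a < u" "u < b" using u(1) ends by (auto simp: M_def less_le)
  have "\<forall>\<^sub>F r in at_right 0. 0 < r \<and> r < min (u - a) (b - u)"
    using ab unfolding eventually_at_right_field by (intro exI[of _ "min (u - a) (b - u)"]) auto
  with mid[OF ab] have "\<forall>\<^sub>F r in at_right 0. 0 < r \<and> r < min (u - a) (b - u) \<and> h (u + r) + h (u - r) = 2 * h u"
    by eventually_elim auto
  then obtain r where r: "0 < r" "r < min (u - a) (b - u)" "h (u + r) + h (u - r) = 2 * h u"
    by (rule eventually_at_right_0_ex) auto
  have "h (u - r) \<le> h u" using s(2)[of "u - r"] r ab hu by auto
  moreover have "h (u + r) \<le> h u" "h (u + r) \<noteq> h u"
    using s(2)[of "u + r"] u(2)[of "u + r"] r ab hu by (auto simp: M_def)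
  ultimately show False using r by linarith
qed

text \<open>The chord is subtracted, and the preceding lemma is applied to the difference and to its
  negative.\<close>

lemma affine_if_local_midpoint:
  fixes h :: "real \<Rightarrow> real"
  assumes cont: "continuous_on {0..l} h" and l: "0 < l"
    and mid: "\<And>t. 0 < t \<Longrightarrow> t < l \<Longrightarrow> \<forall>\<^sub>F r in at_right 0. h (t + r) + h (t - r) = 2 * h t"
    and t: "0 \<le> t" "t \<le> l"
  shows "h t = h 0 + (h l - h 0) / l * t"
proof -
  define q where "q = (h l - h 0) / l"
  define g where "g t = h t - (h 0 + q * t)" for t
  have g: "continuous_on {0..l} g" unfolding g_def by (intro continuous_intros cont)
  have g0: "g 0 = 0" "g l = 0" using l by (simp_all add: g_def q_def)
  have m: "\<forall>\<^sub>F r in at_right 0. g (t + r) + g (t - r) = 2 * g t" if "0 < t" "t < l" for t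
    using mid[OF that] by eventually_elim (simp add: g_def algebra_simps)
  have "g t \<le> 0" using le_0_if_local_midpoint[OF g g0 m] t by simp
  moreover have "- g t \<le> 0"
  proof (rule le_0_if_local_midpoint[of 0 l "\<lambda>t. - g t"])
    show "continuous_on {0..l} (\<lambda>t. - g t)" by (intro continuous_intros g)
    show "\<forall>\<^sub>F r in at_right 0. - g (t + r) + - g (t - r) = 2 * - g t" if "0 < t" "t < l" for t
      using m[OF that] by eventually_elim simp
  qed (use g0 t in auto)
  ultimately show ?thesis by (simp add: g_def q_def)
qed

text \<open>Slope sum zero at the interior points is the midpoint equality, so \<open>f\<close> is
  affine on each edge. That the slope is an integer is read off from a single small sphere around
  the middle of the edge.\<close>

lemma (in graph_model) ex_linear_on_edges:
  assumes cont: "continuous_map (mtopology_of \<Gamma>) euclideanreal f"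
    and sl: "\<And>x. x \<in> mspace \<Gamma> \<Longrightarrow> x \<notin> verts G \<Longrightarrow> has_slope_sum \<Gamma> f x 0"
  shows "\<exists>m. linear_on_edges G len \<phi> f m"
proof -
  have "\<exists>k::int. \<forall>t\<in>{0..len e}. f (\<phi> e t) = f (\<phi> e 0) + of_int k * t" if e: "e \<in> arcs G" for e
  proof -
    let ?h = "\<lambda>t. f (\<phi> e t)"
    have ev: "\<forall>\<^sub>F r in at_right 0. ?h (t + r) + ?h (t - r) = 2 * ?h t \<and> (\<exists>k::int. ?h (t + r) - ?h t = of_int k * r)"
      if t: "0 < t" "t < len e" for t
    proof -
      have "has_slope_sum \<Gamma> f (\<phi> e t) 0"
        using t e \<phi>_not_vert by (intro sl \<phi>_in_mspace) auto
      then show ?thesis unfolding has_slope_sum_interior_iff[OF e t]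
        by eventually_elim auto
    qed
    define q where "q = (?h (len e) - ?h 0) / len e"
    have mid: "\<forall>\<^sub>F r in at_right 0. ?h (t + r) + ?h (t - r) = 2 * ?h t" if "0 < t" "t < len e" for t
      using ev[OF that] by eventually_elim simp
    have aff: "?h t = ?h 0 + q * t" if "0 \<le> t" "t \<le> len e" for t
      unfolding q_def by (rule affine_if_local_midpoint[OF continuous_on_edge[OF cont e] len_pos[OF e] mid that])
    define t where "t = len e / 2"
    have t: "0 < t" "t < len e" using len_pos[OF e] by (auto simp: t_def)
    have "\<forall>\<^sub>F r in at_right 0. r < t \<and> (\<exists>k::int. ?h (t + r) - ?h t = of_int k * r)"
      using ev[OF t] eventually_le_len[OF t(1)] by eventually_elim auto
    then obtain r k where r: "0 < r" "r < t" "?h (t + r) - ?h t = of_int k * r"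
      by (rule eventually_at_right_0_ex) auto
    have "?h t = ?h 0 + q * t" by (rule aff) (use t in auto)
    moreover have "?h (t + r) = ?h 0 + q * (t + r)" by (rule aff) (use t r in \<open>auto simp: t_def\<close>)
    ultimately have "?h (t + r) - ?h t = q * r" by (simp only: distrib_left)
    then have "of_int k * r = q * r" using r(3) by linarith
    then have "q = of_int k" using r(1) by simp
    then have "\<forall>t\<in>{0..len e}. f (\<phi> e t) = f (\<phi> e 0) + of_int k * t" using aff by (metis atLeastAtMost_iff)
    then show ?thesis by (rule exI)
  qed
  then have "\<forall>e\<in>arcs G. \<exists>k::int. \<forall>t\<in>{0..len e}. f (\<phi> e t) = f (\<phi> e 0) + of_int k * t" by (rule ballI)
  from this[unfolded bchoice_iff] show ?thesis unfolding linear_on_edges_def .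
qed

section \<open>Principal divisors\<close>

lemma deg_eq_sum:
  assumes "finite S" "Poly_Mapping.keys D \<subseteq> S"
  shows "deg D = (\<Sum>x\<in>S. Poly_Mapping.lookup D x)"
  unfolding deg_def using assms by (intro sum.mono_neutral_left) (auto simp: in_keys_iff)

lemma deg_diff: "deg (D - D') = deg D - deg D'"
proof -
  let ?S = "Poly_Mapping.keys D \<union> Poly_Mapping.keys D'"
  have "Poly_Mapping.keys (D - D') \<subseteq> ?S" by (auto simp: in_keys_iff lookup_minus)
  then show ?thesis by (simp add: deg_eq_sum[of ?S] lookup_minus sum_subtractf)
qed

lemma deg_0 [simp]: "deg 0 = 0"
  by (simp add: deg_def)

lemma deg_add: "deg (D + D') = deg D + deg D'"
  using deg_diff[of D "0 - D'"] deg_diff[of 0 D'] by simp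

lemma deg_frag_of [simp]: "deg (frag_of x) = 1"
  by (simp add: deg_def)

lemma deg_sum: "deg (\<Sum>i\<in>A. f i) = (\<Sum>i\<in>A. deg (f i))"
  by (induction A rule: infinite_finite_induct) (simp_all add: deg_add)

definition vertex_divisor :: "('a, 'e) pre_digraph \<Rightarrow> ('e \<Rightarrow> int) \<Rightarrow> 'a \<Rightarrow>\<^sub>0 int" where
  "vertex_divisor G m = - (\<Sum>v\<in>verts G. frag_cmul (outgoing_slope_sum G m v) (frag_of v))"

context graph_model begin

lemma lookup_vertex_divisor:
  "Poly_Mapping.lookup (vertex_divisor G m) x = (if x \<in> verts G then - outgoing_slope_sum G m x else 0)"
  by (simp add: vertex_divisor_def lookup_sum if_distrib[of "\<lambda>k. _ * k"] sum.delta cong: if_cong)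

lemma deg_vertex_divisor: "deg (vertex_divisor G m) = 0"
proof -
  have "deg (vertex_divisor G m) = (\<Sum>v\<in>verts G. - outgoing_slope_sum G m v)"
    by (subst deg_eq_sum[of "verts G"]) (auto simp: in_keys_iff lookup_vertex_divisor split: if_splits)
  also have "\<dots> = - ((\<Sum>v\<in>verts G. \<Sum>e | e \<in> arcs G \<and> tail G e = v. m e)
      + (\<Sum>v\<in>verts G. \<Sum>e | e \<in> arcs G \<and> head G e = v. - m e))"
    by (simp add: outgoing_slope_sum_def sum_subtractf sum_negf)
  also have "\<dots> = - (sum m (arcs G) + (\<Sum>e\<in>arcs G. - m e))"
    by (subst (1 2) sum.group) auto
  also have "\<dots> = 0" by (simp add: sum_negf)
  finally show ?thesis .
qed

end

text \<open>The choice in \<open>Laplacian\<close> yields some model, and the three properties hold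
  whichever it is.\<close>

lemma Laplacian_properties:
  assumes f: "f \<in> PL_Z \<Gamma>"
  shows "Poly_Mapping.keys (Laplacian \<Gamma> f) \<subseteq> mspace \<Gamma>" and "deg (Laplacian \<Gamma> f) = 0"
    and "x \<in> mspace \<Gamma> \<Longrightarrow> has_slope_sum \<Gamma> f x (- Poly_Mapping.lookup (Laplacian \<Gamma> f) x)"
proof -
  have "\<exists>D. \<exists>(G :: ('a, nat) pre_digraph) len \<phi> m. is_model \<Gamma> G len \<phi> \<and> linear_on_edges G len \<phi> f m \<and>
      D = vertex_divisor G m"
    using f unfolding PL_Z_def by blast
  from someI_ex[OF this] obtain G :: "('a, nat) pre_digraph" and len \<phi> m
    where m: "is_model \<Gamma> G len \<phi>" "linear_on_edges G len \<phi> f m" "Laplacian \<Gamma> f = vertex_divisor G m"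
    unfolding Laplacian_def vertex_divisor_def by blast
  interpret graph_model \<Gamma> G len \<phi> using m(1) by unfold_locales
  show "Poly_Mapping.keys (Laplacian \<Gamma> f) \<subseteq> mspace \<Gamma>"
    using vert_in_mspace by (auto simp: m(3) in_keys_iff lookup_vertex_divisor split: if_splits)
  show "deg (Laplacian \<Gamma> f) = 0" by (simp add: m(3) deg_vertex_divisor)
  show "has_slope_sum \<Gamma> f x (- Poly_Mapping.lookup (Laplacian \<Gamma> f) x)" if "x \<in> mspace \<Gamma>"
    using linear_has_slope_sum[OF m(2)] that by (simp add: m(3) lookup_vertex_divisor)
qed

text \<open>A description of \<open>Prin \<Gamma>\<close> without models. For its converse direction
  a model is refined until the support of \<open>D\<close> consists of vertices; then
  \<open>f\<close> has slope sum zero inside the edges, hence is linear on them.\<close>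

lemma Prin_iff:
  assumes \<Gamma>: "metric_graph \<Gamma>"
  shows "D \<in> Prin \<Gamma> \<longleftrightarrow> Poly_Mapping.keys D \<subseteq> mspace \<Gamma> \<and>
    (\<exists>f. continuous_map (mtopology_of \<Gamma>) euclideanreal f \<and>
      (\<forall>x\<in>mspace \<Gamma>. has_slope_sum \<Gamma> f x (- Poly_Mapping.lookup D x)))" (is "_ \<longleftrightarrow> ?R")
proof
  assume "D \<in> Prin \<Gamma>"
  then obtain f where "f \<in> PL_Z \<Gamma>" "D = Laplacian \<Gamma> f" by (auto simp: Prin_def)
  then show ?R using Laplacian_properties[of f \<Gamma>] by (auto simp: PL_Z_def)
next
  assume ?R
  then obtain f where D: "Poly_Mapping.keys D \<subseteq> mspace \<Gamma>"
    and f: "continuous_map (mtopology_of \<Gamma>) euclideanreal f"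
    and sl: "\<And>x. x \<in> mspace \<Gamma> \<Longrightarrow> has_slope_sum \<Gamma> f x (- Poly_Mapping.lookup D x)" by blast
  obtain G0 :: "('a, nat) pre_digraph" and len0 \<phi>0 where "is_model \<Gamma> G0 len0 \<phi>0"
    using \<Gamma> by (auto simp: metric_graph_def)
  from ex_refinement[OF finite_keys D this] obtain G :: "('a, nat) pre_digraph" and len \<phi>
    where G: "is_model \<Gamma> G len \<phi>" "Poly_Mapping.keys D \<subseteq> verts G" by blast
  interpret graph_model \<Gamma> G len \<phi> using G(1) by unfold_locales
  have "has_slope_sum \<Gamma> f x 0" if "x \<in> mspace \<Gamma>" "x \<notin> verts G" for x
  proof -
    have "Poly_Mapping.lookup D x = 0" using that G(2) by (auto simp: in_keys_iff)
    then show ?thesis using sl[OF that(1)] by simp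
  qed
  from ex_linear_on_edges[OF f this] obtain m where "linear_on_edges G len \<phi> f m" by blast
  then have PL: "f \<in> PL_Z \<Gamma>" using f G(1) unfolding PL_Z_def by blast
  have "Laplacian \<Gamma> f = D"
  proof (rule poly_mapping_eqI)
    fix x
    show "Poly_Mapping.lookup (Laplacian \<Gamma> f) x = Poly_Mapping.lookup D x"
    proof (cases "x \<in> mspace \<Gamma>")
      case True
      from has_slope_sum_unique[OF Laplacian_properties(3)[OF PL True] sl[OF True]] show ?thesis by simp
    next
      case False
      then have "x \<notin> Poly_Mapping.keys (Laplacian \<Gamma> f)" "x \<notin> Poly_Mapping.keys D"
        using D Laplacian_properties(1)[OF PL] by auto
      then show ?thesis by (simp add: in_keys_iff)
    qed
  qed
  with PL show "D \<in> Prin \<Gamma>" by (auto simp: Prin_def)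
qed

lemma Prin_subset: "D \<in> Prin \<Gamma> \<Longrightarrow> Poly_Mapping.keys D \<subseteq> mspace \<Gamma> \<and> deg D = 0"
  using Laplacian_properties by (auto simp: Prin_def)

lemma frag_subgroup_Prin:
  assumes \<Gamma>: "metric_graph \<Gamma>"
  shows "frag_subgroup (Prin \<Gamma>)"
proof
  have "has_slope_sum \<Gamma> (\<lambda>_. 0) x 0" for x
    by (simp add: has_slope_sum_def)
  then show "0 \<in> Prin \<Gamma>" unfolding Prin_iff[OF \<Gamma>] by (auto intro!: exI[of _ "\<lambda>_. 0"])
  fix D D' assume "D \<in> Prin \<Gamma>" "D' \<in> Prin \<Gamma>"
  then obtain f f' where D: "Poly_Mapping.keys D \<subseteq> mspace \<Gamma>" "Poly_Mapping.keys D' \<subseteq> mspace \<Gamma>"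
    and f: "continuous_map (mtopology_of \<Gamma>) euclideanreal f" "continuous_map (mtopology_of \<Gamma>) euclideanreal f'"
    and sl: "\<And>x. x \<in> mspace \<Gamma> \<Longrightarrow> has_slope_sum \<Gamma> f x (- Poly_Mapping.lookup D x)"
      "\<And>x. x \<in> mspace \<Gamma> \<Longrightarrow> has_slope_sum \<Gamma> f' x (- Poly_Mapping.lookup D' x)"
    unfolding Prin_iff[OF \<Gamma>] by blast
  have "has_slope_sum \<Gamma> (\<lambda>y. f y + - f' y) x (- Poly_Mapping.lookup (D - D') x)" if "x \<in> mspace \<Gamma>" for x
    using has_slope_sum_add[OF sl(1)[OF that] has_slope_sum_minus[OF sl(2)[OF that]]]
    by (simp add: lookup_minus)
  moreover have "continuous_map (mtopology_of \<Gamma>) euclideanreal (\<lambda>y. f y + - f' y)"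
    by (intro continuous_map_add continuous_map_minus f)
  moreover have "Poly_Mapping.keys (D - D') \<subseteq> mspace \<Gamma>"
    using keys_diff[of D D'] D by blast
  ultimately show "D - D' \<in> Prin \<Gamma>" unfolding Prin_iff[OF \<Gamma>] by blast
qed

section \<open>Tent functions\<close>

lemma right_slope_const [simp]: "right_slope (\<lambda>_. a) s 0"
  and left_slope_const [simp]: "left_slope (\<lambda>_. a) s 0"
  by (simp_all add: right_slope_def left_slope_def)

lemma right_slope_add:
  assumes "right_slope f s m" "right_slope g s n"
  shows "right_slope (\<lambda>t. f t + g t) s (m + n)"
  using assms unfolding right_slope_def by eventually_elim (simp add: algebra_simps)

lemma left_slope_add:
  assumes "left_slope f s m" "left_slope g s n"
  shows "left_slope (\<lambda>t. f t + g t) s (m + n)"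
  using assms unfolding left_slope_def by eventually_elim (simp add: algebra_simps)

lemma right_slope_cong:
  assumes "right_slope g s m" "0 < \<epsilon>" "\<And>t. s \<le> t \<Longrightarrow> t < s + \<epsilon> \<Longrightarrow> f t = g t"
  shows "right_slope f s m"
  using assms(1) eventually_at_right_less[of "0::real"] eventually_at_right_real[OF assms(2)] unfolding right_slope_def
  by eventually_elim (use assms(2,3) in auto)

lemma left_slope_cong:
  assumes "left_slope g s m" "0 < \<epsilon>" "\<And>t. t \<le> s \<Longrightarrow> s - \<epsilon> < t \<Longrightarrow> f t = g t"
  shows "left_slope f s m"
  using assms(1) eventually_at_right_less[of "0::real"] eventually_at_right_real[OF assms(2)] unfolding left_slope_def
  by eventually_elim (use assms(2,3) in auto)

lemma right_slope_linear: "right_slope (\<lambda>t. a + of_int m * t) s m"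
  and left_slope_linear: "left_slope (\<lambda>t. a + of_int m * t) s (- m)"
  by (simp_all add: right_slope_def left_slope_def algebra_simps)

lemma right_slope_max: "right_slope (\<lambda>t. max 0 (t - b)) s (if s < b then 0 else 1)"
proof (cases "s < b")
  case True
  have "right_slope (\<lambda>t. max 0 (t - b)) s 0"
    by (rule right_slope_cong[of "\<lambda>t. 0" _ _ "b - s"]) (use True right_slope_linear[of 0 0 s] in auto)
  then show ?thesis using True by simp
next
  case False
  have "right_slope (\<lambda>t. max 0 (t - b)) s 1"
    by (rule right_slope_cong[of "\<lambda>t. - b + t" _ _ "1"]) (use False right_slope_linear[of "- b" 1 s] in auto)
  then show ?thesis using False by simp
qed

lemma left_slope_max: "left_slope (\<lambda>t. max 0 (t - b)) s (if s \<le> b then 0 else - 1)"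
proof (cases "s \<le> b")
  case True
  have "left_slope (\<lambda>t. max 0 (t - b)) s 0"
    by (rule left_slope_cong[of "\<lambda>t. 0" _ _ "1"]) (use True left_slope_linear[of 0 0 s] in auto)
  then show ?thesis using True by simp
next
  case False
  have "left_slope (\<lambda>t. max 0 (t - b)) s (- 1)"
    by (rule left_slope_cong[of "\<lambda>t. - b + t" _ _ "s - b"]) (use False left_slope_linear[of "- b" 1 s] in auto)
  then show ?thesis using False by simp
qed

lemma right_slope_max': "right_slope (\<lambda>t. max 0 (b - t)) s (if s < b then - 1 else 0)"
proof (cases "s < b")
  case True
  have "right_slope (\<lambda>t. max 0 (b - t)) s (- 1)"
    by (rule right_slope_cong[of "\<lambda>t. b + - t" _ _ "b - s"]) (use True right_slope_linear[of b "- 1" s] in auto)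
  then show ?thesis using True by simp
next
  case False
  have "right_slope (\<lambda>t. max 0 (b - t)) s 0"
    by (rule right_slope_cong[of "\<lambda>t. 0" _ _ "1"]) (use False right_slope_linear[of 0 0 s] in auto)
  then show ?thesis using False by simp
qed

lemma left_slope_max': "left_slope (\<lambda>t. max 0 (b - t)) s (if s \<le> b then 1 else 0)"
proof (cases "s \<le> b")
  case True
  have "left_slope (\<lambda>t. max 0 (b - t)) s 1"
    by (rule left_slope_cong[of "\<lambda>t. b + - t" _ _ "1"]) (use True left_slope_linear[of b "- 1" s] in auto)
  then show ?thesis using True by simp
next
  case False
  have "left_slope (\<lambda>t. max 0 (b - t)) s 0"
    by (rule left_slope_cong[of "\<lambda>t. 0" _ _ "s - b"]) (use False left_slope_linear[of 0 0 s] in auto)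
  then show ?thesis using False by simp
qed

context graph_model begin

lemma metric_graph: "metric_graph \<Gamma>"
  using is_model unfolding metric_graph_def by blast

sublocale frag_subgroup "Prin \<Gamma>"
  by (rule frag_subgroup_Prin[OF metric_graph])

abbreviation lin_equiv :: "('a \<Rightarrow>\<^sub>0 int) \<Rightarrow> ('a \<Rightarrow>\<^sub>0 int) \<Rightarrow> bool" (infix \<open>\<doteq>\<close> 50) where
  "lin_equiv \<equiv> eqv"

section \<open>Principal divisors from functions given on the edges\<close>

lemma ex_glued_function:
  assumes "\<And>e. e \<in> arcs G \<Longrightarrow> h e 0 = a (tail G e) \<and> h e (len e) = (a (head G e) :: real)"
  obtains f where "\<And>v. v \<in> verts G \<Longrightarrow> f v = a v"
    "\<And>e t. e \<in> arcs G \<Longrightarrow> 0 \<le> t \<Longrightarrow> t \<le> len e \<Longrightarrow> f (\<phi> e t) = h e t"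
proof -
  define S where "S = (SIGMA e:arcs G. {0<..<len e})"
  define f where "f y = (if y \<in> verts G then a y
    else case inv_into S (\<lambda>(e, t). \<phi> e t) y of (e, t) \<Rightarrow> h e t)" for y
  have inj: "inj_on (\<lambda>(e, t). \<phi> e t) S" using is_model by (simp add: is_model_def S_def)
  have "f (\<phi> e t) = h e t" if e: "e \<in> arcs G" "0 \<le> t" "t \<le> len e" for e t
  proof (cases "t = 0 \<or> t = len e")
    case True
    then show ?thesis using e assms[OF e(1)] \<phi>_0[OF e(1)] \<phi>_len[OF e(1)] by (auto simp: f_def)
  next
    case False
    then have t: "0 < t" "t < len e" using e by auto
    then have "(e, t) \<in> S" using e by (simp add: S_def)
    from inv_into_f_f[OF inj this] show ?thesis using \<phi>_not_vert[OF e(1) t] by (simp add: f_def)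
  qed
  moreover have "f v = a v" if "v \<in> verts G" for v using that by (simp add: f_def)
  ultimately show ?thesis using that by blast
qed

lemma \<phi>_eq_iff:
  assumes "e \<in> arcs G" "0 < s" "s < len e" "e' \<in> arcs G" "0 \<le> t" "t \<le> len e'"
  shows "\<phi> e s = \<phi> e' t \<longleftrightarrow> e = e' \<and> s = t"
  using \<phi>_eqD[of e s e' t] assms by blast

text \<open>The functions \<open>h e\<close> are glued along the vertices; \<open>m\<close> and
  \<open>m'\<close> are their outgoing slopes to the right and to the left. The Lipschitz constant
  \<open>2\<close> leaves room for adding two pieces of a tent, one from each end of a loop.\<close>

lemma Prin_edgeI:
  assumes keys: "Poly_Mapping.keys D \<subseteq> mspace \<Gamma>"
    and h: "\<And>e. e \<in> arcs G \<Longrightarrow> h e 0 = a (tail G e) \<and> h e (len e) = (a (head G e) :: real)"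
    and lip: "\<And>e s t. e \<in> arcs G \<Longrightarrow> 0 \<le> s \<Longrightarrow> s \<le> len e \<Longrightarrow> 0 \<le> t \<Longrightarrow> t \<le> len e \<Longrightarrow>
      \<bar>h e t - h e s\<bar> \<le> 2 * \<bar>t - s\<bar>"
    and right: "\<And>e s. e \<in> arcs G \<Longrightarrow> 0 \<le> s \<Longrightarrow> s < len e \<Longrightarrow> right_slope (h e) s (m e s)"
    and left: "\<And>e s. e \<in> arcs G \<Longrightarrow> 0 < s \<Longrightarrow> s \<le> len e \<Longrightarrow> left_slope (h e) s (m' e s)"
    and vert: "\<And>v. v \<in> verts G \<Longrightarrow> (\<Sum>e | e \<in> arcs G \<and> tail G e = v. m e 0)
      + (\<Sum>e | e \<in> arcs G \<and> head G e = v. m' e (len e)) = - Poly_Mapping.lookup D v"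
    and inter: "\<And>e s. e \<in> arcs G \<Longrightarrow> 0 < s \<Longrightarrow> s < len e \<Longrightarrow> m e s + m' e s = - Poly_Mapping.lookup D (\<phi> e s)"
  shows "D \<in> Prin \<Gamma>"
proof -
  obtain f where f: "\<And>e t. e \<in> arcs G \<Longrightarrow> 0 \<le> t \<Longrightarrow> t \<le> len e \<Longrightarrow> f (\<phi> e t) = h e t"
    using ex_glued_function[OF h] by metis
  have cont: "continuous_map (mtopology_of \<Gamma>) euclideanreal f"
    by (rule Lipschitz_imp_continuous_map[of 2]) (simp_all add: f lip)
  have right': "right_slope (\<lambda>t. f (\<phi> e t)) s (m e s)" if "e \<in> arcs G" "0 \<le> s" "s < len e" for e s
    using right[OF that] by (rule right_slope_cong[of _ _ _ "len e - s"]) (use that f in auto)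
  have left': "left_slope (\<lambda>t. f (\<phi> e t)) s (m' e s)" if "e \<in> arcs G" "0 < s" "s \<le> len e" for e s
    using left[OF that] by (rule left_slope_cong[of _ _ _ s]) (use that f in auto)
  have "has_slope_sum \<Gamma> f x (- Poly_Mapping.lookup D x)" if "x \<in> mspace \<Gamma>" for x
    using that
  proof (cases rule: mspace_cases)
    case 1
    have "has_slope_sum \<Gamma> f x ((\<Sum>e | e \<in> arcs G \<and> tail G e = x. m e 0)
      + (\<Sum>e | e \<in> arcs G \<and> head G e = x. m' e (len e)))"
      by (rule has_slope_sum_vertexI[OF 1]) (simp_all add: right' left' len_pos)
    then show ?thesis by (simp only: vert[OF 1])
  next
    case (2 e t)
    have "has_slope_sum \<Gamma> f (\<phi> e t) (m e t + m' e t)"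
      using 2 by (intro has_slope_sum_interiorI right' left') auto
    then show ?thesis using inter[OF 2(1-3)] 2(4) by simp
  qed
  then show ?thesis unfolding Prin_iff[OF metric_graph] using keys cont by blast
qed

lemma edge_tent:
  assumes e: "e \<in> arcs G" and r: "0 < r" "r \<le> t" "t + r \<le> len e"
  shows "frag_of (\<phi> e (t - r)) + frag_of (\<phi> e (t + r)) - (frag_of (\<phi> e t) + frag_of (\<phi> e t)) \<in> Prin \<Gamma>"
    (is "?D \<in> _")
proof -
  \<comment> \<open>The tent of height \<open>r\<close> between \<open>t - r\<close> and
    \<open>t + r\<close>, as a sum of functions with a single kink each; the kink at
    \<open>t\<close> counts twice.\<close>
  define k where "k s = max 0 (s - (t - r)) + (- (max 0 (s - t)) + (- (max 0 (s - t)) + max 0 (s - (t + r))))" for s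
  define h where "h a s = (if a = e then k s else 0)" for a s
  define m where "m a s = (if a = e then (if s < t - r then 0 else 1)
    + ((if s < t then 0 else - 1) + ((if s < t then 0 else - 1) + (if s < t + r then 0 else 1))) else (0::int))" for a s
  define m' where "m' a s = (if a = e then (if s \<le> t - r then 0 else - 1)
    + ((if s \<le> t then 0 else 1) + ((if s \<le> t then 0 else 1) + (if s \<le> t + r then 0 else - 1))) else (0::int))" for a s
  have neg_right: "right_slope (\<lambda>s. - max 0 (s - b)) s (if s < b then 0 else - 1)" for b s
    using right_slope_max[of b s] unfolding right_slope_def by eventually_elim auto
  have neg_left: "left_slope (\<lambda>s. - max 0 (s - b)) s (if s \<le> b then 0 else 1)" for b s
    using left_slope_max[of b s] unfolding left_slope_def by eventually_elim auto
  have kr: "right_slope k s (m e s)" for s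
  proof -
    have "right_slope k s ((if s < t - r then 0 else 1)
      + ((if s < t then 0 else - 1) + ((if s < t then 0 else - 1) + (if s < t + r then 0 else 1))))"
      unfolding k_def[abs_def] by (intro right_slope_add right_slope_max neg_right)
    then show ?thesis by (simp only: m_def if_True refl)
  qed
  have kl: "left_slope k s (m' e s)" for s
  proof -
    have "left_slope k s ((if s \<le> t - r then 0 else - 1)
      + ((if s \<le> t then 0 else 1) + ((if s \<le> t then 0 else 1) + (if s \<le> t + r then 0 else - 1))))"
      unfolding k_def[abs_def] by (intro left_slope_add left_slope_max neg_left)
    then show ?thesis by (simp only: m'_def if_True refl)
  qed
  \<comment> \<open>At the top of the tent both outgoing slopes are \<open>- 1\<close>, so its
    divisor has coefficient \<open>2\<close> there and is the negative of \<open>?D\<close>.\<close>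
  have "- ?D \<in> Prin \<Gamma>"
  proof (rule Prin_edgeI[where h = h and a = "\<lambda>_. 0" and m = m and m' = m'])
    show "Poly_Mapping.keys (- ?D) \<subseteq> mspace \<Gamma>"
    proof
      fix x assume "x \<in> Poly_Mapping.keys (- ?D)"
      then have "x = \<phi> e (t - r) \<or> x = \<phi> e (t + r) \<or> x = \<phi> e t"
        by (auto simp: in_keys_iff lookup_minus lookup_add split: if_splits)
      then show "x \<in> mspace \<Gamma>" using e r by (auto intro!: \<phi>_in_mspace)
    qed
    show "h a 0 = 0 \<and> h a (len a) = 0" if "a \<in> arcs G" for a
      using r by (auto simp: h_def k_def max_def)
    have "k s = max 0 (r - \<bar>s - t\<bar>)" for s using r(1) by (simp add: k_def max_def abs_if)
    moreover have "\<bar>max 0 (r - \<bar>u - t\<bar>) - max 0 (r - \<bar>s - t\<bar>)\<bar> \<le> \<bar>u - s\<bar>" for s u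
    proof -
      have "\<bar>max 0 x - max 0 y\<bar> \<le> \<bar>x - y\<bar>" for x y :: real by (simp add: max_def)
      then have "\<bar>max 0 (r - \<bar>u - t\<bar>) - max 0 (r - \<bar>s - t\<bar>)\<bar> \<le> \<bar>(r - \<bar>u - t\<bar>) - (r - \<bar>s - t\<bar>)\<bar>" .
      also have "\<dots> = \<bar>\<bar>s - t\<bar> - \<bar>u - t\<bar>\<bar>" by simp
      also have "\<dots> \<le> \<bar>(s - t) - (u - t)\<bar>" by (rule abs_triangle_ineq3)
      also have "\<dots> = \<bar>u - s\<bar>" by (simp add: abs_minus_commute)
      finally show ?thesis .
    qed
    ultimately have lip: "\<bar>h a u - h a s\<bar> \<le> \<bar>u - s\<bar>" for a s u
      by (simp add: h_def)
    show "\<bar>h a u - h a s\<bar> \<le> 2 * \<bar>u - s\<bar>" for a s u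
      by (rule order_trans[OF lip]) simp
    show "right_slope (h a) s (m a s)" for a s
      using kr by (cases "a = e") (simp_all add: h_def[abs_def] m_def)
    show "left_slope (h a) s (m' a s)" for a s
      using kl by (cases "a = e") (simp_all add: h_def[abs_def] m'_def)
    show "m a s + m' a s = - Poly_Mapping.lookup (- ?D) (\<phi> a s)" if a: "a \<in> arcs G" "0 < s" "s < len a" for a s
    proof -
      have "\<phi> a s = \<phi> e (t - r) \<longleftrightarrow> a = e \<and> s = t - r" "\<phi> a s = \<phi> e t \<longleftrightarrow> a = e \<and> s = t"
        "\<phi> a s = \<phi> e (t + r) \<longleftrightarrow> a = e \<and> s = t + r"
        using r by (intro \<phi>_eq_iff a e; simp)+
      then show ?thesis using r(1) by (simp add: lookup_minus lookup_add m_def m'_def)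
    qed
    show "(\<Sum>a | a \<in> arcs G \<and> tail G a = v. m a 0) + (\<Sum>a | a \<in> arcs G \<and> head G a = v. m' a (len a))
        = - Poly_Mapping.lookup (- ?D) v" if v: "v \<in> verts G" for v
    proof -
      have 1: "(\<Sum>a | a \<in> arcs G \<and> tail G a = v. m a 0) = (if tail G e = v then m e 0 else 0)"
        using e by (simp add: m_def sum.delta cong: if_cong)
      have 2: "(\<Sum>a | a \<in> arcs G \<and> head G a = v. m' a (len a)) = (if head G e = v then m' e (len e) else 0)"
        using e by (simp add: m'_def sum.delta' if_distrib cong: if_cong)
      have 3: "v \<noteq> \<phi> e t" using \<phi>_not_vert[OF e, of t] v r by auto
      \<comment> \<open>The feet of the tent may be vertices, namely when \<open>t = r\<close> or
        \<open>t + r = len e\<close>.\<close>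
      have 4: "v = \<phi> e (t - r) \<longleftrightarrow> t = r \<and> tail G e = v"
      proof (cases "t = r")
        case False
        then have "\<phi> e (t - r) \<notin> verts G" using r by (intro \<phi>_not_vert e) auto
        then show ?thesis using v False by metis
      qed (auto simp: \<phi>_0[OF e])
      have 5: "v = \<phi> e (t + r) \<longleftrightarrow> t + r = len e \<and> head G e = v"
      proof (cases "t + r = len e")
        case False
        then have "\<phi> e (t + r) \<notin> verts G" using r by (intro \<phi>_not_vert e) auto
        then show ?thesis using v False by metis
      qed (auto simp: \<phi>_len[OF e])
      have "m e 0 = (if t = r then 1 else 0)" "m' e (len e) = (if t + r = len e then 1 else 0)"
        using r by (auto simp: m_def m'_def)
      moreover have "- Poly_Mapping.lookup (- ?D) v =
          (if t = r \<and> tail G e = v then 1 else 0) + (if t + r = len e \<and> head G e = v then 1 else 0)"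
        by (simp only: lookup_uminus lookup_minus lookup_add lookup_frag_of 3 4 5 if_False)
      ultimately show ?thesis by (simp add: 1 2)
    qed
  qed
  from uminus_mem[OF this] show ?thesis by simp
qed

end

context graph_model begin

text \<open>The divisor of the tent of height \<open>r\<close> over the ball around
  \<open>v\<close>, with slope \<open>- 1\<close> along every half-edge; a loop at \<open>v\<close>
  carries two of its slopes.\<close>

lemma vertex_tent:
  assumes v: "v \<in> verts G" and r: "0 < r" "\<And>e. e \<in> arcs G \<Longrightarrow> 2 * r < len e"
  shows "(\<Sum>e | e \<in> arcs G \<and> tail G e = v. frag_of v - frag_of (\<phi> e r))
    + (\<Sum>e | e \<in> arcs G \<and> head G e = v. frag_of v - frag_of (\<phi> e (len e - r))) \<in> Prin \<Gamma>" (is "?D \<in> _")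
proof -
  define h where "h e s = (if tail G e = v then max 0 (r - s) else 0)
    + (if head G e = v then max 0 (s - (len e - r)) else 0)" for e s
  define m where "m e s = (if tail G e = v then if s < r then - 1 else 0 else 0)
    + (if head G e = v then if s < len e - r then 0 else 1 else (0::int))" for e s
  define m' where "m' e s = (if tail G e = v then if s \<le> r then 1 else 0 else 0)
    + (if head G e = v then if s \<le> len e - r then 0 else - 1 else (0::int))" for e s
  have lookup_D: "Poly_Mapping.lookup ?D x =
      (\<Sum>e | e \<in> arcs G \<and> tail G e = v. (if x = v then 1 else 0) - (if x = \<phi> e r then 1 else 0))
      + (\<Sum>e | e \<in> arcs G \<and> head G e = v. (if x = v then 1 else 0) - (if x = \<phi> e (len e - r) then 1 else 0))" for x
    by (simp add: lookup_add lookup_sum lookup_minus)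
  have in_edge: "0 < r" "r < len e" "0 < len e - r" "len e - r < len e" if "e \<in> arcs G" for e
    using r(1) r(2)[OF that] by auto
  show ?thesis
  proof (rule Prin_edgeI[where h = h and a = "\<lambda>u. if u = v then r else 0" and m = m and m' = m'])
    show "Poly_Mapping.keys ?D \<subseteq> mspace \<Gamma>"
    proof
      fix x assume "x \<in> Poly_Mapping.keys ?D"
      then have "Poly_Mapping.lookup ?D x \<noteq> 0" by (simp add: in_keys_iff)
      moreover have "Poly_Mapping.lookup ?D x = 0" if "x \<notin> mspace \<Gamma>"
      proof -
        have xv: "x \<noteq> v" using that vert_in_mspace[OF v] by blast
        have xe: "x \<noteq> \<phi> e r" "x \<noteq> \<phi> e (len e - r)" if "e \<in> arcs G" for e
          using \<phi>_in_mspace[OF that, of r] \<phi>_in_mspace[OF that, of "len e - r"] in_edge[OF that] \<open>x \<notin> mspace \<Gamma>\<close>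
          by auto
        have "(\<Sum>e | e \<in> arcs G \<and> tail G e = v. (if x = v then 1 else 0) - (if x = \<phi> e r then 1 else 0)) = (0::int)"
          by (rule sum.neutral) (simp add: xv xe)
        moreover have "(\<Sum>e | e \<in> arcs G \<and> head G e = v. (if x = v then 1 else 0) - (if x = \<phi> e (len e - r) then 1 else 0)) = (0::int)"
          by (rule sum.neutral) (simp add: xv xe)
        ultimately show ?thesis unfolding lookup_D by simp
      qed
      ultimately show "x \<in> mspace \<Gamma>" by blast
    qed
    show "h e 0 = (if tail G e = v then r else 0) \<and> h e (len e) = (if head G e = v then r else 0)"
      if "e \<in> arcs G" for e
      using in_edge[OF that] by (simp add: h_def)
    show "\<bar>h e t - h e s\<bar> \<le> 2 * \<bar>t - s\<bar>" for e s t
    proof -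
      have max: "\<bar>max 0 x - max 0 y\<bar> \<le> \<bar>x - y\<bar>" for x y :: real by (simp add: max_def)
      have 1: "\<bar>(if tail G e = v then max 0 (r - t) else 0) - (if tail G e = v then max 0 (r - s) else 0)\<bar> \<le> \<bar>t - s\<bar>"
        using max[of "r - t" "r - s"] by (simp add: abs_minus_commute)
      have 2: "\<bar>(if head G e = v then max 0 (t - (len e - r)) else 0) - (if head G e = v then max 0 (s - (len e - r)) else 0)\<bar> \<le> \<bar>t - s\<bar>"
        using max[of "t - (len e - r)" "s - (len e - r)"] by simp
      have "\<bar>(a + b) - (a' + b')\<bar> \<le> \<bar>a - a'\<bar> + \<bar>b - b'\<bar>" for a b a' b' :: real by linarith
      from order_trans[OF this add_mono[OF 1 2]] show ?thesis unfolding h_def by simp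
    qed
    show "right_slope (h e) s (m e s)" for e s
      unfolding h_def[abs_def] m_def using right_slope_max'[of r s] right_slope_max[of "len e - r" s]
      by (intro right_slope_add) auto
    show "left_slope (h e) s (m' e s)" for e s
      unfolding h_def[abs_def] m'_def using left_slope_max'[of r s] left_slope_max[of "len e - r" s]
      by (intro left_slope_add) auto
    show "(\<Sum>e | e \<in> arcs G \<and> tail G e = u. m e 0) + (\<Sum>e | e \<in> arcs G \<and> head G e = u. m' e (len e))
        = - Poly_Mapping.lookup ?D u" if u: "u \<in> verts G" for u
    proof -
      have ne: "u \<noteq> \<phi> e t" if "e \<in> arcs G" "0 < t" "t < len e" for e t
        using \<phi>_not_vert[OF that] u by blast
      have "(\<Sum>e | e \<in> arcs G \<and> tail G e = u. m e 0) = (\<Sum>e | e \<in> arcs G \<and> tail G e = u. if tail G e = v then - 1 else 0)"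
      proof (intro sum.cong refl)
        fix e assume "e \<in> {e. e \<in> arcs G \<and> tail G e = u}"
        then show "m e 0 = (if tail G e = v then - 1 else 0)" using in_edge[of e] by (auto simp: m_def)
      qed
      moreover have "(\<Sum>e | e \<in> arcs G \<and> head G e = u. m' e (len e)) = (\<Sum>e | e \<in> arcs G \<and> head G e = u. if head G e = v then - 1 else 0)"
      proof (intro sum.cong refl)
        fix e assume "e \<in> {e. e \<in> arcs G \<and> head G e = u}"
        then show "m' e (len e) = (if head G e = v then - 1 else 0)" using in_edge[of e] by (auto simp: m'_def)
      qed
      moreover have "Poly_Mapping.lookup ?D u = (\<Sum>e | e \<in> arcs G \<and> tail G e = v. if u = v then 1 else 0)
          + (\<Sum>e | e \<in> arcs G \<and> head G e = v. if u = v then 1 else 0)"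
        unfolding lookup_D
      proof (intro arg_cong2[where f = "(+)"] sum.cong refl)
        fix e assume "e \<in> {e. e \<in> arcs G \<and> tail G e = v}"
        then show "(if u = v then 1 else 0) - (if u = \<phi> e r then 1 else 0) = (if u = v then 1 else 0 :: int)"
          using ne[of e r] in_edge[of e] by auto
      next
        fix e assume "e \<in> {e. e \<in> arcs G \<and> head G e = v}"
        then show "(if u = v then 1 else 0) - (if u = \<phi> e (len e - r) then 1 else 0) = (if u = v then 1 else 0 :: int)"
          using ne[of e "len e - r"] in_edge[of e] by auto
      qed
      ultimately show ?thesis by (cases "u = v") (simp_all add: sum_negf)
    qed
    show "m e s + m' e s = - Poly_Mapping.lookup ?D (\<phi> e s)" if e: "e \<in> arcs G" "0 < s" "s < len e" for e s
    proof -
      have ne: "\<phi> e s \<noteq> v" using \<phi>_not_vert[OF e] v by blast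
      have "Poly_Mapping.lookup ?D (\<phi> e s) =
          (\<Sum>a | a \<in> arcs G \<and> tail G a = v. if a = e then if s = r then - 1 else 0 else 0)
          + (\<Sum>a | a \<in> arcs G \<and> head G a = v. if a = e then if s = len e - r then - 1 else 0 else 0)"
        unfolding lookup_D
      proof (intro arg_cong2[where f = "(+)"] sum.cong refl)
        fix a assume "a \<in> {a. a \<in> arcs G \<and> tail G a = v}"
        then show "(if \<phi> e s = v then 1 else 0) - (if \<phi> e s = \<phi> a r then 1 else 0) =
            (if a = e then if s = r then - 1 else 0 else 0 :: int)"
          using ne \<phi>_eq_iff[OF e, of a r] in_edge[of a] by auto
      next
        fix a assume "a \<in> {a. a \<in> arcs G \<and> head G a = v}"
        then show "(if \<phi> e s = v then 1 else 0) - (if \<phi> e s = \<phi> a (len a - r) then 1 else 0) =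
            (if a = e then if s = len e - r then - 1 else 0 else 0 :: int)"
          using ne \<phi>_eq_iff[OF e, of a "len a - r"] in_edge[of a] by auto
      qed
      also have "\<dots> = (if tail G e = v then if s = r then - 1 else 0 else 0)
          + (if head G e = v then if s = len e - r then - 1 else 0 else 0)"
        using e by (simp add: sum.delta')
      finally show ?thesis by (simp add: m_def m'_def)
    qed
  qed
qed

text \<open>The points at \<open>0\<close> and \<open>x + y\<close>, and likewise those at
  \<open>x\<close> and \<open>y\<close>, are symmetric about \<open>t\<close>. By
  \<open>edge_tent\<close> both sums are equivalent to twice the point at \<open>t\<close>.\<close>

lemma frag_of_additive:
  assumes e: "e \<in> arcs G" and xy: "0 \<le> x" "0 \<le> y" "x + y \<le> len e"
  shows "frag_of (\<phi> e (x + y)) + frag_of (\<phi> e 0) \<doteq> frag_of (\<phi> e x) + frag_of (\<phi> e y)"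
proof -
  define t where "t = (x + y) / 2"
  have sym: "frag_of (\<phi> e (t - r)) + frag_of (\<phi> e (t + r)) \<doteq> frag_of (\<phi> e t) + frag_of (\<phi> e t)"
    if "0 \<le> r" "r \<le> t" for r
  proof (cases "r = 0")
    case False
    have "t + r \<le> len e" using that xy by (simp add: t_def field_simps)
    then show ?thesis using edge_tent[OF e, of r t] that False by (simp add: eqv_def)
  qed simp
  have "frag_of (\<phi> e (t - t)) + frag_of (\<phi> e (t + t)) \<doteq> frag_of (\<phi> e t) + frag_of (\<phi> e t)"
    using xy by (intro sym) (simp_all add: t_def)
  also have "\<dots> \<doteq> frag_of (\<phi> e (t - \<bar>x - y\<bar> / 2)) + frag_of (\<phi> e (t + \<bar>x - y\<bar> / 2))"
    using xy by (intro eqv_sym[OF sym]) (auto simp: t_def abs_if)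
  also have "\<dots> = frag_of (\<phi> e x) + frag_of (\<phi> e y)"
  proof (cases "x \<le> y")
    case True
    then have "t - \<bar>x - y\<bar> / 2 = x" "t + \<bar>x - y\<bar> / 2 = y" by (simp_all add: t_def field_simps)
    then show ?thesis by simp
  next
    case False
    then have "t - \<bar>x - y\<bar> / 2 = y" "t + \<bar>x - y\<bar> / 2 = x" by (simp_all add: t_def field_simps)
    then show ?thesis by (simp add: add.commute)
  qed
  finally show ?thesis by (simp add: t_def add.commute)
qed

text \<open>The difference between a point and the tail is additive as long as one stays on the
  edge, and \<open>extend_additive\<close> turns it into \<open>\<delta>\<close>. Kirchhoff's law
  holds for small positive arguments by \<open>vertex_tent\<close> and spreads to all reals by
  additivity.\<close>

lemma ex_tropical_graph:
  obtains \<delta> where "tropical_graph (Prin \<Gamma>) (verts G) (arcs G) (tail G) (head G) len \<delta> frag_of"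
    and "\<And>e t. e \<in> arcs G \<Longrightarrow> 0 \<le> t \<Longrightarrow> t \<le> len e \<Longrightarrow> frag_of (\<phi> e t) \<doteq> frag_of (tail G e) + \<delta> e t"
proof -
  have "\<exists>d. (\<forall>x y. d (x + y) \<doteq> d x + d y) \<and>
      (\<forall>x. 0 \<le> x \<longrightarrow> x \<le> len e \<longrightarrow> d x \<doteq> frag_of (\<phi> e x) - frag_of (\<phi> e 0))" if e: "e \<in> arcs G" for e
  proof -
    have "frag_of (\<phi> e (x + y)) - frag_of (\<phi> e 0) \<doteq>
        (frag_of (\<phi> e x) - frag_of (\<phi> e 0)) + (frag_of (\<phi> e y) - frag_of (\<phi> e 0))"
      if "0 \<le> x" "0 \<le> y" "x + y \<le> len e" for x y
      using frag_of_additive[OF e that] by (simp add: eqv_def algebra_simps)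
    from extend_additive[where h = "\<lambda>x. frag_of (\<phi> e x) - frag_of (\<phi> e 0)", OF this len_pos[OF e]]
    show ?thesis by metis
  qed
  then have "\<forall>e\<in>arcs G. \<exists>d. (\<forall>x y. d (x + y) \<doteq> d x + d y) \<and>
      (\<forall>x. 0 \<le> x \<longrightarrow> x \<le> len e \<longrightarrow> d x \<doteq> frag_of (\<phi> e x) - frag_of (\<phi> e 0))" by (rule ballI)
  from this[unfolded bchoice_iff] obtain \<delta> where
    "\<forall>e\<in>arcs G. (\<forall>x y. \<delta> e (x + y) \<doteq> \<delta> e x + \<delta> e y) \<and>
      (\<forall>x. 0 \<le> x \<longrightarrow> x \<le> len e \<longrightarrow> \<delta> e x \<doteq> frag_of (\<phi> e x) - frag_of (\<phi> e 0))" by (rule exE)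
  then have add: "\<delta> e (x + y) \<doteq> \<delta> e x + \<delta> e y"
    and \<delta>: "0 \<le> x \<Longrightarrow> x \<le> len e \<Longrightarrow> \<delta> e x \<doteq> frag_of (\<phi> e x) - frag_of (\<phi> e 0)" if "e \<in> arcs G" for e x y
    using that by blast+
  have frag: "frag_of (\<phi> e t) \<doteq> frag_of (tail G e) + \<delta> e t" if "e \<in> arcs G" "0 \<le> t" "t \<le> len e" for e t
    using eqv_sym[OF \<delta>[OF that]] \<phi>_0[OF that(1)] by (simp add: eqv_def algebra_simps)
  have \<delta>0: "\<delta> e 0 \<doteq> 0" if "e \<in> arcs G" for e
    using \<delta>[OF that, of 0] len_pos[OF that] by simp
  have minus: "\<delta> e (- x) \<doteq> - \<delta> e x" if e: "e \<in> arcs G" for e x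
  proof -
    have "\<delta> e x + \<delta> e (- x) \<doteq> 0" using eqv_trans[OF eqv_sym[OF add[OF e, of x "- x"]], of 0] \<delta>0[OF e] by simp
    then show ?thesis by (simp add: eqv_def add.commute)
  qed
  define K where "K v x = (\<Sum>e\<in>arcs G. frag_cmul (of_bool (tail G e = v) - of_bool (head G e = v)) (\<delta> e x))" for v x
  obtain \<epsilon> where \<epsilon>: "0 < \<epsilon>" "\<And>e. e \<in> arcs G \<Longrightarrow> 2 * \<epsilon> \<le> len e" by (rule ex_small) blast
  have small: "K v r \<in> Prin \<Gamma>" if v: "v \<in> verts G" and r: "0 < r" "r < \<epsilon>" for v r
  proof -
    have len: "2 * r < len e" if "e \<in> arcs G" for e using \<epsilon>(2)[OF that] r by linarith
    have "K v r = (\<Sum>e\<in>arcs G. if tail G e = v then \<delta> e r else 0) - (\<Sum>e\<in>arcs G. if head G e = v then \<delta> e r else 0)"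
      unfolding K_def sum_subtractf[symmetric] by (intro sum.cong) (auto simp: frag_cmul_diff_distrib)
    also have "\<dots> = (\<Sum>e | e \<in> arcs G \<and> tail G e = v. \<delta> e r) - (\<Sum>e | e \<in> arcs G \<and> head G e = v. \<delta> e r)"
      by (simp add: sum.inter_filter)
    also have "\<dots> \<doteq> (\<Sum>e | e \<in> arcs G \<and> tail G e = v. - (frag_of v - frag_of (\<phi> e r)))
        - (\<Sum>e | e \<in> arcs G \<and> head G e = v. frag_of v - frag_of (\<phi> e (len e - r)))"
    proof (intro eqv_diff eqv_sum)
      fix e assume "e \<in> {e. e \<in> arcs G \<and> tail G e = v}"
      then show "\<delta> e r \<doteq> - (frag_of v - frag_of (\<phi> e r))" using \<delta>[of e r] len[of e] r \<phi>_0[of e] by simp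
    next
      fix e assume "e \<in> {e. e \<in> arcs G \<and> head G e = v}"
      then have e: "e \<in> arcs G" "head G e = v" by auto
      \<comment> \<open>By additivity \<open>\<delta> e r\<close> is also the displacement along the
        last stretch of the edge, which is the one next to \<open>v\<close>.\<close>
      have "\<delta> e (len e) \<doteq> \<delta> e (len e - r) + \<delta> e r" using add[OF e(1), of "len e - r" r] by simp
      from eqv_diff[OF this eqv_refl[of "\<delta> e (len e - r)"]]
      have "\<delta> e r \<doteq> \<delta> e (len e) - \<delta> e (len e - r)" by (simp add: eqv_sym)
      also have "\<dots> \<doteq> (frag_of (\<phi> e (len e)) - frag_of (\<phi> e 0)) - (frag_of (\<phi> e (len e - r)) - frag_of (\<phi> e 0))"
        using len[OF e(1)] r by (intro eqv_diff \<delta> e) auto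
      finally show "\<delta> e r \<doteq> frag_of v - frag_of (\<phi> e (len e - r))" using \<phi>_len[OF e(1)] e(2) by simp
    qed
    also have "\<dots> \<doteq> 0"
      using uminus_mem[OF vertex_tent[OF v r(1) len]] by (simp add: eqv_0_iff sum_negf del: minus_diff_eq)
    finally show ?thesis by (simp add: eqv_0_iff)
  qed
  have pos: "K v x \<in> Prin \<Gamma>" if v: "v \<in> verts G" and x: "0 < x" for v x
  proof -
    obtain n where n: "x / \<epsilon> < real n" using reals_Archimedean2 by blast
    moreover have "0 < x / \<epsilon>" using x \<epsilon>(1) by simp
    ultimately have "0 < real n" by linarith
    then have n': "0 < n" "x / real n < \<epsilon>" "0 < x / real n"
      using n x \<epsilon>(1) by (auto simp: field_simps)
    have mult: "\<delta> e x \<doteq> frag_cmul (int n) (\<delta> e (x / real n))" if "e \<in> arcs G" for e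
      using eqv_cmul_of_additive[of x "\<delta> e" "x / real n" n] add[OF that] n' x by simp
    have "K v x \<doteq> (\<Sum>e\<in>arcs G. frag_cmul (of_bool (tail G e = v) - of_bool (head G e = v)) (frag_cmul (int n) (\<delta> e (x / real n))))"
      unfolding K_def by (intro eqv_sum eqv_cmul mult)
    also have "\<dots> = frag_cmul (int n) (K v (x / real n))"
      unfolding K_def frag_cmul_sum by (simp add: mult.commute)
    also have "\<dots> \<doteq> 0" using small[OF v n'(3,2)] cmul_mem by (simp add: eqv_0_iff)
    finally show ?thesis by (simp add: eqv_0_iff)
  qed
  have kirchhoff: "K v x \<in> Prin \<Gamma>" if v: "v \<in> verts G" for v x
  proof (cases x "0 :: real" rule: linorder_cases)
    case less
    have "K v x \<doteq> - K v (- x)"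
      unfolding K_def sum_negf[symmetric] frag_cmul_minus2[symmetric]
      using minus[of _ "- x"] by (intro eqv_sum eqv_cmul) auto
    also have "\<dots> \<doteq> 0" using pos[OF v, of "- x"] less uminus_mem by (simp add: eqv_0_iff)
    finally show ?thesis by (simp add: eqv_0_iff)
  next
    case equal
    have "K v x \<doteq> (\<Sum>e\<in>arcs G. frag_cmul (of_bool (tail G e = v) - of_bool (head G e = v)) 0)"
      unfolding K_def equal by (intro eqv_sum eqv_cmul \<delta>0)
    then show ?thesis by (simp add: eqv_0_iff)
  qed (rule pos[OF v])
  have "tropical_graph (Prin \<Gamma>) (verts G) (arcs G) (tail G) (head G) len \<delta> frag_of"
  proof unfold_locales
    show "frag_of (head G e) - (frag_of (tail G e) + \<delta> e (len e)) \<in> Prin \<Gamma>" if "e \<in> arcs G" for e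
      using frag[OF that, of "len e"] \<phi>_len[OF that] len_pos[OF that] by (simp add: eqv_def)
  qed (use verts_ne G_cut_conn len_pos add kirchhoff in \<open>auto simp: eqv_def K_def\<close>)
  then show ?thesis using that frag by blast
qed

end

section \<open>Rigidity of interior chips\<close>

text \<open>Continuity induction at the infimum of the points where \<open>h\<close> differs from
  \<open>\<mu>\<close>: by continuity \<open>h\<close> equals \<open>\<mu>\<close> there, and then
  also a little further on.\<close>

lemma constant_propagates_right:
  fixes h :: "real \<Rightarrow> real"
  assumes cont: "continuous_on {a..b} h" and a: "h a = \<mu>"
    and step: "\<And>t. a \<le> t \<Longrightarrow> t < b \<Longrightarrow> h t = \<mu> \<Longrightarrow> \<forall>\<^sub>F r in at_right 0. h (t + r) = \<mu>"
    and t: "t \<in> {a..b}"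
  shows "h t = \<mu>"
proof (rule ccontr)
  assume ne: "h t \<noteq> \<mu>"
  define M where "M = {u \<in> {a..b}. h u \<noteq> \<mu>}"
  define i where "i = Inf M"
  have M: "t \<in> M" "bdd_below M" using ne t by (auto simp: M_def intro: bdd_belowI[of _ a])
  have i: "a \<le> i" "i \<le> t" unfolding i_def using M
    by (auto intro!: cInf_greatest cInf_lower simp: M_def)
  have below: "h u = \<mu>" if "a \<le> u" "u < i" for u
  proof (rule ccontr)
    assume "h u \<noteq> \<mu>"
    then have "u \<in> M" using that i t by (auto simp: M_def)
    then have "i \<le> u" unfolding i_def using M(2) by (rule cInf_lower)
    then show False using that by simp
  qed
  have hi: "h i = \<mu>"
  proof (cases "i = a")
    case False
    then have ai: "a < i" using i by simp
    have "closed {u \<in> {a..b}. h u = \<mu>}"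
      using continuous_closed_preimage_constant[OF cont, of \<mu>] by (simp add: conj_commute)
    moreover have "{a..<i} \<subseteq> {u \<in> {a..b}. h u = \<mu>}" using below i t by auto
    ultimately have "closure {a..<i} \<subseteq> {u \<in> {a..b}. h u = \<mu>}" by (rule closure_minimal[rotated])
    then have "{a..i} \<subseteq> {u \<in> {a..b}. h u = \<mu>}" using ai by (simp add: closure_atLeastLessThan)
    then have "i \<in> {u \<in> {a..b}. h u = \<mu>}" by (rule subsetD) (use ai in simp)
    then show ?thesis by simp
  qed (simp add: a)
  have "i \<noteq> t" using hi ne by auto
  then have ib: "i < b" using i t by auto
  obtain \<epsilon> where \<epsilon>: "0 < \<epsilon>" "\<And>r. 0 < r \<Longrightarrow> r < \<epsilon> \<Longrightarrow> h (i + r) = \<mu>"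
    using step[OF i(1) ib hi] unfolding eventually_at_right_field by blast
  have "i + \<epsilon> \<le> u" if "u \<in> M" for u
  proof (rule ccontr)
    assume "\<not> i + \<epsilon> \<le> u"
    moreover have "i \<le> u" unfolding i_def using that M(2) by (rule cInf_lower)
    moreover have "u \<noteq> i" using that hi by (auto simp: M_def)
    ultimately have "h (i + (u - i)) = \<mu>" by (intro \<epsilon>(2)) auto
    then show False using that by (simp add: M_def)
  qed
  then have "i + \<epsilon> \<le> Inf M" using M(1) by (intro cInf_greatest) auto
  then show False using \<epsilon>(1) by (simp add: i_def)
qed

lemma constant_propagates_left:
  fixes h :: "real \<Rightarrow> real"
  assumes cont: "continuous_on {a..b} h" and b: "h b = \<mu>"
    and step: "\<And>t. a < t \<Longrightarrow> t \<le> b \<Longrightarrow> h t = \<mu> \<Longrightarrow> \<forall>\<^sub>F r in at_right 0. h (t - r) = \<mu>"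
    and t: "t \<in> {a..b}"
  shows "h t = \<mu>"
proof -
  have "continuous_on {a..b} (\<lambda>t. h (a + b - t))"
    by (intro continuous_on_compose2[OF cont] continuous_intros) auto
  moreover have "\<forall>\<^sub>F r in at_right 0. h (a + b - (t + r)) = \<mu>" if "a \<le> t" "t < b" "h (a + b - t) = \<mu>" for t
    using step[of "a + b - t"] that by (simp add: algebra_simps)
  ultimately have "h (a + b - (a + b - t)) = \<mu>"
    using constant_propagates_right[of a b "\<lambda>t. h (a + b - t)" \<mu> "a + b - t"] b t by simp
  then show ?thesis by simp
qed

context graph_model begin

text \<open>Compactness is used on each of the finitely many edges.\<close>

lemma attains_max:
  assumes cont: "continuous_map (mtopology_of \<Gamma>) euclideanreal f"
  obtains x where "x \<in> mspace \<Gamma>" "\<And>y. y \<in> mspace \<Gamma> \<Longrightarrow> f y \<le> f x"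
proof -
  have "\<forall>e\<in>arcs G. \<exists>t\<in>{0..len e}. \<forall>s\<in>{0..len e}. f (\<phi> e s) \<le> f (\<phi> e t)"
    using continuous_attains_sup[OF compact_Icc _ continuous_on_edge[OF cont]] less_imp_le[OF len_pos] by fastforce
  from this[unfolded bchoice_iff Bex_def] obtain \<tau> where \<tau>: "\<And>e. e \<in> arcs G \<Longrightarrow> \<tau> e \<in> {0..len e}"
    "\<And>e s. e \<in> arcs G \<Longrightarrow> s \<in> {0..len e} \<Longrightarrow> f (\<phi> e s) \<le> f (\<phi> e (\<tau> e))" by blast
  define C where "C = verts G \<union> (\<lambda>e. \<phi> e (\<tau> e)) ` arcs G"
  have C: "finite (f ` C)" "f ` C \<noteq> {}" using verts_ne by (auto simp: C_def)
  obtain x where x: "x \<in> C" "f x = Max (f ` C)" using Max_in[OF C] by auto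
  have "x \<in> mspace \<Gamma>" using x(1) vert_in_mspace \<phi>_in_mspace \<tau>(1) by (auto simp: C_def)
  moreover have "f y \<le> f x" if "y \<in> mspace \<Gamma>" for y
    using that
  proof (cases rule: mspace_cases)
    case 1
    then show ?thesis unfolding x(2) using C(1) by (intro Max_ge) (auto simp: C_def)
  next
    case (2 e t)
    have "f (\<phi> e t) \<le> f (\<phi> e (\<tau> e))" using 2 by (intro \<tau>(2)) auto
    also have "\<dots> \<le> f x" unfolding x(2) using C(1) 2 by (intro Max_ge) (auto simp: C_def)
    finally show ?thesis using 2 by simp
  qed
  ultimately show ?thesis using that by blast
qed

text \<open>At a maximum no increment is positive, so increments with sum zero all vanish.\<close>

lemma max_spreads_at_vertex:
  assumes max: "\<And>y. y \<in> mspace \<Gamma> \<Longrightarrow> f y \<le> f v" and v: "v \<in> verts G" and sl: "has_slope_sum \<Gamma> f v 0"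
  shows "\<forall>\<^sub>F r in at_right 0. \<forall>e\<in>arcs G. (tail G e = v \<longrightarrow> f (\<phi> e r) = f v) \<and> (head G e = v \<longrightarrow> f (\<phi> e (len e - r)) = f v)"
proof -
  obtain \<epsilon> where \<epsilon>: "0 < \<epsilon>" "\<And>e. e \<in> arcs G \<Longrightarrow> 2 * \<epsilon> \<le> len e" by (rule ex_small) blast
  from sl[unfolded has_slope_sum_vertex_iff[OF v]] eventually_le_len[OF \<epsilon>(1)]
  show ?thesis
  proof eventually_elim
    case (elim r)
    let ?A = "\<Sum>e | e \<in> arcs G \<and> tail G e = v. f (\<phi> e r) - f v"
    let ?B = "\<Sum>e | e \<in> arcs G \<and> head G e = v. f (\<phi> e (len e - r)) - f v"
    have le: "f (\<phi> e r) \<le> f v" "f (\<phi> e (len e - r)) \<le> f v" if "e \<in> arcs G" for e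
      using elim \<epsilon>(2)[OF that] that by (auto intro!: max \<phi>_in_mspace)
    have nonpos: "?A \<le> 0" "?B \<le> 0" using le by (auto intro!: sum_nonpos)
    have "?A + ?B = 0" using elim(1) by simp
    then have "- ?A = 0" "- ?B = 0" using nonpos by linarith+
    then have A: "(\<Sum>e | e \<in> arcs G \<and> tail G e = v. f v - f (\<phi> e r)) = 0"
      and B: "(\<Sum>e | e \<in> arcs G \<and> head G e = v. f v - f (\<phi> e (len e - r))) = 0"
      by (simp_all add: sum_negf[symmetric])
    have "f v - f (\<phi> e r) = 0" if "e \<in> arcs G" "tail G e = v" for e
      using A le that by (subst (asm) sum_nonneg_eq_0_iff) auto
    moreover have "f v - f (\<phi> e (len e - r)) = 0" if "e \<in> arcs G" "head G e = v" for e
      using B le that by (subst (asm) sum_nonneg_eq_0_iff) auto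
    ultimately show ?case by auto
  qed
qed

text \<open>At a maximum the two outgoing slopes are nonpositive integers with sum \<open>a\<close>.
  Integrality is essential: for \<open>a \<ge> - 1\<close> one of them vanishes, so a single chip
  blocks the maximum on at most one side.\<close>

lemma max_spreads_in_edge:
  assumes max: "\<And>y. y \<in> mspace \<Gamma> \<Longrightarrow> f y \<le> f (\<phi> e t)" and e: "e \<in> arcs G" "0 < t" "t < len e"
    and sl: "has_slope_sum \<Gamma> f (\<phi> e t) a" and a: "- 1 \<le> a"
  shows "\<forall>\<^sub>F r in at_right 0. (f (\<phi> e (t + r)) = f (\<phi> e t) \<or> f (\<phi> e (t - r)) = f (\<phi> e t)) \<and>
    (0 \<le> a \<longrightarrow> a = 0 \<and> f (\<phi> e (t + r)) = f (\<phi> e t) \<and> f (\<phi> e (t - r)) = f (\<phi> e t))"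
proof -
  have "0 < min t (len e - t)" using e by simp
  from sl[unfolded has_slope_sum_interior_iff[OF e]] eventually_le_len[OF this]
  show ?thesis
  proof eventually_elim
    case (elim r)
    have r: "0 < r" "r < t" "r < len e - t" using elim(2) by auto
    obtain k k' :: int where k: "f (\<phi> e (t + r)) - f (\<phi> e t) = of_int k * r"
      "f (\<phi> e (t - r)) - f (\<phi> e t) = of_int k' * r" using elim(1) by blast
    have "f (\<phi> e (t + r)) \<le> f (\<phi> e t)" "f (\<phi> e (t - r)) \<le> f (\<phi> e t)"
      by (rule max, rule \<phi>_in_mspace[OF e(1)]; use r e in simp)+
    then have "of_int k * r \<le> 0" "of_int k' * r \<le> 0" unfolding k[symmetric] by simp_all
    then have k0: "k \<le> 0" "k' \<le> 0" using r(1) by (simp_all add: mult_le_0_iff)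
    have "of_int k * r + of_int k' * r = of_int a * r" unfolding k[symmetric] by (rule conjunct1[OF elim(1)])
    then have "real_of_int (k + k') * r = of_int a * r" by (simp add: distrib_right)
    then have "real_of_int (k + k') = of_int a" using r(1) by simp
    then have "k + k' = a" by (simp only: of_int_eq_iff)
    then have kk: "k = 0 \<or> k' = 0" "0 \<le> a \<Longrightarrow> a = 0 \<and> k = 0 \<and> k' = 0" using k0 a by arith+
    have "f (\<phi> e (t + r)) = f (\<phi> e t)" if "k = 0" using k(1) that by simp
    moreover have "f (\<phi> e (t - r)) = f (\<phi> e t)" if "k' = 0" using k(2) that by simp
    ultimately show ?case using kk by blast
  qed
qed

text \<open>
  The maximum locus of a function relating the two configurations can only be left at a chip, and a
  single chip per edge does not suffice to separate it from its complement.
\<close>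

lemma interior_chips_rigid:
  assumes T: "T \<subseteq> arcs G" "cut_conn (tail G) (head G) T (verts G)"
    and s: "\<And>i. i \<in> arcs G - T \<Longrightarrow> 0 < s i \<and> s i < len i"
    and u: "\<And>i. i \<in> arcs G - T \<Longrightarrow> 0 < u i \<and> u i < len i"
    and P: "(\<Sum>i\<in>arcs G - T. frag_of (\<phi> i (s i))) - (\<Sum>i\<in>arcs G - T. frag_of (\<phi> i (u i))) \<in> Prin \<Gamma>" (is "?D \<in> _")
    and i: "i \<in> arcs G - T"
  shows "s i = u i"
proof -
  obtain f where cont: "continuous_map (mtopology_of \<Gamma>) euclideanreal f"
    and sl: "\<And>x. x \<in> mspace \<Gamma> \<Longrightarrow> has_slope_sum \<Gamma> f x (- Poly_Mapping.lookup ?D x)"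
    using P unfolding Prin_iff[OF metric_graph] by blast
  have lookup_D: "Poly_Mapping.lookup ?D x =
      (\<Sum>i\<in>arcs G - T. if x = \<phi> i (s i) then 1 else 0) - (\<Sum>i\<in>arcs G - T. if x = \<phi> i (u i) then 1 else 0)" for x
    by (simp add: lookup_minus lookup_sum)
  have D_vert: "Poly_Mapping.lookup ?D v = 0" if v: "v \<in> verts G" for v
  proof -
    have "v \<noteq> \<phi> i (s i)" "v \<noteq> \<phi> i (u i)" if "i \<in> arcs G - T" for i
      using \<phi>_not_vert[of i "s i"] \<phi>_not_vert[of i "u i"] s[OF that] u[OF that] that v by auto
    then show ?thesis unfolding lookup_D by simp
  qed
  have D_edge: "Poly_Mapping.lookup ?D (\<phi> e t) =
      (if e \<in> T then 0 else (if t = s e then 1 else 0) - (if t = u e then 1 else 0))"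
    if e: "e \<in> arcs G" "0 < t" "t < len e" for e t
  proof -
    have "(\<Sum>i\<in>arcs G - T. if \<phi> e t = \<phi> i (w i) then 1 else 0) = (if e \<in> T then 0 else if t = w e then 1 else (0::int))"
      if w: "\<And>i. i \<in> arcs G - T \<Longrightarrow> 0 < w i \<and> w i < len i" for w
    proof -
      have "(\<Sum>i\<in>arcs G - T. if \<phi> e t = \<phi> i (w i) then 1 else 0) = (\<Sum>i\<in>arcs G - T. if i = e then if t = w e then 1 else 0 else (0::int))"
      proof (intro sum.cong refl)
        fix i assume i: "i \<in> arcs G - T"
        have "\<phi> e t = \<phi> i (w i) \<longleftrightarrow> e = i \<and> t = w i" using w[OF i] i by (intro \<phi>_eq_iff e) auto
        then show "(if \<phi> e t = \<phi> i (w i) then 1 else 0) = (if i = e then if t = w e then 1 else 0 else (0::int))" by auto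
      qed
      then show ?thesis using e by simp
    qed
    from this[OF s] this[OF u] show ?thesis unfolding lookup_D by auto
  qed
  obtain x0 where x0: "x0 \<in> mspace \<Gamma>" "\<And>y. y \<in> mspace \<Gamma> \<Longrightarrow> f y \<le> f x0" by (rule attains_max[OF cont]) blast
  define \<mu> where "\<mu> = f x0"
  have h_cont: "continuous_on {a..b} (\<lambda>t. f (\<phi> e t))" if "e \<in> arcs G" "0 \<le> a" "b \<le> len e" for e a b
    using continuous_on_edge[OF cont that(1)] by (rule continuous_on_subset) (use that in auto)
  have at_vert: "\<forall>\<^sub>F r in at_right 0. \<forall>e\<in>arcs G. (tail G e = v \<longrightarrow> f (\<phi> e r) = \<mu>) \<and> (head G e = v \<longrightarrow> f (\<phi> e (len e - r)) = \<mu>)"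
    if "v \<in> verts G" "f v = \<mu>" for v
  proof -
    have "has_slope_sum \<Gamma> f v 0" using sl[OF vert_in_mspace[OF that(1)]] D_vert[OF that(1)] by simp
    moreover have "f y \<le> f v" if "y \<in> mspace \<Gamma>" for y using x0(2)[OF that] \<open>f v = \<mu>\<close> by (simp add: \<mu>_def)
    ultimately show ?thesis using max_spreads_at_vertex[of f v] that by simp
  qed
  have in_edge: "\<forall>\<^sub>F r in at_right 0. (f (\<phi> e (t + r)) = \<mu> \<or> f (\<phi> e (t - r)) = \<mu>) \<and>
      (e \<in> T \<or> t \<noteq> s e \<or> s e = u e \<longrightarrow> f (\<phi> e (t + r)) = \<mu> \<and> f (\<phi> e (t - r)) = \<mu>)"
    if e: "e \<in> arcs G" "0 < t" "t < len e" "f (\<phi> e t) = \<mu>" for e t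
  proof -
    define a where "a = - Poly_Mapping.lookup ?D (\<phi> e t)"
    have "has_slope_sum \<Gamma> f (\<phi> e t) a" unfolding a_def using e by (intro sl \<phi>_in_mspace) auto
    moreover have "f y \<le> f (\<phi> e t)" if "y \<in> mspace \<Gamma>" for y using x0(2)[OF that] e(4) by (simp add: \<mu>_def)
    \<comment> \<open>The slope sum is \<open>- 1\<close> only at a chip \<open>s e\<close> that
      does not coincide with \<open>u e\<close>; the maximum is blocked nowhere else.\<close>
    moreover have "- 1 \<le> a" "e \<in> T \<or> t \<noteq> s e \<or> s e = u e \<longrightarrow> 0 \<le> a" unfolding a_def D_edge[OF e(1-3)] by auto
    ultimately show ?thesis using max_spreads_in_edge[of f e t a] e by (auto elim!: eventually_mono)
  qed
  have right: "f (\<phi> e b) = \<mu>"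
    if e: "e \<in> arcs G" "0 \<le> a" "a \<le> b" "b \<le> len e" "f (\<phi> e a) = \<mu>"
      and ok: "\<And>t. 0 < t \<Longrightarrow> a \<le> t \<Longrightarrow> t < b \<Longrightarrow> e \<in> T \<or> t \<noteq> s e" for e a b
  proof (rule constant_propagates_right[of a b "\<lambda>t. f (\<phi> e t)"])
    fix t assume t: "a \<le> t" "t < b" "f (\<phi> e t) = \<mu>"
    show "\<forall>\<^sub>F r in at_right 0. f (\<phi> e (t + r)) = \<mu>"
    proof (cases "t = 0")
      case True
      then have "f (tail G e) = \<mu>" using t \<phi>_0[OF e(1)] by simp
      from at_vert[OF tail_in_verts[OF e(1)] this] show ?thesis by eventually_elim (use True e in auto)
    next
      case False
      then have t': "0 < t" "t < len e" using t e by auto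
      from in_edge[OF e(1) t' t(3)] show ?thesis by eventually_elim (use ok[OF t'(1) t(1,2)] in auto)
    qed
  qed (use e h_cont in auto)
  have left: "f (\<phi> e a) = \<mu>"
    if e: "e \<in> arcs G" "0 \<le> a" "a \<le> b" "b \<le> len e" "f (\<phi> e b) = \<mu>"
      and ok: "\<And>t. t < len e \<Longrightarrow> a < t \<Longrightarrow> t \<le> b \<Longrightarrow> e \<in> T \<or> t \<noteq> s e" for e a b
  proof (rule constant_propagates_left[of a b "\<lambda>t. f (\<phi> e t)"])
    fix t assume t: "a < t" "t \<le> b" "f (\<phi> e t) = \<mu>"
    show "\<forall>\<^sub>F r in at_right 0. f (\<phi> e (t - r)) = \<mu>"
    proof (cases "t = len e")
      case True
      then have "f (head G e) = \<mu>" using t \<phi>_len[OF e(1)] by simp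
      from at_vert[OF head_in_verts[OF e(1)] this] show ?thesis by eventually_elim (use True e in auto)
    next
      case False
      then have t': "0 < t" "t < len e" using t e by auto
      from in_edge[OF e(1) t' t(3)] show ?thesis by eventually_elim (use ok[OF t'(2) t(1,2)] in auto)
    qed
  qed (use e h_cont in auto)
  \<comment> \<open>Off the chip \<open>s e\<close> a maximum propagates to the end of the edge that
    is not behind the chip; a maximum at the chip first spreads to one of its sides.\<close>
  have "\<exists>v\<in>verts G. f v = \<mu>"
  proof (rule ccontr)
    assume none: "\<not> (\<exists>v\<in>verts G. f v = \<mu>)"
    have off_chip: "\<not> (0 < t \<and> t < len e \<and> f (\<phi> e t) = \<mu>)" if e: "e \<in> arcs G" "e \<in> T \<or> t \<noteq> s e" for e t
    proof
      assume t: "0 < t \<and> t < len e \<and> f (\<phi> e t) = \<mu>"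
      show False
      proof (cases "e \<in> T \<or> s e < t")
        case True
        have "f (\<phi> e (len e)) = \<mu>" by (rule right[OF e(1), of t]) (use t True in auto)
        then show False using none \<phi>_len[OF e(1)] head_in_verts[OF e(1)] by metis
      next
        case False
        have "f (\<phi> e 0) = \<mu>" by (rule left[OF e(1), of _ t]) (use t e False in auto)
        then show False using none \<phi>_0[OF e(1)] tail_in_verts[OF e(1)] by metis
      qed
    qed
    from x0(1) show False
    proof (cases rule: mspace_cases)
      case 1
      then show False using none unfolding \<mu>_def by blast
    next
      case (2 e t)
      have ft: "f (\<phi> e t) = \<mu>" using 2 by (simp add: \<mu>_def)
      then have t: "t = s e" "e \<notin> T" using off_chip[OF 2(1), of t] 2 by auto
      have "0 < min t (len e - t)" using 2 by simp
      from in_edge[OF 2(1-3) ft] eventually_le_len[OF this]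
      have "\<forall>\<^sub>F r in at_right 0. (f (\<phi> e (t + r)) = \<mu> \<or> f (\<phi> e (t - r)) = \<mu>) \<and> r < min t (len e - t)"
        by eventually_elim auto
      then obtain r where r: "0 < r" "(f (\<phi> e (t + r)) = \<mu> \<or> f (\<phi> e (t - r)) = \<mu>) \<and> r < min t (len e - t)"
        by (rule eventually_at_right_0_ex)
      then show False using off_chip[OF 2(1), of "t + r"] off_chip[OF 2(1), of "t - r"] t 2 by auto
    qed
  qed
  then obtain v0 where v0: "v0 \<in> verts G" "f v0 = \<mu>" by blast
  define R where "R = {v \<in> verts G. f v = \<mu>}"
  \<comment> \<open>Tree edges carry no chips, so the maximum passes along them to every
    vertex.\<close>
  have "R = verts G"
  proof (rule ccontr)
    assume "R \<noteq> verts G"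
    then have R: "R \<subset> verts G" "R \<noteq> {}" using v0 by (auto simp: R_def)
    from T(2) R obtain e where e: "e \<in> T" "joins (tail G) (head G) e R (verts G - R)" by (rule cut_connD)
    have eG: "e \<in> arcs G" using e T by auto
    have "f (\<phi> e 0) = \<mu> \<longleftrightarrow> f (\<phi> e (len e)) = \<mu>"
      using right[OF eG, of 0 "len e"] left[OF eG, of 0 "len e"] e(1) len_pos[OF eG] by auto
    then show False using e(2) \<phi>_0[OF eG] \<phi>_len[OF eG] by (auto simp: R_def joins_def)
  qed
  then have verts_max: "f v = \<mu>" if "v \<in> verts G" for v using that by (auto simp: R_def)
  have iG: "i \<in> arcs G" and si: "0 < s i" "s i < len i" using i s by auto
  have lo: "f (\<phi> i t) = \<mu>" if "0 \<le> t" "t \<le> s i" for t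
    by (rule right[OF iG, of 0]) (use that si verts_max[OF tail_in_verts[OF iG]] \<phi>_0[OF iG] in auto)
  have hi: "f (\<phi> i t) = \<mu>" if "s i \<le> t" "t \<le> len i" for t
    by (rule left[OF iG, of _ "len i"]) (use that si verts_max[OF head_in_verts[OF iG]] \<phi>_len[OF iG] in auto)
  have const: "f (\<phi> i t) = \<mu>" if "0 \<le> t" "t \<le> len i" for t using lo[of t] hi[of t] that by linarith
  have "0 < min (s i) (len i - s i)" using si by simp
  from sl[OF \<phi>_in_mspace[OF iG less_imp_le[OF si(1)] less_imp_le[OF si(2)]], unfolded has_slope_sum_interior_iff[OF iG si]]
    eventually_le_len[OF this]
  have "\<forall>\<^sub>F r in at_right 0. real_of_int (Poly_Mapping.lookup ?D (\<phi> i (s i))) * r = 0"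
  proof eventually_elim
    case (elim r)
    have "f (\<phi> i (s i + r)) = \<mu>" "f (\<phi> i (s i - r)) = \<mu>" "f (\<phi> i (s i)) = \<mu>"
      using elim(2) si by (auto intro!: const)
    with conjunct1[OF elim(1)] show ?case by simp
  qed
  then obtain r where "0 < r" "real_of_int (Poly_Mapping.lookup ?D (\<phi> i (s i))) * r = 0"
    by (rule eventually_at_right_0_ex)
  then have "Poly_Mapping.lookup ?D (\<phi> i (s i)) = 0" by simp
  \<comment> \<open>The edge \<open>i\<close> is reached from both ends, so \<open>f\<close> is
    constant on it and the divisor vanishes at \<open>s i\<close>. For
    \<open>s i \<noteq> u i\<close> its coefficient there would be \<open>1\<close>.\<close>
  then have "(if s i = u i then 1 else 0) = (1 :: int)" using i unfolding D_edge[OF iG si] by simp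
  then show ?thesis by (simp split: if_splits)
qed

end

section \<open>The Jacobian\<close>

lemma carrier_Div0: "carrier (Div0 \<Gamma>) = {D. Poly_Mapping.keys D \<subseteq> mspace \<Gamma> \<and> deg D = 0}"
  and mult_Div0 [simp]: "D \<otimes>\<^bsub>Div0 \<Gamma>\<^esub> D' = D + D'"
  and one_Div0 [simp]: "\<one>\<^bsub>Div0 \<Gamma>\<^esub> = 0"
  by (auto simp: Div0_def Div_def kernel_def)

lemma comm_group_Div0: "comm_group (Div0 \<Gamma>)"
proof (rule comm_groupI)
  fix D assume "D \<in> carrier (Div0 \<Gamma>)"
  then show "\<exists>D'\<in>carrier (Div0 \<Gamma>). D' \<otimes>\<^bsub>Div0 \<Gamma>\<^esub> D = \<one>\<^bsub>Div0 \<Gamma>\<^esub>"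
    using deg_diff[of 0 D] by (intro bexI[of _ "- D"]) (auto simp: carrier_Div0)
next
  fix D D' assume D: "D \<in> carrier (Div0 \<Gamma>)" "D' \<in> carrier (Div0 \<Gamma>)"
  then have "Poly_Mapping.keys (D + D') \<subseteq> mspace \<Gamma>" using keys_add[of D D'] by (auto simp: carrier_Div0)
  then show "D \<otimes>\<^bsub>Div0 \<Gamma>\<^esub> D' \<in> carrier (Div0 \<Gamma>)" using D by (simp add: carrier_Div0 deg_add)
qed (auto simp: carrier_Div0 add_ac)

lemma pow_Div0: "D [^]\<^bsub>Div0 \<Gamma>\<^esub> (n :: nat) = frag_cmul (int n) D"
proof -
  interpret comm_group "Div0 \<Gamma>" by (rule comm_group_Div0)
  show ?thesis by (induction n) (simp_all add: frag_cmul_distrib add.commute)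
qed

lemma r_coset_Div0: "P #>\<^bsub>Div0 \<Gamma>\<^esub> D = {x. x - D \<in> P}"
  unfolding r_coset_def by (auto simp: algebra_simps intro!: bexI[of _ "_ - D"])

lemma Prin_normal: "metric_graph \<Gamma> \<Longrightarrow> Prin \<Gamma> \<lhd> Div0 \<Gamma>"
  unfolding comm_group.normal_iff_subgroup[OF comm_group_Div0]
proof
  assume "metric_graph \<Gamma>"
  then interpret frag_subgroup "Prin \<Gamma>" by (rule frag_subgroup_Prin)
  interpret comm_group "Div0 \<Gamma>" by (rule comm_group_Div0)
  show "Prin \<Gamma> \<subseteq> carrier (Div0 \<Gamma>)" using Prin_subset by (auto simp: carrier_Div0)
  show "D \<otimes>\<^bsub>Div0 \<Gamma>\<^esub> D' \<in> Prin \<Gamma>" if "D \<in> Prin \<Gamma>" "D' \<in> Prin \<Gamma>" for D D' using add_mem[OF that] by simp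
  show "\<one>\<^bsub>Div0 \<Gamma>\<^esub> \<in> Prin \<Gamma>" by (simp add: zero_mem)
  show "inv\<^bsub>Div0 \<Gamma>\<^esub> D \<in> Prin \<Gamma>" if D: "D \<in> Prin \<Gamma>" for D
  proof -
    have "inv\<^bsub>Div0 \<Gamma>\<^esub> D = - D"
      using Prin_subset[OF D] Prin_subset[OF uminus_mem[OF D]] by (intro inv_equality) (auto simp: carrier_Div0)
    then show ?thesis using uminus_mem[OF D] by simp
  qed
qed

context graph_model begin

lemma coset_eq_iff: "Prin \<Gamma> #>\<^bsub>Div0 \<Gamma>\<^esub> D = Prin \<Gamma> #>\<^bsub>Div0 \<Gamma>\<^esub> D' \<longleftrightarrow> D \<doteq> D'"
proof
  assume "Prin \<Gamma> #>\<^bsub>Div0 \<Gamma>\<^esub> D = Prin \<Gamma> #>\<^bsub>Div0 \<Gamma>\<^esub> D'"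
  moreover have "D \<in> Prin \<Gamma> #>\<^bsub>Div0 \<Gamma>\<^esub> D" by (simp add: r_coset_Div0 zero_mem)
  ultimately show "D \<doteq> D'" by (simp add: r_coset_Div0 eqv_def)
next
  assume D: "D \<doteq> D'"
  have "x \<doteq> D \<longleftrightarrow> x \<doteq> D'" for x
    using eqv_trans[OF _ D] eqv_trans[OF _ eqv_sym[OF D]] by blast
  then show "Prin \<Gamma> #>\<^bsub>Div0 \<Gamma>\<^esub> D = Prin \<Gamma> #>\<^bsub>Div0 \<Gamma>\<^esub> D'"
    by (simp add: r_coset_Div0 eqv_def)
qed

lemma torsion_Jac_iff:
  assumes D: "D \<in> carrier (Div0 \<Gamma>)"
  shows "Prin \<Gamma> #>\<^bsub>Div0 \<Gamma>\<^esub> D \<in> torsion (Jac \<Gamma>) \<longleftrightarrow> is_torsion D"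
proof -
  have one: "\<one>\<^bsub>Jac \<Gamma>\<^esub> = Prin \<Gamma> #>\<^bsub>Div0 \<Gamma>\<^esub> 0"
    by (simp add: Jac_def r_coset_Div0)
  have pow: "(Prin \<Gamma> #>\<^bsub>Div0 \<Gamma>\<^esub> D) [^]\<^bsub>Jac \<Gamma>\<^esub> n = Prin \<Gamma> #>\<^bsub>Div0 \<Gamma>\<^esub> frag_cmul (int n) D" for n :: nat
    unfolding Jac_def using normal.FactGroup_pow[OF Prin_normal[OF metric_graph] D, of n] by (simp add: pow_Div0)
  have "Prin \<Gamma> #>\<^bsub>Div0 \<Gamma>\<^esub> D \<in> carrier (Jac \<Gamma>)"
    using D by (auto simp: Jac_def carrier_FactGroup)
  then show ?thesis by (simp add: torsion_def is_torsion_def pow one coset_eq_iff eqv_0_iff)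
qed

lemma Abel_Jacobi_eq_iff:
  "Abel_Jacobi \<Gamma> d D p = Abel_Jacobi \<Gamma> d D q \<longleftrightarrow> (\<Sum>i<d. frag_of (p i)) \<doteq> (\<Sum>i<d. frag_of (q i))"
  unfolding Abel_Jacobi_def coset_eq_iff by (simp add: eqv_def)

lemma keys_sum_frag_of:
  assumes "\<And>i. i < d \<Longrightarrow> p i \<in> mspace \<Gamma>"
  shows "Poly_Mapping.keys (\<Sum>i<(d::nat). frag_of (p i)) \<subseteq> mspace \<Gamma>"
proof
  fix x assume x: "x \<in> Poly_Mapping.keys (\<Sum>i<d. frag_of (p i))"
  show "x \<in> mspace \<Gamma>"
  proof (rule ccontr)
    assume "x \<notin> mspace \<Gamma>"
    then have "x \<noteq> p i" if "i < d" for i using assms[OF that] by metis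
    then have "(\<Sum>i<d. if x = p i then 1 else 0 :: int) = 0" by simp
    then show False using x by (simp add: in_keys_iff lookup_sum)
  qed
qed

lemma Abel_Jacobi_torsion_iff:
  assumes D: "D \<in> carrier (Div \<Gamma>)" "deg D = int d" and p: "\<And>i. i < d \<Longrightarrow> p i \<in> mspace \<Gamma>"
  shows "Abel_Jacobi \<Gamma> d D p \<in> torsion (Jac \<Gamma>) \<longleftrightarrow> is_torsion ((\<Sum>i<d. frag_of (p i)) - D)"
  unfolding Abel_Jacobi_def
proof (rule torsion_Jac_iff)
  have "Poly_Mapping.keys ((\<Sum>i<d. frag_of (p i)) - D) \<subseteq> mspace \<Gamma>"
    using order_trans[OF keys_diff Un_least[OF keys_sum_frag_of[of d p, OF p]]] D(1) by (simp add: Div_def)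
  then show "(\<Sum>i<d. frag_of (p i)) - D \<in> carrier (Div0 \<Gamma>)"
    using D(2) by (simp add: carrier_Div0 deg_diff deg_sum)
qed

text \<open>
  Moving one chip on each edge outside a spanning tree along \<open>1/n\<close> of a period produces torsion
  classes, which are distinct for large \<open>n\<close>.
\<close>

lemma not_Manin_Mumford:
  assumes g: "int g = int (card (arcs G)) - int (card (verts G)) + 1" "1 \<le> g" and d: "g \<le> d"
  shows "\<not> Manin_Mumford \<Gamma> d"
proof
  assume MM: "Manin_Mumford \<Gamma> d"
  obtain v0 where v0: "v0 \<in> verts G" using verts_ne by blast
  obtain T where T: "T \<subseteq> arcs G" "cut_conn (tail G) (head G) T (verts G)" "card T + 1 = card (verts G)"
    by (rule ex_spanning_tree[OF finite_verts finite_arcs v0 G_cut_conn])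
  define I where "I = arcs G - T"
  have finI: "finite I" by (simp add: I_def)
  have "card I + card T = card (arcs G)"
    using card_Diff_subset[OF finite_subset[OF T(1) finite_arcs] T(1)] card_mono[OF finite_arcs T(1)] by (simp add: I_def)
  then have cI: "card I = g" using g T(3) by linarith
  then obtain i where i: "i \<in> I" using g(2) by fastforce
  obtain \<delta> where trop: "tropical_graph (Prin \<Gamma>) (verts G) (arcs G) (tail G) (head G) len \<delta> frag_of"
    and \<delta>: "\<And>e t. e \<in> arcs G \<Longrightarrow> 0 \<le> t \<Longrightarrow> t \<le> len e \<Longrightarrow> frag_of (\<phi> e t) \<doteq> frag_of (tail G e) + \<delta> e t"
    by (rule ex_tropical_graph) blast
  interpret T: tropical_graph "Prin \<Gamma>" "verts G" "arcs G" "tail G" "head G" len \<delta> frag_of by (rule trop)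
  obtain x where x: "0 < x i" "(\<Sum>j\<in>I. \<delta> j (x j)) \<in> Prin \<Gamma>"
    using T.ex_relation[OF T(1,2,3)] i unfolding I_def by blast
  obtain h where h: "bij_betw h {..<g} I" using ex_bij_betw_nat_finite[OF finI] cI by (metis atLeast0LessThan)
  \<comment> \<open>\<open>h\<close> numbers the \<open>g\<close> edges outside the tree. The
    remaining \<open>d - g\<close> chips are parked at \<open>v0\<close> and cancel in all
    differences.\<close>
  define q where "q w = (\<lambda>k\<in>{..<d}. if k < g then \<phi> (h k) (w (h k)) else v0)" for w
  define W where "W = {w. \<forall>j\<in>I. 0 < w j \<and> w j < len j}"
  have IG: "j \<in> arcs G" if "j \<in> I" for j using that by (simp add: I_def)
  have hI: "h k \<in> I" if "k < g" for k using h that by (auto simp: bij_betw_def)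
  have q_in: "q w \<in> {..<d} \<rightarrow>\<^sub>E mspace \<Gamma>" if "w \<in> W" for w
  proof -
    have "\<phi> (h k) (w (h k)) \<in> mspace \<Gamma>" if "k < g" for k
      using \<open>w \<in> W\<close> hI[OF that] by (intro \<phi>_in_mspace IG) (auto simp: W_def intro: less_imp_le)
    then show ?thesis using vert_in_mspace[OF v0] by (simp add: q_def)
  qed
  define R where "R = (\<Sum>k\<in>{g..<d}. frag_of v0)"
  have q_sum: "(\<Sum>k<d. frag_of (q w k)) = (\<Sum>j\<in>I. frag_of (\<phi> j (w j))) + R" for w
  proof -
    have "(\<Sum>k<d. frag_of (q w k)) = (\<Sum>k<g. frag_of (q w k)) + (\<Sum>k\<in>{g..<d}. frag_of (q w k))"
      using d by (metis atLeast0LessThan sum.atLeastLessThan_concat zero_le)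
    also have "(\<Sum>k\<in>{g..<d}. frag_of (q w k)) = R" unfolding R_def by (intro sum.cong) (auto simp: q_def)
    also have "(\<Sum>k<g. frag_of (q w k)) = (\<Sum>k<g. frag_of (\<phi> (h k) (w (h k))))"
      using d by (intro sum.cong) (auto simp: q_def)
    also have "\<dots> = (\<Sum>j\<in>I. frag_of (\<phi> j (w j)))" by (rule sum.reindex_bij_betw[OF h])
    finally show ?thesis .
  qed
  \<comment> \<open>The midpoints of the edges, displaced by an \<open>n\<close>-th part of the
    relation \<open>x\<close>.\<close>
  define w where "w n j = len j / 2 + x j / real n" for n j
  \<comment> \<open>For \<open>n > B\<close> the displacement on each of these edges is less than
    half its length, so the chips stay in the interior.\<close>
  define B where "B = (\<Sum>j\<in>I. 2 * \<bar>x j\<bar> / len j)"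
  have w: "w n \<in> W" if n: "B < real n" for n
    unfolding W_def
  proof (intro CollectI ballI)
    fix j assume j: "j \<in> I"
    have lp: "0 < len a" if "a \<in> I" for a using len_pos IG that by blast
    have "2 * \<bar>x j\<bar> / len j \<le> B" unfolding B_def
      using finI j lp by (intro member_le_sum) (auto intro!: divide_nonneg_pos)
    then have b: "2 * \<bar>x j\<bar> / len j < real n" using n by linarith
    moreover have "0 \<le> 2 * \<bar>x j\<bar> / len j" using lp[OF j] by simp
    ultimately have n0: "0 < real n" by linarith
    have "2 * \<bar>x j\<bar> < real n * len j" using b lp[OF j] by (simp add: field_simps)
    then have "\<bar>x j\<bar> / real n < len j / 2" using n0 by (simp add: field_simps)
    then have "\<bar>x j / real n\<bar> < len j / 2" using n0 by simp
    then have "x j / real n < len j / 2" "- (x j / real n) < len j / 2" by (simp_all only: abs_less_iff)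
    then show "0 < w n j \<and> w n j < len j" unfolding w_def by linarith
  qed
  define w0 where "w0 j = len j / 2" for j
  have w0: "w0 \<in> W" using len_pos IG by (auto simp: W_def w0_def)
  \<comment> \<open>The Manin--Mumford condition is refuted at this base divisor, with the moving
    chips at the midpoints, from which the displacements are measured.\<close>
  define D where "D = (\<Sum>k<d. frag_of (q w0 k))"
  have q0: "q w0 k \<in> mspace \<Gamma>" if "k < d" for k using q_in[OF w0] that by auto
  have "Poly_Mapping.keys D \<subseteq> mspace \<Gamma>" unfolding D_def by (rule keys_sum_frag_of) (rule q0)
  then have D: "D \<in> carrier (Div \<Gamma>)" "deg D = int d" by (simp_all add: Div_def D_def deg_sum)
  have eff: "effective D" by (simp add: effective_def D_def lookup_sum sum_nonneg)
  have fin: "finite (Abel_Jacobi \<Gamma> d D ` ({..<d} \<rightarrow>\<^sub>E mspace \<Gamma>) \<inter> torsion (Jac \<Gamma>))" (is "finite ?Z")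
    using MM D eff unfolding Manin_Mumford_def by blast
  have mem: "Abel_Jacobi \<Gamma> d D (q (w n)) \<in> ?Z" if n: "B < real n" "0 < n" for n
  proof
    show "Abel_Jacobi \<Gamma> d D (q (w n)) \<in> Abel_Jacobi \<Gamma> d D ` ({..<d} \<rightarrow>\<^sub>E mspace \<Gamma>)"
      using q_in[OF w[OF n(1)]] by (rule imageI)
    have qn: "q (w n) k \<in> mspace \<Gamma>" if "k < d" for k using q_in[OF w[OF n(1)]] that by auto
    have "(\<Sum>k<d. frag_of (q (w n) k)) - D = (\<Sum>j\<in>I. frag_of (\<phi> j (w n j)) - frag_of (\<phi> j (w0 j)))"
      unfolding D_def q_sum by (simp add: sum_subtractf)
    also have "\<dots> \<doteq> (\<Sum>j\<in>I. \<delta> j (x j / real n))"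
    proof (rule eqv_sum)
      fix j assume j: "j \<in> I"
      have b: "0 \<le> w n j" "w n j \<le> len j" "0 \<le> w0 j" "w0 j \<le> len j"
        using w[OF n(1)] w0 j by (auto simp: W_def intro: less_imp_le)
      have "frag_of (\<phi> j (w n j)) - frag_of (\<phi> j (w0 j)) \<doteq> (frag_of (tail G j) + \<delta> j (w n j)) - (frag_of (tail G j) + \<delta> j (w0 j))"
        using b by (intro eqv_diff \<delta> IG j)
      also have "\<dots> = \<delta> j (w n j) - \<delta> j (w0 j)" by simp
      also have "\<dots> \<doteq> \<delta> j (w n j - w0 j)" by (rule eqv_sym[OF T.\<delta>_diff[OF IG[OF j]]])
      also have "\<dots> = \<delta> j (x j / real n)" by (simp add: w_def w0_def)
      finally show "frag_of (\<phi> j (w n j)) - frag_of (\<phi> j (w0 j)) \<doteq> \<delta> j (x j / real n)" .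
    qed
    finally have eq: "(\<Sum>k<d. frag_of (q (w n) k)) - D \<doteq> (\<Sum>j\<in>I. \<delta> j (x j / real n))" .
    have "frag_cmul (int n) (\<Sum>j\<in>I. \<delta> j (x j / real n)) \<doteq> (\<Sum>j\<in>I. \<delta> j (x j))"
      unfolding frag_cmul_sum
    proof (rule eqv_sum)
      fix j assume j: "j \<in> I"
      show "frag_cmul (int n) (\<delta> j (x j / real n)) \<doteq> \<delta> j (x j)"
        using eqv_sym[OF T.\<delta>_mult[OF IG[OF j], of n "x j / real n"]] n(2) by simp
    qed
    also have "\<dots> \<doteq> 0" using x(2) by (simp add: eqv_0_iff)
    finally have "is_torsion (\<Sum>j\<in>I. \<delta> j (x j / real n))"
      unfolding is_torsion_def eqv_0_iff using n(2) by blast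
    then have "is_torsion ((\<Sum>k<d. frag_of (q (w n) k)) - D)" by (rule is_torsion_cong[OF eq])
    then show "Abel_Jacobi \<Gamma> d D (q (w n)) \<in> torsion (Jac \<Gamma>)"
      using Abel_Jacobi_torsion_iff[OF D, of "q (w n)"] qn by simp
  qed
  have inj: "n = m" if nm: "B < real n" "0 < n" "B < real m" "0 < m"
    and eq: "Abel_Jacobi \<Gamma> d D (q (w n)) = Abel_Jacobi \<Gamma> d D (q (w m))" for n m
  proof -
    have "(\<Sum>j\<in>I. frag_of (\<phi> j (w n j))) - (\<Sum>j\<in>I. frag_of (\<phi> j (w m j))) \<in> Prin \<Gamma>"
      using eq unfolding Abel_Jacobi_eq_iff q_sum eqv_def by simp
    then have "w n i = w m i"
      using interior_chips_rigid[OF T(1,2), of "w n" "w m" i] w[OF nm(1)] w[OF nm(3)] i unfolding I_def W_def by blast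
    \<comment> \<open>Because \<open>x i > 0\<close>, different \<open>n\<close> give different
      positions on the edge \<open>i\<close>.\<close>
    then show ?thesis using x(1) nm by (simp add: w_def field_simps)
  qed
  define N where "N = {n. B < real n \<and> 0 < n}"
  have "inj_on (\<lambda>n. Abel_Jacobi \<Gamma> d D (q (w n))) N" by (rule inj_onI) (auto simp: N_def intro: inj)
  moreover have "(\<lambda>n. Abel_Jacobi \<Gamma> d D (q (w n))) ` N \<subseteq> ?Z" using mem by (auto simp: N_def)
  ultimately have "finite N" using fin by (meson finite_imageD finite_subset)
  moreover have "infinite N"
  proof -
    obtain n0 where n0: "B < real n0" using reals_Archimedean2 by blast
    have "{Suc n0..} \<subseteq> N" using n0 by (auto simp: N_def)
    then show ?thesis using infinite_Ici infinite_super by blast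
  qed
  ultimately show False by blast
qed

end

text \<open>The model behind the choice in \<open>genus\<close> is taken along with its value. That
  some natural number qualifies rests on \<open>card V \<le> card E + 1\<close> for connected
  graphs.\<close>

lemma genus_model:
  fixes \<Gamma> :: "'a metric"
  assumes "metric_graph \<Gamma>"
  obtains G :: "('a, nat) pre_digraph" and len \<phi> where "is_model \<Gamma> G len \<phi>"
    "int (genus \<Gamma>) = int (card (arcs G)) - int (card (verts G)) + 1"
proof -
  obtain G :: "('a, nat) pre_digraph" and len \<phi> where m: "is_model \<Gamma> G len \<phi>"
    using assms by (auto simp: metric_graph_def)
  interpret graph_model \<Gamma> G len \<phi> using m by unfold_locales
  have "card (verts G) \<le> card (arcs G) + 1"
    by (rule card_le_cut_conn[OF finite_verts finite_arcs G_cut_conn])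
  then have "int (card (arcs G) + 1 - card (verts G)) = int (card (arcs G)) - int (card (verts G)) + 1" by simp
  with m have "\<exists>g. \<exists>(G :: ('a, nat) pre_digraph) len \<phi>. is_model \<Gamma> G len \<phi> \<and>
      int g = int (card (arcs G)) - int (card (verts G)) + 1" by blast
  from someI_ex[OF this] show ?thesis unfolding genus_def[symmetric] using that by blast
qed

theorem theorem1p4:
  fixes \<Gamma> :: "'a metric" and g d :: nat
  assumes "metric_graph \<Gamma>"
    and "genus \<Gamma> = g" and "g \<ge> 1"
    and "d \<ge> 1"
    and "Manin_Mumford \<Gamma> d"
    and "D \<in> carrier (Div \<Gamma>)" and "effective D" and "deg D = int d"
  shows "card (Abel_Jacobi \<Gamma> d D ` ({..<d} \<rightarrow>\<^sub>E mspace \<Gamma>) \<inter> torsion (Jac \<Gamma>))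
           \<le> (3 * g - 3) choose d"
proof -
  obtain G :: "('a, nat) pre_digraph" and len \<phi> where m: "is_model \<Gamma> G len \<phi>"
    and "int (genus \<Gamma>) = int (card (arcs G)) - int (card (verts G)) + 1"
    by (rule genus_model[OF assms(1)])
  then have g: "int g = int (card (arcs G)) - int (card (verts G)) + 1" using assms(2) by simp
  interpret graph_model \<Gamma> G len \<phi> using m by unfold_locales
  have dg: "d < g" using not_Manin_Mumford[OF g assms(3)] assms(5) by (meson not_le)
  obtain \<delta> where trop: "tropical_graph (Prin \<Gamma>) (verts G) (arcs G) (tail G) (head G) len \<delta> frag_of"
    and \<delta>: "\<And>e t. e \<in> arcs G \<Longrightarrow> 0 \<le> t \<Longrightarrow> t \<le> len e \<Longrightarrow> frag_of (\<phi> e t) \<doteq> frag_of (tail G e) + \<delta> e t"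
    by (rule ex_tropical_graph) blast
  interpret T: tropical_graph "Prin \<Gamma>" "verts G" "arcs G" "tail G" "head G" len \<delta> frag_of by (rule trop)
  have is_point: "T.is_point (frag_of x)" if "x \<in> mspace \<Gamma>" for x
    using that
  proof (cases rule: mspace_cases)
    case 1
    then show ?thesis by (intro T.is_point_vertex[of x]) auto
  next
    case (2 e t)
    then show ?thesis using \<delta>[of e t] by (intro T.is_point_edge[of e t]) auto
  qed
  have ex_point: "\<exists>x\<in>mspace \<Gamma>. y \<doteq> frag_of x" if "T.is_point y" for y
    using that unfolding T.is_point_def
  proof (elim disjE bexE exE conjE)
    fix v assume "v \<in> verts G" "y \<doteq> frag_of v"
    then show ?thesis using vert_in_mspace by blast
  next
    fix e t assume e: "e \<in> arcs G" "0 \<le> t" "t \<le> len e" "y \<doteq> frag_of (tail G e) + \<delta> e t"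
    then have "y \<doteq> frag_of (\<phi> e t)" using eqv_trans[OF _ eqv_sym[OF \<delta>]] by blast
    then show ?thesis using \<phi>_in_mspace[OF e(1-3)] by blast
  qed
  let ?div = "\<lambda>p. \<Sum>i<d. frag_of (p i)" and ?PE = "{..<d} \<rightarrow>\<^sub>E mspace \<Gamma>"
  let ?Z = "Abel_Jacobi \<Gamma> d D ` ?PE \<inter> torsion (Jac \<Gamma>)"
  have finZ: "finite ?Z" using assms(5-8) unfolding Manin_Mumford_def by blast
  have "\<forall>z\<in>?Z. \<exists>p. p \<in> ?PE \<and> Abel_Jacobi \<Gamma> d D p = z" by blast
  from this[unfolded bchoice_iff] obtain p where
    p': "\<forall>z\<in>?Z. p z \<in> ?PE \<and> Abel_Jacobi \<Gamma> d D (p z) = z" by (rule exE)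
  have p: "p z \<in> ?PE \<and> Abel_Jacobi \<Gamma> d D (p z) = z" if "z \<in> ?Z" for z by (rule bspec[OF p' that])
  \<comment> \<open>One divisor for each torsion class in the image; \<open>p\<close> has chosen the
    points.\<close>
  define A where "A = (\<lambda>z. ?div (p z)) ` ?Z"
  have tors: "Abel_Jacobi \<Gamma> d D r \<in> torsion (Jac \<Gamma>) \<longleftrightarrow> is_torsion (?div r - D)" if "r \<in> ?PE" for r
    using that by (intro Abel_Jacobi_torsion_iff assms) auto
  have "inj_on (\<lambda>z. ?div (p z)) ?Z"
  proof (rule inj_onI)
    fix y z assume yz: "y \<in> ?Z" "z \<in> ?Z" "?div (p y) = ?div (p z)"
    then have "Abel_Jacobi \<Gamma> d D (p y) = Abel_Jacobi \<Gamma> d D (p z)" by (simp add: Abel_Jacobi_def)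
    then show "y = z" using p yz by metis
  qed
  then have cA: "card A = card ?Z" unfolding A_def by (rule card_image)
  \<comment> \<open>\<open>A\<close> serves twice: as the family to be counted and as the finite set
    of representatives of all torsion classes.\<close>
  have "card A \<le> 3 * (card (arcs G) - card (verts G)) choose d"
  proof (rule T.torsion_bound_genus[where F = A and D = D])
    \<comment> \<open>From \<open>1 \<le> d < g\<close>, so that \<open>g \<ge> 2\<close>.\<close>
    show "card (verts G) < card (arcs G)" "d + card (verts G) \<le> card (arcs G) + 1"
      using g dg assms(4) by linarith+
    show "finite A" using finZ by (simp add: A_def)
    show "T.is_point_sum d x \<and> is_torsion (x - D)" if "x \<in> A" for x
    proof -
      obtain z where z: "z \<in> ?Z" "x = ?div (p z)" using \<open>x \<in> A\<close> by (auto simp: A_def)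
      have "p z i \<in> mspace \<Gamma>" if "i < d" for i using p[OF z(1)] that by auto
      then have "T.is_point_sum d x"
        unfolding T.is_point_sum_def z(2) by (intro exI[of _ "\<lambda>i. frag_of (p z i)"]) (simp add: is_point)
      moreover have "is_torsion (x - D)" using tors[of "p z"] p[OF z(1)] z by auto
      ultimately show ?thesis ..
    qed
    show "x = y" if "x \<in> A" "y \<in> A" "x \<doteq> y" for x y
    proof -
      obtain u z where uz: "u \<in> ?Z" "z \<in> ?Z" "x = ?div (p u)" "y = ?div (p z)" using \<open>x \<in> A\<close> \<open>y \<in> A\<close> by (auto simp: A_def)
      then have "Abel_Jacobi \<Gamma> d D (p u) = Abel_Jacobi \<Gamma> d D (p z)" using \<open>x \<doteq> y\<close> by (simp add: Abel_Jacobi_eq_iff)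
      then have "u = z" using p uz by metis
      then show ?thesis using uz by simp
    qed
    show "\<exists>r\<in>A. x \<doteq> r" if x: "T.is_point_sum d x" "is_torsion (x - D)" for x
    proof -
      obtain y where y: "\<And>i. i < d \<Longrightarrow> T.is_point (y i)" "x \<doteq> (\<Sum>i<d. y i)"
        using x(1) unfolding T.is_point_sum_def by blast
      have "\<forall>i\<in>{..<d}. \<exists>a. a \<in> mspace \<Gamma> \<and> y i \<doteq> frag_of a" using ex_point y(1) by blast
      from this[unfolded bchoice_iff] obtain r where r: "\<And>i. i < d \<Longrightarrow> r i \<in> mspace \<Gamma> \<and> y i \<doteq> frag_of (r i)" by blast
      define r' where "r' = restrict r {..<d}"
      have r': "r' \<in> ?PE" using r by (simp add: r'_def)
      have "(\<Sum>i<d. y i) \<doteq> ?div r'" using r by (intro eqv_sum) (simp add: r'_def)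
      then have xr: "x \<doteq> ?div r'" using eqv_trans y(2) by blast
      have "is_torsion (?div r' - D)"
        using x(2) by (rule is_torsion_cong[OF eqv_diff[OF eqv_sym[OF xr] eqv_refl]])
      then have z: "Abel_Jacobi \<Gamma> d D r' \<in> ?Z" using tors[OF r'] r' by blast
      then have "?div r' \<doteq> ?div (p (Abel_Jacobi \<Gamma> d D r'))" 
        using p[OF z] Abel_Jacobi_eq_iff[of d D r' "p (Abel_Jacobi \<Gamma> d D r')"] by simp
      then have "x \<doteq> ?div (p (Abel_Jacobi \<Gamma> d D r'))" using eqv_trans xr by blast
      moreover have "?div (p (Abel_Jacobi \<Gamma> d D r')) \<in> A" using z by (simp add: A_def)
      ultimately show ?thesis by blast
    qed
  qed
  moreover have "3 * (card (arcs G) - card (verts G)) = 3 * g - 3" using g assms(3) by linarith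
  ultimately show ?thesis by (simp add: cA)
qed

end
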